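(* Let $G$ be a lacunary hyperbolic group with an approximating sequence $(G_k,S_k)_{k\in\mathbb{N}}$, hyperbolicity constants $\delta_k$ and natural epimorphisms $\eta_k\colon G_k\to G$ as described in the context. Assume that $G$ has property $(\mathrm{F}\mathbb{R})$ and $$\lim_{k\to+\infty}\frac{\mathrm{inj}(\eta_k)}{\delta_k^3}=\infty.$$ Then there exists $A>0$ such that for all $k$ large enough, the set $$U_k=\left\{\Phi\in\mathrm{Out}(G) : \max\{\|\Phi\|,\|\Phi^{-1}\|\}\le A\delta_k\right\}$$ is a subgroup of $\mathrm{Out}(G)$.
   Context: Setting: $G$ is a lacunary hyperbolic group with a finite generating set $S$ for which $(G,S)$ is the direct limit of a sequence of groups with finite generating sets and epimorphisms $\alpha_k\colon(G_k,S_k)\to(G_{k+1},S_{k+1})$, $k\in\mathbb{N}$, with $\alpha_k(S_k)=S_{k+1}$, such that: (1) the Cayley graph of $G_k$ with respect to $S_k$ is $\delta_k$-hyperbolic ($\delta_k>0$; every side of a geodesic triangle lies in the $\delta_k$-neighbourhood of the union of the other two); (2) $\lim_{k\to\infty}\mathrm{inj}(\eta_k)/\delta_k=\infty$, where $\eta_k\colon G_k\to G$ is the natural epimorphism (so $\eta_k(S_k)=S$) and $\mathrm{inj}(\eta_k)\in\mathbb{N}\cup\{\infty\}$ is the largest $R$ such that $\eta_k$ is injective on every ball of radius $R$ of $G_k$ for the word metric of $S_k$. (Existence of such a sequence characterizes lacunary hyperbolic groups.) Convention on the constants $\delta_k$: $G_k$ admits a presentation with generating set $S_k$ whose relators have length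 at most $10\delta_k$. A group has property $(\mathrm{F}\mathbb{R})$ if every action of it by isometries on an $\mathbb{R}$-tree has a global fixed point. For $g\in G$, $|g|_S$ is the word length and $\iota_g$ is the inner automorphism $x\mapsto gxg^{-1}$. For an endomorphism $\phi$ of $G$, $|\phi|=\max_{s\in S}|\phi(s)|_S$ and $\|\phi\|=\inf_{g\in G}|\iota_g\circ\phi|$. For $\Phi\in\mathrm{Out}(G)$, $\|\Phi\|=\|\phi\|$ for any representative $\phi\in\mathrm{Aut}(G)$. *)

theory Defs
  imports "HOL-Analysis.Analysis" "HOL-Algebra.Algebra"
begin

section \<open>Words, word metrics and presentations\<close>

text \<open>A letter \<open>(s, True)\<close> stands for \<open>s\<close> and \<open>(s, False)\<close> for the formal inverse of \<open>s\<close>.\<close>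

type_synonym 'a group_word = "('a \<times> bool) list"

definition words :: "'a set \<Rightarrow> 'a group_word set" where
  "words S = lists (S \<times> UNIV)"

definition word_val :: "('a, 'm) monoid_scheme \<Rightarrow> 'a group_word \<Rightarrow> 'a" where
  "word_val G w =
     foldr (\<lambda>(s, b) x. (if b then s else inv\<^bsub>G\<^esub> s) \<otimes>\<^bsub>G\<^esub> x) w \<one>\<^bsub>G\<^esub>"

definition word_length :: "('a, 'm) monoid_scheme \<Rightarrow> 'a set \<Rightarrow> 'a \<Rightarrow> nat" where
  "word_length G S g = (LEAST n. \<exists>w\<in>words S. length w = n \<and> word_val G w = g)"

definition word_dist :: "('a, 'm) monoid_scheme \<Rightarrow> 'a set \<Rightarrow> 'a \<Rightarrow> 'a \<Rightarrow> nat" where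
  "word_dist G S g h = word_length G S (inv\<^bsub>G\<^esub> g \<otimes>\<^bsub>G\<^esub> h)"

definition finite_generating_set :: "'a monoid \<Rightarrow> 'a set \<Rightarrow> bool" where
  "finite_generating_set G S \<longleftrightarrow>
     finite S \<and> S \<subseteq> carrier G \<and> generate G S = carrier G"

text \<open>The congruence on words whose quotient is the group \<open>\<langle>S | R\<rangle>\<close>.\<close>

inductive presentation_eq :: "'a set \<Rightarrow> 'a group_word set \<Rightarrow> 'a group_word \<Rightarrow> 'a group_word \<Rightarrow> bool"
  for S :: "'a set" and R :: "'a group_word set" where
  refl: "w \<in> words S \<Longrightarrow> presentation_eq S R w w"
| sym: "presentation_eq S R v w \<Longrightarrow> presentation_eq S R w v"
| trans: "presentation_eq S R u v \<Longrightarrow> presentation_eq S R v w \<Longrightarrow> presentation_eq S R u w"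
| cancel: "u \<in> words S \<Longrightarrow> v \<in> words S \<Longrightarrow> s \<in> S \<Longrightarrow>
     presentation_eq S R (u @ [(s, b), (s, \<not> b)] @ v) (u @ v)"
| relator: "u \<in> words S \<Longrightarrow> v \<in> words S \<Longrightarrow> r \<in> R \<Longrightarrow>
     presentation_eq S R (u @ r @ v) (u @ v)"

definition is_presentation :: "'a monoid \<Rightarrow> 'a set \<Rightarrow> 'a group_word set \<Rightarrow> bool" where
  "is_presentation G S R \<longleftrightarrow>
     S \<subseteq> carrier G \<and> generate G S = carrier G \<and> R \<subseteq> words S \<and>
     (\<forall>v\<in>words S. \<forall>w\<in>words S. word_val G v = word_val G w \<longleftrightarrow> presentation_eq S R v w)"


section \<open>Hyperbolicity and real trees\<close>

definition geodesic_segment :: "'x set \<Rightarrow> ('x \<Rightarrow> 'x \<Rightarrow> real) \<Rightarrow> 'x \<Rightarrow> 'x \<Rightarrow> 'x set \<Rightarrow> bool" where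
  "geodesic_segment M d x y A \<longleftrightarrow>
     (\<exists>\<gamma>. \<gamma> 0 = x \<and> \<gamma> (d x y) = y \<and>
          (\<forall>s\<in>{0..d x y}. \<forall>t\<in>{0..d x y}. d (\<gamma> s) (\<gamma> t) = \<bar>s - t\<bar>) \<and>
          A = \<gamma> ` {0..d x y} \<and> A \<subseteq> M)"

definition geodesic_space :: "'x set \<Rightarrow> ('x \<Rightarrow> 'x \<Rightarrow> real) \<Rightarrow> bool" where
  "geodesic_space M d \<longleftrightarrow> (\<forall>x\<in>M. \<forall>y\<in>M. \<exists>A. geodesic_segment M d x y A)"

text \<open>
  It is enough to bound the side \<open>A\<close>, since the three sides may be permuted cyclically.
  Neighbourhoods are closed.
\<close>

definition hyperbolic :: "real \<Rightarrow> 'x set \<Rightarrow> ('x \<Rightarrow> 'x \<Rightarrow> real) \<Rightarrow> bool" where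
  "hyperbolic \<delta> M d \<longleftrightarrow>
     (\<forall>x\<in>M. \<forall>y\<in>M. \<forall>z\<in>M. \<forall>A B C.
        geodesic_segment M d x y A \<and> geodesic_segment M d y z B \<and> geodesic_segment M d z x C \<longrightarrow>
        (\<forall>p\<in>A. \<exists>q\<in>B \<union> C. d p q \<le> \<delta>))"

definition real_tree :: "'x set \<Rightarrow> ('x \<Rightarrow> 'x \<Rightarrow> real) \<Rightarrow> bool" where
  "real_tree T d \<longleftrightarrow> T \<noteq> {} \<and> Metric_space T d \<and> geodesic_space T d \<and> hyperbolic 0 T d"

definition isometric_action ::
  "'a monoid \<Rightarrow> 'x set \<Rightarrow> ('x \<Rightarrow> 'x \<Rightarrow> real) \<Rightarrow> ('a \<Rightarrow> 'x \<Rightarrow> 'x) \<Rightarrow> bool" where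
  "isometric_action G T d \<rho> \<longleftrightarrow> group_action G T \<rho> \<and>
     (\<forall>g\<in>carrier G. \<forall>x\<in>T. \<forall>y\<in>T. d (\<rho> g x) (\<rho> g y) = d x y)"

text \<open>
  HOL cannot quantify over trees of all types, so the trees here have their points in the type
  \<^typ>\<open>real\<close>. For countable \<open>G\<close>, in particular for finitely generated \<open>G\<close>, this is no restriction:
  the theorem \<open>property_FR_all_types\<close> below gives fixed points in real trees over arbitrary types.
\<close>

definition property_FR :: "'a monoid \<Rightarrow> bool" where
  "property_FR G \<longleftrightarrow>
     (\<forall>(T :: real set) d \<rho>. real_tree T d \<and> isometric_action G T d \<rho> \<longrightarrow>
        (\<exists>x\<in>T. \<forall>g\<in>carrier G. \<rho> g x = x))"


section \<open>Cayley graphs\<close>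

text \<open>
  Points of the geometric realization are given by barycentric coordinates; \<open>edge_point u v t\<close> is
  the point at distance \<open>t\<close> from \<open>u\<close> on the edge from \<open>u\<close> to \<open>v\<close>. The graph is simplicial:
  edges with the same endpoints are identified, and a generator equal to \<open>\<one>\<close> yields no loop.
\<close>

definition edge_point :: "'a \<Rightarrow> 'a \<Rightarrow> real \<Rightarrow> 'a \<Rightarrow> real" where
  "edge_point u v t = (\<lambda>w. (1 - t) * of_bool (w = u) + t * of_bool (w = v))"

definition cayley_graph :: "'a monoid \<Rightarrow> 'a set \<Rightarrow> ('a \<Rightarrow> real) set" where
  "cayley_graph G S =
     {edge_point u u 0 |u. u \<in> carrier G} \<union>
     {edge_point u (u \<otimes>\<^bsub>G\<^esub> s) t |u s t. u \<in> carrier G \<and> s \<in> S \<and> t \<in> {0..1}}"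

text \<open>\<open>cayley_path_length G S p q l\<close>: some piecewise linear path from \<open>p\<close> to \<open>q\<close> has length \<open>l\<close>.\<close>

inductive cayley_path_length ::
  "'a monoid \<Rightarrow> 'a set \<Rightarrow> ('a \<Rightarrow> real) \<Rightarrow> ('a \<Rightarrow> real) \<Rightarrow> real \<Rightarrow> bool"
  for G :: "'a monoid" and S :: "'a set" and p :: "'a \<Rightarrow> real" where
  start: "p \<in> cayley_graph G S \<Longrightarrow> cayley_path_length G S p p 0"
| step: "cayley_path_length G S p (edge_point u (u \<otimes>\<^bsub>G\<^esub> s) a) l \<Longrightarrow>
     u \<in> carrier G \<Longrightarrow> s \<in> S \<Longrightarrow> a \<in> {0..1} \<Longrightarrow> b \<in> {0..1} \<Longrightarrow>
     cayley_path_length G S p (edge_point u (u \<otimes>\<^bsub>G\<^esub> s) b) (l + \<bar>a - b\<bar>)"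

definition cayley_dist :: "'a monoid \<Rightarrow> 'a set \<Rightarrow> ('a \<Rightarrow> real) \<Rightarrow> ('a \<Rightarrow> real) \<Rightarrow> real" where
  "cayley_dist G S p q = Inf {l. cayley_path_length G S p q l}"


section \<open>Lacunary hyperbolic groups\<close>

definition inj_radius :: "'b monoid \<Rightarrow> 'b set \<Rightarrow> ('b \<Rightarrow> 'a) \<Rightarrow> enat" where
  "inj_radius H S \<eta> =
     Sup {enat R |R. \<forall>x\<in>carrier H. inj_on \<eta> {y \<in> carrier H. word_dist H S x y \<le> R}}"

primrec iterated_map :: "(nat \<Rightarrow> 'b \<Rightarrow> 'b) \<Rightarrow> nat \<Rightarrow> nat \<Rightarrow> 'b \<Rightarrow> 'b" where
  "iterated_map \<alpha> k 0 = id"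
| "iterated_map \<alpha> k (Suc n) = \<alpha> (k + n) \<circ> iterated_map \<alpha> k n"

text \<open>
  \<open>G\<close> with the maps \<open>\<eta> k\<close> is a direct limit: every element of \<open>G\<close> comes from some stage, and two
  elements of a stage are identified in \<open>G\<close> precisely when they are identified at a later stage.
  The universal property is \<open>direct_limit_universal\<close> below.
\<close>

definition is_direct_limit ::
  "(nat \<Rightarrow> 'b monoid) \<Rightarrow> (nat \<Rightarrow> 'b \<Rightarrow> 'b) \<Rightarrow> 'a monoid \<Rightarrow> (nat \<Rightarrow> 'b \<Rightarrow> 'a) \<Rightarrow> bool" where
  "is_direct_limit Gs \<alpha> G \<eta> \<longleftrightarrow>
     (\<forall>k. \<alpha> k \<in> hom (Gs k) (Gs (Suc k))) \<and>
     (\<forall>k. \<eta> k \<in> hom (Gs k) G) \<and>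
     (\<forall>k. \<forall>x\<in>carrier (Gs k). \<eta> (Suc k) (\<alpha> k x) = \<eta> k x) \<and>
     (\<forall>g\<in>carrier G. \<exists>k. \<exists>x\<in>carrier (Gs k). \<eta> k x = g) \<and>
     (\<forall>k. \<forall>x\<in>carrier (Gs k). \<forall>y\<in>carrier (Gs k). \<eta> k x = \<eta> k y \<longrightarrow>
        (\<exists>n. iterated_map \<alpha> k n x = iterated_map \<alpha> k n y))"

locale lacunary_hyperbolic_approximation =
  fixes G :: "'a monoid" and S :: "'a set"
    and Gs :: "nat \<Rightarrow> 'b monoid" and Ss :: "nat \<Rightarrow> 'b set"
    and \<alpha> :: "nat \<Rightarrow> 'b \<Rightarrow> 'b" and \<eta> :: "nat \<Rightarrow> 'b \<Rightarrow> 'a" and \<delta> :: "nat \<Rightarrow> real"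
  assumes group_limit: "group G"
    and gen_limit: "finite_generating_set G S"
    and group_stage: "\<And>k. group (Gs k)"
    and gen_stage: "\<And>k. finite_generating_set (Gs k) (Ss k)"
    and epi: "\<And>k. \<alpha> k \<in> epi (Gs k) (Gs (Suc k))"
    and epi_gen: "\<And>k. \<alpha> k ` Ss k = Ss (Suc k)"
    and direct_limit: "is_direct_limit Gs \<alpha> G \<eta>"
    and limit_gen: "\<And>k. \<eta> k ` Ss k = S"
    and delta_pos: "\<And>k. \<delta> k > 0"
    and cayley_hyperbolic:
      "\<And>k. hyperbolic (\<delta> k) (cayley_graph (Gs k) (Ss k)) (cayley_dist (Gs k) (Ss k))"
    and inj_radius_lim:
      "(\<lambda>k. ereal_of_enat (inj_radius (Gs k) (Ss k) (\<eta> k)) / ereal (\<delta> k)) \<longlonglongrightarrow> \<infinity>"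
    and short_presentation:
      "\<And>k. \<exists>R. is_presentation (Gs k) (Ss k) R \<and> (\<forall>r\<in>R. real (length r) \<le> 10 * \<delta> k)"


section \<open>Outer automorphisms\<close>

definition inner_aut :: "('a, 'm) monoid_scheme \<Rightarrow> 'a \<Rightarrow> 'a \<Rightarrow> 'a" where
  "inner_aut G g = (\<lambda>x\<in>carrier G. g \<otimes>\<^bsub>G\<^esub> x \<otimes>\<^bsub>G\<^esub> inv\<^bsub>G\<^esub> g)"

definition Inn :: "('a, 'm) monoid_scheme \<Rightarrow> ('a \<Rightarrow> 'a) set" where
  "Inn G = inner_aut G ` carrier G"

definition Out :: "('a, 'm) monoid_scheme \<Rightarrow> ('a \<Rightarrow> 'a) set monoid" where
  "Out G = AutoGroup G Mod Inn G"

text \<open>The inserted \<open>0\<close> only matters when \<open>S\<close> is empty.\<close>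

definition endo_length :: "('a, 'm) monoid_scheme \<Rightarrow> 'a set \<Rightarrow> ('a \<Rightarrow> 'a) \<Rightarrow> nat" where
  "endo_length G S \<phi> = Max (insert 0 ((\<lambda>s. word_length G S (\<phi> s)) ` S))"

definition endo_norm :: "('a, 'm) monoid_scheme \<Rightarrow> 'a set \<Rightarrow> ('a \<Rightarrow> 'a) \<Rightarrow> nat" where
  "endo_norm G S \<phi> = (INF g\<in>carrier G. endo_length G S (inner_aut G g \<circ> \<phi>))"

text \<open>The choice of the representative is immaterial, see \<open>out_norm_eq\<close> below.\<close>

definition out_norm :: "('a, 'm) monoid_scheme \<Rightarrow> 'a set \<Rightarrow> ('a \<Rightarrow> 'a) set \<Rightarrow> nat" where
  "out_norm G S \<Phi> = endo_norm G S (SOME \<phi>. \<phi> \<in> \<Phi>)"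


section \<open>Justification of the definitions\<close>

lemma hyperbolicD:
  assumes "hyperbolic \<delta> M d" "x \<in> M" "y \<in> M" "z \<in> M"
    and "geodesic_segment M d x y A" "geodesic_segment M d y z B" "geodesic_segment M d z x C"
    and "p \<in> A"
  shows "\<exists>q\<in>B \<union> C. d p q \<le> \<delta>"
  using assms unfolding hyperbolic_def by blast

lemma geodesic_segment_dist:
  assumes "geodesic_segment M d x y A" "p \<in> A" "q \<in> A" "Metric_space M d"
  shows "d p q = \<bar>d x p - d x q\<bar>"
proof -
  interpret Metric_space M d by fact
  obtain c where c: "c 0 = x" "c (d x y) = y"
    "\<And>s t. s \<in> {0..d x y} \<Longrightarrow> t \<in> {0..d x y} \<Longrightarrow> d (c s) (c t) = \<bar>s - t\<bar>"
    "A = c ` {0..d x y}"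
    using assms(1) unfolding geodesic_segment_def by blast
  obtain s t where st: "s \<in> {0..d x y}" "p = c s" "t \<in> {0..d x y}" "q = c t"
    using assms(2,3) c(4) by blast
  have 0: "0 \<in> {0..d x y}" by simp
  have "d x p = s" using c(3)[OF 0 st(1)] st c(1) by auto
  moreover have "d x q = t" using c(3)[OF 0 st(3)] st c(1) by auto
  moreover have "d p q = \<bar>s - t\<bar>" using c(3) st by auto
  ultimately show ?thesis by simp
qed

lemma geodesic_segment_ends:
  assumes "geodesic_segment M d x y A" "Metric_space M d"
  shows "x \<in> A" "y \<in> A"
proof -
  interpret Metric_space M d by fact
  have I: "0 \<in> {0..d x y}" "d x y \<in> {0..d x y}" by simp_all
  obtain c where c: "c 0 = x" "c (d x y) = y"
    "\<And>s t. s \<in> {0..d x y} \<Longrightarrow> t \<in> {0..d x y} \<Longrightarrow> d (c s) (c t) = \<bar>s - t\<bar>"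
    "A = c ` {0..d x y}"
    using assms(1) unfolding geodesic_segment_def by blast
  show "x \<in> A" unfolding c(4) using c(1) I(1) by (metis imageI)
  show "y \<in> A" unfolding c(4) using c(2) I(2) by (metis imageI)
qed

lemma geodesic_segment_image:
  assumes "geodesic_segment M d x y A"
    and "\<And>p q. p \<in> A \<Longrightarrow> q \<in> A \<Longrightarrow> d' (f p) (f q) = d p q" and "f ` A \<subseteq> N"
    and "Metric_space M d"
  shows "geodesic_segment N d' (f x) (f y) (f ` A)"
proof -
  interpret Metric_space M d by fact
  obtain c where c: "c 0 = x" "c (d x y) = y"
    "\<And>s t. s \<in> {0..d x y} \<Longrightarrow> t \<in> {0..d x y} \<Longrightarrow> d (c s) (c t) = \<bar>s - t\<bar>"
    "A = c ` {0..d x y}"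
    using assms(1) unfolding geodesic_segment_def by blast
  have "x \<in> A" "y \<in> A" using c by (metis atLeastAtMost_iff imageI nonneg order_refl)+
  then have "d' (f x) (f y) = d x y" using assms(2) by blast
  then show ?thesis unfolding geodesic_segment_def using c assms(2,3)
    by (intro exI[of _ "f \<circ> c"]) (auto simp: image_comp)
qed

lemma real_tree_unique_point:
  assumes "real_tree T d" "geodesic_segment T d x y A" "geodesic_segment T d x y B"
    "p \<in> A" "q \<in> B" "d x p = d x q"
  shows "p = q"
proof -
  interpret Metric_space T d using assms(1) by (simp add: real_tree_def)
  have sub: "A \<subseteq> T" "B \<subseteq> T" using assms(2,3) unfolding geodesic_segment_def by auto
  obtain c where c: "c 0 = x" "c (d x y) = y"
    "\<And>s t. s \<in> {0..d x y} \<Longrightarrow> t \<in> {0..d x y} \<Longrightarrow> d (c s) (c t) = \<bar>s - t\<bar>"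
    "B = c ` {0..d x y}"
    using assms(3) unfolding geodesic_segment_def by blast
  have xy: "x \<in> B" "y \<in> B" using c by (metis atLeastAtMost_iff imageI nonneg order_refl)+
  have xyT: "x \<in> T" "y \<in> T" using xy sub by auto
  have B': "geodesic_segment T d y x B"
  proof -
    let ?c = "\<lambda>t. c (d x y - t)"
    have "z \<in> ?c ` {0..d x y}" if z: "z \<in> c ` {0..d x y}" for z
    proof -
      obtain t where "t \<in> {0..d x y}" "z = c t" using z by auto
      then show ?thesis by (intro image_eqI[of _ _ "d x y - t"]) auto
    qed
    then have "?c ` {0..d x y} = c ` {0..d x y}" by auto
    then show ?thesis unfolding geodesic_segment_def commute[of y x]
      using c sub by (intro exI[of _ ?c]) auto
  qed
  have X: "geodesic_segment T d x x {x}"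
    unfolding geodesic_segment_def using xyT by (intro exI[of _ "\<lambda>_. x"]) auto
  obtain r where r: "r \<in> B \<union> {x}" "d p r \<le> 0"
    using assms(1,2,4) B' X xyT unfolding real_tree_def hyperbolic_def by blast
  have "r \<in> B" using r xy by auto
  moreover have "p = r" using r(2) nonneg[of p r] zero sub assms(4) \<open>r \<in> B\<close>
    by (metis order_antisym subsetD)
  ultimately have "d p q = \<bar>d x p - d x q\<bar>"
    using geodesic_segment_dist[OF assms(3) _ assms(5) Metric_space_axioms] by blast
  then show ?thesis using assms(4-6) sub zero by (metis abs_zero diff_self subsetD)
qed

definition real_image :: "'x set \<Rightarrow> bool" where
  "real_image A \<longleftrightarrow> (\<exists>f :: real \<Rightarrow> 'x. A \<subseteq> range f)"

lemma real_image_mono: "real_image B \<Longrightarrow> A \<subseteq> B \<Longrightarrow> real_image A"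
  unfolding real_image_def by (meson subset_trans)

lemma surj_real_real2: "\<exists>h :: real \<Rightarrow> real \<times> real. surj h"
proof -
  have "|UNIV \<times> UNIV :: (real \<times> real) set| \<le>o |UNIV :: real set|"
    by (intro ordIso_imp_ordLeq card_of_Times_same_infinite) (rule infinite_UNIV_char_0)
  then show ?thesis using card_of_ordLeq2[of "UNIV :: (real \<times> real) set" "UNIV :: real set"]
    by auto
qed

lemma real_image_image2:
  assumes "real_image A" "real_image B"
  shows "real_image ((\<lambda>(a, b). g a b) ` (A \<times> B))"
proof -
  obtain f k :: "real \<Rightarrow> _" where f: "A \<subseteq> range f" and k: "B \<subseteq> range k"
    using assms unfolding real_image_def by blast
  obtain h :: "real \<Rightarrow> real \<times> real" where h: "surj h" using surj_real_real2 by blast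
  have "g a b \<in> range (\<lambda>t. g (f (fst (h t))) (k (snd (h t))))" if ab: "a \<in> A" "b \<in> B" for a b
  proof -
    obtain s t where "a = f s" "b = k t" using f k ab by blast
    moreover obtain r where "h r = (s, t)" using h by (metis surjD)
    ultimately show ?thesis by (intro image_eqI[of _ _ r]) auto
  qed
  then show ?thesis unfolding real_image_def by (intro exI) auto
qed

lemma real_image_countable:
  assumes "countable A" shows "real_image A"
proof (cases "A = {}")
  case False
  have "A \<subseteq> range (\<lambda>t :: real. from_nat_into A (nat \<lfloor>t\<rfloor>))"
  proof
    fix a assume "a \<in> A"
    then obtain n where "from_nat_into A n = a" using from_nat_into_surj[OF assms] by blast
    then show "a \<in> range (\<lambda>t :: real. from_nat_into A (nat \<lfloor>t\<rfloor>))"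
      by (intro image_eqI[of _ _ "real n"]) auto
  qed
  then show ?thesis unfolding real_image_def by blast
qed (auto simp: real_image_def)

lemma real_image_real: "real_image (UNIV :: real set)"
  unfolding real_image_def by (rule exI[of _ id]) simp

lemma real_image_UNION:
  assumes "\<And>n :: nat. real_image (A n)"
  shows "real_image (\<Union>n. A n)"
proof -
  obtain f where f: "\<And>n. A n \<subseteq> range (f n :: real \<Rightarrow> _)"
    using assms unfolding real_image_def by metis
  have "real_image ((\<lambda>(n, t). f n t) ` (UNIV \<times> UNIV))"
    by (rule real_image_image2[OF real_image_countable real_image_real]) simp
  moreover have "(\<Union>n. A n) \<subseteq> (\<lambda>(n, t). f n t) ` (UNIV \<times> UNIV)"
    using f by fastforce
  ultimately show ?thesis by (rule real_image_mono)
qed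

theorem property_FR_all_types:
  fixes T :: "'x set"
  assumes FR: "property_FR G" and G: "group G" and ctbl: "countable (carrier G)"
    and tree: "real_tree T d" and act: "isometric_action G T d \<rho>"
  shows "\<exists>x\<in>T. \<forall>g\<in>carrier G. \<rho> g x = x"
proof -
  interpret Metric_space T d using tree by (simp add: real_tree_def)
  interpret group_action G T \<rho> using act by (simp add: isometric_action_def)
  have iso: "d (\<rho> g x) (\<rho> g y) = d x y" if "g \<in> carrier G" "x \<in> T" "y \<in> T" for g x y
    using act that by (simp add: isometric_action_def)
  define seg where "seg = (\<lambda>x y. SOME A. geodesic_segment T d x y A)"
  have seg: "geodesic_segment T d x y (seg x y)" if "x \<in> T" "y \<in> T" for x y
    using tree that unfolding seg_def real_tree_def geodesic_space_def by (meson someI_ex)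
  have segT: "seg x y \<subseteq> T" if "x \<in> T" "y \<in> T" for x y
    using seg[OF that] unfolding geodesic_segment_def by blast
  have ends: "x \<in> A" "y \<in> A" if "geodesic_segment T d x y A" for x y A
    using geodesic_segment_ends[OF that Metric_space_axioms] by auto
  have uniq: "A = B" if AB: "geodesic_segment T d x y A" "geodesic_segment T d x y B" for x y A B
  proof -
    have le: "A \<subseteq> B" if AB: "geodesic_segment T d x y A" "geodesic_segment T d x y B" for A B
    proof
      fix p assume p: "p \<in> A"
      obtain c where c: "c 0 = x" "A = c ` {0..d x y}"
        "\<And>s t. s \<in> {0..d x y} \<Longrightarrow> t \<in> {0..d x y} \<Longrightarrow> d (c s) (c t) = \<bar>s - t\<bar>"
        using AB(1) unfolding geodesic_segment_def by blast
      obtain c' where c': "c' 0 = x" "B = c' ` {0..d x y}"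
        "\<And>s t. s \<in> {0..d x y} \<Longrightarrow> t \<in> {0..d x y} \<Longrightarrow> d (c' s) (c' t) = \<bar>s - t\<bar>"
        using AB(2) unfolding geodesic_segment_def by blast
      obtain t where t: "t \<in> {0..d x y}" "p = c t" using p c by blast
      have 0: "0 \<in> {0..d x y}" by simp
      have "d x p = d x (c' t)" using c(1) c'(1) c(3)[OF 0 t(1)] c'(3)[OF 0 t(1)] t by auto
      moreover have "c' t \<in> B" using c' t by blast
      ultimately show "p \<in> B" using real_tree_unique_point[OF tree AB p] by metis
    qed
    show ?thesis using le AB by blast
  qed
  obtain x0 where x0: "x0 \<in> T" using tree by (auto simp: real_tree_def)
  define Orb where "Orb = (\<lambda>g. \<rho> g x0) ` carrier G"
  define A where "A = rec_nat Orb (\<lambda>_ Y. \<Union>x\<in>Y. \<Union>y\<in>Y. seg x y)"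
  have A0: "A 0 = Orb" and AS: "A (Suc n) = (\<Union>x\<in>A n. \<Union>y\<in>A n. seg x y)" for n
    by (simp_all add: A_def)
  have AT: "A n \<subseteq> T" for n
  proof (induction n)
    case 0
    show ?case using x0 element_image by (auto simp: A0 Orb_def)
  next
    case (Suc n)
    then show ?case unfolding AS using segT by blast
  qed
  have A_mono: "A n \<subseteq> A (Suc n)" for n
  proof
    fix x assume x: "x \<in> A n"
    then have "x \<in> T" using AT by auto
    then have "x \<in> seg x x" using ends(1)[OF seg] by auto
    then show "x \<in> A (Suc n)" unfolding AS using x by auto
  qed
  have rho_seg: "\<rho> g ` seg x y = seg (\<rho> g x) (\<rho> g y)"
    if "g \<in> carrier G" "x \<in> T" "y \<in> T" for g x y
  proof (rule uniq)
    show "geodesic_segment T d (\<rho> g x) (\<rho> g y) (\<rho> g ` seg x y)"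
      by (rule geodesic_segment_image[OF seg[OF that(2,3)]])
        (use that segT[OF that(2,3)] iso[OF that(1)] element_image[OF that(1)] Metric_space_axioms
           in \<open>auto simp: subset_iff\<close>)
    show "geodesic_segment T d (\<rho> g x) (\<rho> g y) (seg (\<rho> g x) (\<rho> g y))"
      using that element_image by (intro seg) auto
  qed
  have A_inv: "\<rho> g x \<in> A n" if "g \<in> carrier G" "x \<in> A n" for g x n
    using that(2)
  proof (induction n arbitrary: x)
    case 0
    then obtain h where h: "h \<in> carrier G" "x = \<rho> h x0" by (auto simp: A0 Orb_def)
    then have "\<rho> g x = \<rho> (g \<otimes>\<^bsub>G\<^esub> h) x0"
      using composition_rule[OF x0 that(1)] by simp
    then show ?case using h that(1) G by (auto simp: A0 Orb_def group.is_monoid monoid.m_closed)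
  next
    case (Suc n)
    then obtain y z where yz: "y \<in> A n" "z \<in> A n" "x \<in> seg y z" by (auto simp: AS)
    then have "\<rho> g x \<in> seg (\<rho> g y) (\<rho> g z)"
      using rho_seg[OF that(1)] AT by blast
    then show ?case using Suc.IH yz by (auto simp: AS)
  qed
  have A_img: "real_image (A n)" for n
  proof (induction n)
    case 0
    show ?case unfolding A0 Orb_def by (intro real_image_countable countable_image ctbl)
  next
    case (Suc n)
    define c where "c = (\<lambda>x y. SOME c :: real \<Rightarrow> 'x. seg x y \<subseteq> range c)"
    have c: "seg x y \<subseteq> range (c x y)" if xy: "x \<in> T" "y \<in> T" for x y
    proof -
      obtain b :: "real \<Rightarrow> 'x" where "seg x y = b ` {0..d x y}"
        using seg[OF xy] unfolding geodesic_segment_def by (elim exE conjE) metis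
      then have "seg x y \<subseteq> range b" by auto
      then have "\<exists>c :: real \<Rightarrow> 'x. seg x y \<subseteq> range c" by (rule exI[of _ b])
      then show ?thesis unfolding c_def by (rule someI_ex)
    qed
    have "real_image ((\<lambda>(a, b). (a, b)) ` (A n \<times> A n))"
      by (rule real_image_image2[OF Suc Suc])
    then have "real_image ((\<lambda>(p, t). c (fst p) (snd p) t) `
        (((\<lambda>(a, b). (a, b)) ` (A n \<times> A n)) \<times> UNIV))"
      by (rule real_image_image2) (rule real_image_real)
    moreover have "A (Suc n) \<subseteq> (\<lambda>(p, t). c (fst p) (snd p) t) `
        (((\<lambda>(a, b). (a, b)) ` (A n \<times> A n)) \<times> UNIV)"
    proof
      fix z assume "z \<in> A (Suc n)"
      then obtain x y where xy: "x \<in> A n" "y \<in> A n" "z \<in> seg x y" by (auto simp: AS)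
      then obtain t where "z = c x y t" using c AT by blast
      then show "z \<in> (\<lambda>(p, t). c (fst p) (snd p) t) `
        (((\<lambda>(a, b). (a, b)) ` (A n \<times> A n)) \<times> UNIV)"
        using xy by (intro image_eqI[of _ _ "((x, y), t)"]) auto
    qed
    ultimately show ?case by (rule real_image_mono)
  qed
  define H where "H = (\<Union>n. A n)"
  obtain f :: "real \<Rightarrow> 'x" where f: "H \<subseteq> range f"
    using real_image_UNION[of A] A_img unfolding real_image_def H_def by blast
  have HT: "H \<subseteq> T" using AT by (auto simp: H_def)
  have H_seg: "seg x y \<subseteq> H" if xy: "x \<in> H" "y \<in> H" for x y
  proof -
    obtain m n where mn: "x \<in> A m" "y \<in> A n" using xy by (auto simp: H_def)
    have "x \<in> A (max m n)" "y \<in> A (max m n)"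
      using mn lift_Suc_mono_le[of A, OF A_mono] by (meson max.cobounded1 max.cobounded2 subsetD)+
    then have "seg x y \<subseteq> A (Suc (max m n))" by (auto simp: AS)
    then show ?thesis by (auto simp: H_def)
  qed
  have H_inv: "\<rho> g x \<in> H" if "g \<in> carrier G" "x \<in> H" for g x
    using that A_inv by (auto simp: H_def)
  define j where "j = inv_into UNIV f"
  have fj: "f (j x) = x" if "x \<in> H" for x
    using f that by (auto simp: j_def f_inv_into_f)
  define K where "K = j ` H"
  have jf: "j (f r) = r" "f r \<in> H" if "r \<in> K" for r
    using that fj by (auto simp: K_def)
  define e where "e = (\<lambda>r s. d (f r) (f s))"
  define \<sigma> where "\<sigma> = (\<lambda>g. \<lambda>r\<in>K. j (\<rho> g (f r)))"
  have mK: "Metric_space K e"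
  proof
    fix r s t
    show "0 \<le> e r s" "e r s = e s r" by (auto simp: e_def commute)
    show "e r s = 0 \<longleftrightarrow> r = s" if "r \<in> K" "s \<in> K"
      using jf[OF that(1)] jf[OF that(2)] HT zero unfolding e_def by (metis subsetD)
    show "e r t \<le> e r s + e s t" if "r \<in> K" "s \<in> K" "t \<in> K"
      unfolding e_def using that jf(2) HT by (intro triangle) auto
  qed
  have toT: "geodesic_segment T d (f r) (f s) (f ` B)" if "geodesic_segment K e r s B" for r s B
  proof (rule geodesic_segment_image[OF that])
    have "B \<subseteq> K" using that unfolding geodesic_segment_def by blast
    then show "f ` B \<subseteq> T" using jf HT by blast
  qed (use mK in \<open>simp_all add: e_def\<close>)
  have tK: "real_tree K e"
    unfolding real_tree_def
  proof (intro conjI mK)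
    have "x0 \<in> H"
    proof -
      have "\<rho> \<one>\<^bsub>G\<^esub> x0 = x0" using id_eq_one x0 by (metis restrict_apply')
      moreover have "\<one>\<^bsub>G\<^esub> \<in> carrier G" using G by (simp add: group.is_monoid)
      ultimately have "x0 \<in> A 0" unfolding A0 Orb_def by (metis imageI)
      then show ?thesis by (auto simp: H_def)
    qed
    then show "K \<noteq> {}" by (auto simp: K_def)
    show "geodesic_space K e"
      unfolding geodesic_space_def
    proof (intro ballI)
      fix r s assume rs: "r \<in> K" "s \<in> K"
      have fr: "f r \<in> H" "f s \<in> H" using jf rs by auto
      then have "geodesic_segment K e (j (f r)) (j (f s)) (j ` seg (f r) (f s))"
        using HT H_seg[OF fr] fj
        by (intro geodesic_segment_image[OF seg])
          (auto simp: e_def K_def Metric_space_axioms subset_iff)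
      then show "\<exists>B. geodesic_segment K e r s B" using jf rs by auto
    qed
    show "hyperbolic 0 K e"
      unfolding hyperbolic_def
    proof (intro ballI allI impI)
      fix x y z B C D p
      assume K: "x \<in> K" "y \<in> K" "z \<in> K" and p: "p \<in> B" and
        S: "geodesic_segment K e x y B \<and> geodesic_segment K e y z C \<and> geodesic_segment K e z x D"
      have fT: "f x \<in> T" "f y \<in> T" "f z \<in> T" using K jf HT by auto
      have "hyperbolic 0 T d" using tree by (simp add: real_tree_def)
      then have "\<exists>q\<in>f ` C \<union> f ` D. d (f p) q \<le> 0"
        by (rule hyperbolicD[OF _ fT]) (use toT S p in auto)
      then show "\<exists>q\<in>C \<union> D. e p q \<le> 0" by (auto simp: e_def)
    qed
  qed
  have sK: "\<sigma> g r \<in> K" "f (\<sigma> g r) = \<rho> g (f r)" if "g \<in> carrier G" "r \<in> K" for g r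
    using that H_inv jf fj by (auto simp: \<sigma>_def K_def)
  have s_comp: "\<sigma> (g \<otimes>\<^bsub>G\<^esub> h) r = \<sigma> g (\<sigma> h r)" 
    if "g \<in> carrier G" "h \<in> carrier G" "r \<in> K" for g h r
  proof -
    have "f r \<in> T" using jf that HT by auto
    then have "\<rho> (g \<otimes>\<^bsub>G\<^esub> h) (f r) = \<rho> g (\<rho> h (f r))"
      using composition_rule that by simp
    then show ?thesis using that sK by (simp add: \<sigma>_def)
  qed
  have s_one: "\<sigma> \<one>\<^bsub>G\<^esub> r = r" if "r \<in> K" for r
  proof -
    have "\<rho> \<one>\<^bsub>G\<^esub> (f r) = f r" using id_eq_one jf that HT by (metis restrict_apply' subsetD)
    then show ?thesis using that jf by (simp add: \<sigma>_def)
  qed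
  interpret G: group G by fact
  have s_bij: "bij_betw (\<sigma> g) K K" if "g \<in> carrier G" for g
    by (rule bij_betwI[of _ _ _ "\<sigma> (inv\<^bsub>G\<^esub> g)"])
      (use that sK s_comp[symmetric] s_one in auto)
  have s_Bij: "\<sigma> g \<in> Bij K" if "g \<in> carrier G" for g
    using s_bij[OF that] by (auto simp: Bij_def \<sigma>_def)
  have aK: "isometric_action G K e \<sigma>"
    unfolding isometric_action_def
  proof
    have "\<sigma> \<in> hom G (BijGroup K)"
    proof (rule homI)
      fix g h assume gh: "g \<in> carrier G" "h \<in> carrier G"
      show "\<sigma> g \<in> carrier (BijGroup K)" using s_Bij gh by (simp add: BijGroup_def)
      show "\<sigma> (g \<otimes>\<^bsub>G\<^esub> h) = \<sigma> g \<otimes>\<^bsub>BijGroup K\<^esub> \<sigma> h"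
      proof
        fix r show "\<sigma> (g \<otimes>\<^bsub>G\<^esub> h) r = (\<sigma> g \<otimes>\<^bsub>BijGroup K\<^esub> \<sigma> h) r"
          using gh s_Bij s_comp
          by (cases "r \<in> K") (auto simp: BijGroup_def compose_def, simp add: \<sigma>_def)
      qed
    qed
    then show "group_action G K \<sigma>"
      by (simp add: group_action_def group_hom_def group_hom_axioms_def G group_BijGroup)
    show "\<forall>g\<in>carrier G. \<forall>x\<in>K. \<forall>y\<in>K. e (\<sigma> g x) (\<sigma> g y) = e x y"
      unfolding e_def using sK(2) iso jf HT by (simp add: subset_iff)
  qed
  obtain r where r: "r \<in> K" "\<And>g. g \<in> carrier G \<Longrightarrow> \<sigma> g r = r"
    using FR[unfolded property_FR_def, rule_format, OF conjI, OF tK aK] by blast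
  then have "f r \<in> T" "\<And>g. g \<in> carrier G \<Longrightarrow> \<rho> g (f r) = f r"
    using jf HT sK(2)[OF _ r(1)] by (auto dest: sym)
  then show ?thesis by blast
qed

lemma (in group) inner_aut_hom: "inner_aut G \<in> hom G (AutoGroup G)"
proof -
  have eq: "inner_aut G = (\<lambda>g. \<lambda>h \<in> carrier G. g \<otimes> h \<otimes> inv g)"
    by (simp add: inner_aut_def fun_eq_iff)
  have hom: "inner_aut G \<in> hom G (BijGroup (carrier G))"
    unfolding eq by (rule conjugation_is_hom)
  have "inner_aut G g \<in> auto G" if g: "g \<in> carrier G" for g
  proof -
    have "inner_aut G g \<in> Bij (carrier G)"
      using hom_in_carrier[OF hom g] by (simp add: BijGroup_def)
    moreover have "inner_aut G g \<in> hom G G"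
    proof (rule homI)
      fix x y assume xy: "x \<in> carrier G" "y \<in> carrier G"
      have "inv g \<otimes> (g \<otimes> (y \<otimes> inv g)) = y \<otimes> inv g"
        using g xy by (simp add: m_assoc[symmetric])
      then show "inner_aut G g (x \<otimes> y) = inner_aut G g x \<otimes> inner_aut G g y"
        using g xy by (simp add: inner_aut_def m_assoc)
    qed (use g in \<open>simp add: inner_aut_def\<close>)
    ultimately show ?thesis by (simp add: auto_def)
  qed
  then show ?thesis using hom by (auto simp: hom_def AutoGroup_def)
qed

lemma (in group) AutoGroup_mult:
  assumes "\<phi> \<in> auto G" "\<psi> \<in> auto G"
  shows "\<phi> \<otimes>\<^bsub>AutoGroup G\<^esub> \<psi> = compose (carrier G) \<phi> \<psi>"
  using assms by (simp add: AutoGroup_def BijGroup_def auto_def)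

lemma (in group) auto_inner_aut:
  assumes "\<phi> \<in> auto G" "g \<in> carrier G"
  shows "\<phi> \<otimes>\<^bsub>AutoGroup G\<^esub> inner_aut G g = inner_aut G (\<phi> g) \<otimes>\<^bsub>AutoGroup G\<^esub> \<phi>"
proof -
  interpret f: group_hom G G \<phi>
    using assms by (unfold_locales) (simp add: auto_def)
  have "inner_aut G h \<in> auto G" if "h \<in> carrier G" for h
    using hom_in_carrier[OF inner_aut_hom that] by (simp add: AutoGroup_def)
  then show ?thesis
    using assms by (auto simp: AutoGroup_mult compose_def inner_aut_def fun_eq_iff)
qed

lemma (in group) Inn_normal: "Inn G \<lhd> AutoGroup G"
proof -
  interpret Aut: group "AutoGroup G" by (rule AutoGroup)
  have car: "carrier (AutoGroup G) = auto G" by (simp add: AutoGroup_def)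
  interpret inn: group_hom G "AutoGroup G" "inner_aut G"
    by unfold_locales (rule inner_aut_hom)
  have sub: "subgroup (Inn G) (AutoGroup G)"
    unfolding Inn_def by (rule inn.img_is_subgroup)
  have "\<phi> \<otimes>\<^bsub>AutoGroup G\<^esub> f \<otimes>\<^bsub>AutoGroup G\<^esub> inv\<^bsub>AutoGroup G\<^esub> \<phi> \<in> Inn G"
    if h: "\<phi> \<in> carrier (AutoGroup G)" "f \<in> Inn G" for \<phi> f
  proof -
    obtain g where g: "g \<in> carrier G" "f = inner_aut G g" using h by (auto simp: Inn_def)
    have "\<phi> g \<in> carrier G" using h g by (auto simp: car auto_def hom_def)
    moreover have "\<phi> \<otimes>\<^bsub>AutoGroup G\<^esub> f = inner_aut G (\<phi> g) \<otimes>\<^bsub>AutoGroup G\<^esub> \<phi>"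
      using auto_inner_aut h g by (simp add: car)
    ultimately show ?thesis
      using h inn.hom_closed by (simp add: Aut.m_assoc Inn_def)
  qed
  then show ?thesis using sub Aut.normal_inv_iff by blast
qed

lemma (in group) group_Out: "group (Out G)"
  unfolding Out_def by (rule normal.factorgroup_is_group[OF Inn_normal])

lemma (in group) endo_norm_inner_aut:
  assumes S: "S \<subseteq> carrier G" and h: "h \<in> carrier G" and \<phi>: "\<phi> \<in> auto G"
  shows "endo_norm G S (compose (carrier G) (inner_aut G h) \<phi>) = endo_norm G S \<phi>"
proof -
  have \<phi>S: "\<phi> s \<in> carrier G" if "s \<in> S" for s
    using S \<phi> that by (auto simp: auto_def hom_def)
  have len: "endo_length G S (inner_aut G g \<circ> compose (carrier G) (inner_aut G h) \<phi>) =
      endo_length G S (inner_aut G (g \<otimes> h) \<circ> \<phi>)" if g: "g \<in> carrier G" for g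
  proof -
    have "inner_aut G g (compose (carrier G) (inner_aut G h) \<phi> s) = inner_aut G (g \<otimes> h) (\<phi> s)"
      if "s \<in> S" for s
      using g h that \<phi>S[OF that] S
      by (auto simp: inner_aut_def compose_def m_assoc inv_mult_group subset_iff)
    then have "(\<lambda>s. word_length G S
        ((inner_aut G g \<circ> compose (carrier G) (inner_aut G h) \<phi>) s)) ` S =
      (\<lambda>s. word_length G S ((inner_aut G (g \<otimes> h) \<circ> \<phi>) s)) ` S"
      by (intro image_cong) auto
    then show ?thesis unfolding endo_length_def by simp
  qed
  have bij: "(\<lambda>g. g \<otimes> h) ` carrier G = carrier G"
  proof (intro equalityI subsetI)
    fix x assume "x \<in> carrier G"
    then show "x \<in> (\<lambda>g. g \<otimes> h) ` carrier G"
      using h by (intro image_eqI[of _ _ "x \<otimes> inv h"]) (auto simp: m_assoc)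
  qed (use h in auto)
  have "endo_norm G S (compose (carrier G) (inner_aut G h) \<phi>) =
      (INF g\<in>carrier G. endo_length G S (inner_aut G (g \<otimes> h) \<circ> \<phi>))"
    unfolding endo_norm_def using len by (intro arg_cong[of _ _ Inf] image_cong) auto
  also have "\<dots> = Inf ((\<lambda>g. endo_length G S (inner_aut G g \<circ> \<phi>)) ` (\<lambda>g. g \<otimes> h) ` carrier G)"
    by (simp only: image_image)
  finally show ?thesis by (simp only: bij endo_norm_def)
qed

theorem (in group) out_norm_eq:
  assumes S: "S \<subseteq> carrier G" and \<Phi>: "\<Phi> \<in> carrier (Out G)" and \<phi>: "\<phi> \<in> \<Phi>"
  shows "out_norm G S \<Phi> = endo_norm G S \<phi>"
proof -
  obtain \<psi> where \<psi>: "\<psi> \<in> auto G" "\<Phi> = Inn G #>\<^bsub>AutoGroup G\<^esub> \<psi>"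
    using \<Phi> by (auto simp: Out_def carrier_FactGroup AutoGroup_def)
  have "endo_norm G S \<phi> = endo_norm G S \<psi>" if mem: "\<phi> \<in> \<Phi>" for \<phi>
  proof -
    obtain h where h: "h \<in> carrier G" "\<phi> = inner_aut G h \<otimes>\<^bsub>AutoGroup G\<^esub> \<psi>"
      using mem \<psi>(2) by (auto simp: r_coset_def Inn_def)
    have "inner_aut G h \<in> auto G"
      using hom_in_carrier[OF inner_aut_hom h(1)] by (simp add: AutoGroup_def)
    then show ?thesis using h \<psi> S by (simp add: AutoGroup_mult endo_norm_inner_aut)
  qed
  moreover have "(SOME \<phi>. \<phi> \<in> \<Phi>) \<in> \<Phi>" using \<phi> by (rule someI[of "\<lambda>\<phi>. \<phi> \<in> \<Phi>"])
  ultimately show ?thesis using \<phi> unfolding out_norm_def by metis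
qed

lemma iterated_map_limit:
  assumes "is_direct_limit Gs \<alpha> G \<eta>" and x: "x \<in> carrier (Gs k)"
    and \<theta>: "\<And>k x. x \<in> carrier (Gs k) \<Longrightarrow> \<theta> (Suc k) (\<alpha> k x) = \<theta> k x"
  shows "iterated_map \<alpha> k n x \<in> carrier (Gs (k + n)) \<and> \<theta> (k + n) (iterated_map \<alpha> k n x) = \<theta> k x"
proof (induction n)
  case (Suc n)
  have "\<alpha> (k + n) \<in> hom (Gs (k + n)) (Gs (Suc (k + n)))"
    using assms(1) by (simp add: is_direct_limit_def)
  then show ?case using Suc \<theta> by (auto simp: hom_in_carrier)
qed (use x in simp)

theorem direct_limit_universal:
  fixes \<theta> :: "nat \<Rightarrow> 'b \<Rightarrow> 'c"
  assumes lim: "is_direct_limit Gs \<alpha> G \<eta>" and G: "group G"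
    and Gs: "\<And>k. group (Gs k)"
    and \<theta>: "\<And>k. \<theta> k \<in> hom (Gs k) H"
    and compat: "\<And>k x. x \<in> carrier (Gs k) \<Longrightarrow> \<theta> (Suc k) (\<alpha> k x) = \<theta> k x"
  shows "\<exists>!f. f \<in> hom G H \<inter> extensional (carrier G) \<and>
           (\<forall>k. \<forall>x\<in>carrier (Gs k). f (\<eta> k x) = \<theta> k x)"
proof -
  have \<eta>: "\<eta> k \<in> hom (Gs k) G" "x \<in> carrier (Gs k) \<Longrightarrow> \<eta> (Suc k) (\<alpha> k x) = \<eta> k x" for k x
    using lim by (auto simp: is_direct_limit_def)
  have surj: "\<exists>k. \<exists>x\<in>carrier (Gs k). \<eta> k x = g" if "g \<in> carrier G" for g
    using lim that by (auto simp: is_direct_limit_def)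
  have ker: "\<theta> k x = \<theta> k y"
    if xy: "x \<in> carrier (Gs k)" "y \<in> carrier (Gs k)" "\<eta> k x = \<eta> k y" for k x y
  proof -
    obtain n where "iterated_map \<alpha> k n x = iterated_map \<alpha> k n y"
      using lim xy unfolding is_direct_limit_def by blast
    then show ?thesis
      using iterated_map_limit[OF lim xy(1), of \<theta> n] iterated_map_limit[OF lim xy(2), of \<theta> n] compat
      by auto
  qed
  have lift: "\<exists>y\<in>carrier (Gs m). \<eta> m y = \<eta> k x \<and> \<theta> m y = \<theta> k x"
    if "x \<in> carrier (Gs k)" "k \<le> m" for k m x
    using iterated_map_limit[OF lim that(1), of \<theta> "m - k"] that(2) compat
      iterated_map_limit[OF lim that(1), of \<eta> "m - k"] \<eta>(2) by auto
  have wd: "\<theta> k x = \<theta> m y"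
    if xy: "x \<in> carrier (Gs k)" "y \<in> carrier (Gs m)" "\<eta> k x = \<eta> m y" for k m x y
  proof -
    obtain x' y' where "x' \<in> carrier (Gs (max k m))" "\<eta> (max k m) x' = \<eta> k x"
        "\<theta> (max k m) x' = \<theta> k x"
      and "y' \<in> carrier (Gs (max k m))" "\<eta> (max k m) y' = \<eta> m y" "\<theta> (max k m) y' = \<theta> m y"
      using lift[OF xy(1), of "max k m"] lift[OF xy(2), of "max k m"] by auto
    then show ?thesis using ker[of x' "max k m" y'] xy(3) by simp
  qed
  define f where "f = (\<lambda>g\<in>carrier G. SOME c. \<exists>k. \<exists>x\<in>carrier (Gs k). \<eta> k x = g \<and> c = \<theta> k x)"
  have f: "f (\<eta> k x) = \<theta> k x" if x: "x \<in> carrier (Gs k)" for k x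
  proof -
    have "(SOME c. \<exists>m. \<exists>y\<in>carrier (Gs m). \<eta> m y = \<eta> k x \<and> c = \<theta> m y) = \<theta> k x"
    proof (rule some_equality)
      show "\<exists>m. \<exists>y\<in>carrier (Gs m). \<eta> m y = \<eta> k x \<and> \<theta> k x = \<theta> m y"
        by (intro exI[of _ k] bexI[OF _ x]) simp
      fix c assume "\<exists>m. \<exists>y\<in>carrier (Gs m). \<eta> m y = \<eta> k x \<and> c = \<theta> m y"
      then obtain m y where "y \<in> carrier (Gs m)" "\<eta> m y = \<eta> k x" "c = \<theta> m y" by (elim exE bexE conjE)
      then show "c = \<theta> k x" using wd[OF x, of y m] by simp
    qed
    then show ?thesis using hom_in_carrier[OF \<eta>(1) x] by (simp add: f_def)
  qed
  have hom: "f \<in> hom G H"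
  proof (rule homI)
    fix g assume "g \<in> carrier G"
    then obtain k x where "x \<in> carrier (Gs k)" "\<eta> k x = g" using surj by blast
    then show "f g \<in> carrier H" using f hom_in_carrier[OF \<theta>] by metis
  next
    fix g h assume gh: "g \<in> carrier G" "h \<in> carrier G"
    obtain k x m y where xy: "x \<in> carrier (Gs k)" "\<eta> k x = g" "y \<in> carrier (Gs m)" "\<eta> m y = h"
      using surj gh by metis
    obtain x' y' where *: "x' \<in> carrier (Gs (max k m))" "\<eta> (max k m) x' = g"
      "y' \<in> carrier (Gs (max k m))" "\<eta> (max k m) y' = h"
      using lift[OF xy(1), of "max k m"] lift[OF xy(3), of "max k m"] xy by auto
    have "x' \<otimes>\<^bsub>Gs (max k m)\<^esub> y' \<in> carrier (Gs (max k m))"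
      using * Gs by (simp add: group.is_monoid monoid.m_closed)
    then show "f (g \<otimes>\<^bsub>G\<^esub> h) = f g \<otimes>\<^bsub>H\<^esub> f h"
      using * f hom_mult[OF \<eta>(1)] hom_mult[OF \<theta>] by metis
  qed
  show ?thesis
  proof (intro ex1I conjI)
    show "f \<in> hom G H \<inter> extensional (carrier G)" using hom by (simp add: f_def)
    show "\<forall>k. \<forall>x\<in>carrier (Gs k). f (\<eta> k x) = \<theta> k x" using f by blast
    fix f' assume f': "f' \<in> hom G H \<inter> extensional (carrier G) \<and>
      (\<forall>k. \<forall>x\<in>carrier (Gs k). f' (\<eta> k x) = \<theta> k x)"
    show "f' = f"
    proof (rule extensionalityI[of _ "carrier G"])
      fix g assume "g \<in> carrier G"
      then obtain k x where "x \<in> carrier (Gs k)" "\<eta> k x = g" using surj by blast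
      then show "f' g = f g" using f f' by metis
    qed (use f' in \<open>auto simp: f_def\<close>)
  qed
qed

end

theory Submission
  imports Defs
begin

text \<open>
  The heart of the proof is a uniform bound (\<open>uniform_displacement_bound\<close>): there is a constant \<open>A\<close>
  such that, for all large \<open>k\<close>, every endomorphism of the \<open>k\<close>-th approximating group is conjugate to
  one that sends the generators to elements of length at most \<open>A * \<delta> k\<close>. Otherwise there are
  endomorphisms whose displacement, minimised over all points, is arbitrarily large compared to \<open>\<delta> k\<close>.
  The approximating groups with their word metrics, rescaled by these displacements and acted on
  through the endomorphisms, then converge along an ultrafilter to an action of \<open>G\<close> on a real tree
  without a global fixed point, against property (FR).

  Given the bound, let \<open>\<Phi>\<close> and \<open>\<Psi>\<close> have norm at most \<open>A * \<delta> k\<close>. Their product has a representative of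
  length at most \<open>(A * \<delta> k)\<^sup>2\<close>. Relators of the \<open>k\<close>-th group have length at most \<open>10 * \<delta> k\<close>, so the
  representative lifts to an endomorphism of this group as soon as the injectivity radius exceeds
  \<open>10 * \<delta> k * (A * \<delta> k)\<^sup>2\<close> (\<open>lift_endomorphism\<close>); this is where the cube of \<open>\<delta> k\<close> comes from. By the uniform
  bound a conjugate of the lift has length at most \<open>A * \<delta> k\<close>, and so the product again has norm at most
  \<open>A * \<delta> k\<close>. The inverse of a product is a product of inverses, so both norms in the definition
  of \<open>U\<^sub>k\<close> are controlled in this way, and the identity lifts to every stage.

  Geodesics of the limit tree are avoided in favour of betweenness: \<open>p\<close> is between \<open>x\<close> and \<open>y\<close> if the
  distances from \<open>p\<close> add up to the distance of \<open>x\<close> and \<open>y\<close>. Thin triangles of a Cayley graph become a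
  statement about betweenness in the word metric (\<open>word_metric_thin_triangles\<close>), which passes to
  limits (\<open>pseudo_tree_ultradist\<close>) and is exact there since \<open>\<delta> k\<close> is negligible at the chosen scale.
  An exact statement of this kind already gives a real tree (\<open>real_tree_representatives\<close>).
\<close>

section \<open>Word metrics\<close>

lemma words_simps [simp]:
  "[] \<in> words S"
  "(s, b) # w \<in> words S \<longleftrightarrow> s \<in> S \<and> w \<in> words S"
  "v @ w \<in> words S \<longleftrightarrow> v \<in> words S \<and> w \<in> words S"
  by (auto simp: words_def)

lemma words_induct [consumes 1, case_names Nil Cons]:
  assumes "w \<in> words S" and "P []"
    and "\<And>s b w. s \<in> S \<Longrightarrow> w \<in> words S \<Longrightarrow> P w \<Longrightarrow> P ((s, b) # w)"
  shows "P w"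
  using assms(1)
proof (induction w)
  case (Cons a w)
  then show ?case using assms(3)[of "fst a" w "snd a"] by (cases a) auto
qed (rule assms(2))

lemma word_val_Nil [simp]: "word_val G [] = \<one>\<^bsub>G\<^esub>"
  by (simp add: word_val_def)

lemma word_val_Cons [simp]:
  "word_val G ((s, b) # w) = (if b then s else inv\<^bsub>G\<^esub> s) \<otimes>\<^bsub>G\<^esub> word_val G w"
  by (simp add: word_val_def)

lemma (in group) word_val_in_carrier:
  "w \<in> words T \<Longrightarrow> T \<subseteq> carrier G \<Longrightarrow> word_val G w \<in> carrier G"
  by (induction w rule: words_induct) auto

lemma (in group) word_val_mult:
  "v \<in> words T \<Longrightarrow> w \<in> words T \<Longrightarrow> T \<subseteq> carrier G \<Longrightarrow>
    word_val G (v @ w) = word_val G v \<otimes> word_val G w"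
  by (induction v rule: words_induct) (use word_val_in_carrier in \<open>auto simp: m_assoc subset_iff\<close>)

locale generated_group = group G for G :: "'a monoid" (structure) +
  fixes S :: "'a set"
  assumes generators_closed: "S \<subseteq> carrier G" and generate_eq: "generate G S = carrier G"
begin

lemmas word_val_closed = word_val_in_carrier[OF _ generators_closed]
lemmas word_val_append = word_val_mult[OF _ _ generators_closed]

lemma inverse_word:
  "w \<in> words S \<Longrightarrow> \<exists>v\<in>words S. length v = length w \<and> word_val G v = inv (word_val G w)"
proof (induction w rule: words_induct)
  case Nil
  show ?case by (rule bexI[of _ "[]"]) auto
next
  case (Cons s b w)
  then obtain v where "v \<in> words S" "length v = length w" "word_val G v = inv (word_val G w)"
    by auto
  then show ?case using Cons generators_closed word_val_closed
    by (intro bexI[of _ "v @ [(s, \<not> b)]"]) (auto simp: word_val_append inv_mult_group subset_iff)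
qed

lemma word_exists:
  assumes "g \<in> carrier G" shows "\<exists>w\<in>words S. word_val G w = g"
proof -
  have "g \<in> generate G S" using assms generate_eq by simp
  then show ?thesis
  proof induction
    case one
    show ?case by (rule bexI[of _ "[]"]) auto
  next
    case (incl s)
    then show ?case using generators_closed by (intro bexI[of _ "[(s, True)]"]) auto
  next
    case (inv s)
    then show ?case using generators_closed by (intro bexI[of _ "[(s, False)]"]) auto
  next
    case (eng x y)
    then obtain v w where "v \<in> words S" "word_val G v = x" "w \<in> words S" "word_val G w = y"
      by auto
    then show ?case by (intro bexI[of _ "v @ w"]) (auto simp: word_val_append)
  qed
qed

lemma word_length_attained:
  assumes "g \<in> carrier G"
  shows "\<exists>w\<in>words S. length w = word_length G S g \<and> word_val G w = g"
  unfolding word_length_def by (rule LeastI_ex) (use word_exists[OF assms] in blast)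

lemma word_length_le: "w \<in> words S \<Longrightarrow> word_length G S (word_val G w) \<le> length w"
  unfolding word_length_def by (rule Least_le) blast

lemma word_length_one [simp]: "word_length G S \<one> = 0"
  using word_length_le[of "[]"] by simp

lemma word_length_generator: "s \<in> S \<Longrightarrow> word_length G S s \<le> 1"
  using word_length_le[of "[(s, True)]"] generators_closed by (auto simp: subset_iff)

lemma word_length_mult:
  assumes "g \<in> carrier G" "h \<in> carrier G"
  shows "word_length G S (g \<otimes> h) \<le> word_length G S g + word_length G S h"
proof -
  obtain v w where "v \<in> words S" "length v = word_length G S g" "word_val G v = g"
    "w \<in> words S" "length w = word_length G S h" "word_val G w = h"
    using word_length_attained assms by metis
  then show ?thesis using word_length_le[of "v @ w"] by (simp add: word_val_append)
qed

lemma word_length_inv [simp]: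
  assumes g: "g \<in> carrier G"
  shows "word_length G S (inv g) = word_length G S g"
proof -
  have *: "word_length G S (inv g) \<le> word_length G S g" if g: "g \<in> carrier G" for g
    using word_length_attained[OF g] inverse_word word_length_le by metis
  show ?thesis using *[OF g] *[of "inv g"] g by simp
qed

text \<open>Cutting a shortest word gives elements at every intermediate distance from \<open>\<one>\<close>.\<close>

lemma word_length_split:
  assumes g: "g \<in> carrier G" and i: "i \<le> word_length G S g"
  shows "\<exists>x\<in>carrier G. \<exists>y\<in>carrier G. g = x \<otimes> y \<and> word_length G S x = i \<and>
           word_length G S y = word_length G S g - i"
proof -
  obtain w where w: "w \<in> words S" "length w = word_length G S g" "word_val G w = g"
    using word_length_attained[OF g] by auto
  define x y where "x = word_val G (take i w)" and "y = word_val G (drop i w)"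
  have tw: "take i w \<in> words S" "drop i w \<in> words S"
    using w(1) by (metis append_take_drop_id words_simps(3))+
  have xy: "x \<in> carrier G" "y \<in> carrier G" "g = x \<otimes> y"
    using word_val_append[OF tw] w(3) word_val_closed tw by (auto simp: x_def y_def)
  moreover have "word_length G S x \<le> i" "word_length G S y \<le> word_length G S g - i"
    using word_length_le[OF tw(1)] word_length_le[OF tw(2)] w(2) i by (auto simp: x_def y_def)
  ultimately show ?thesis
    using word_length_mult[OF xy(1,2)] i by (intro bexI[of _ x] bexI[of _ y]) auto
qed

lemma inv_cancel_left [simp]:
  assumes "x \<in> carrier G" "y \<in> carrier G"
  shows "inv x \<otimes> (x \<otimes> y) = y" "x \<otimes> (inv x \<otimes> y) = y"
  using assms by (simp_all add: m_assoc[symmetric])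

lemma word_dist_self [simp]: "x \<in> carrier G \<Longrightarrow> word_dist G S x x = 0"
  by (simp add: word_dist_def)

lemma word_dist_commute:
  assumes "x \<in> carrier G" "y \<in> carrier G" shows "word_dist G S x y = word_dist G S y x"
proof -
  have "inv (inv x \<otimes> y) = inv y \<otimes> x" using assms by (simp add: inv_mult_group)
  then show ?thesis using assms word_length_inv[of "inv x \<otimes> y"] by (simp add: word_dist_def)
qed

lemma word_dist_triangle:
  assumes "x \<in> carrier G" "y \<in> carrier G" "z \<in> carrier G"
  shows "word_dist G S x z \<le> word_dist G S x y + word_dist G S y z"
proof -
  have "inv x \<otimes> z = (inv x \<otimes> y) \<otimes> (inv y \<otimes> z)"
    using assms by (simp add: m_assoc)
  then show ?thesis using assms word_length_mult[of "inv x \<otimes> y" "inv y \<otimes> z"]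
    by (simp add: word_dist_def)
qed

lemma word_dist_translate:
  assumes "g \<in> carrier G" "x \<in> carrier G" "y \<in> carrier G"
  shows "word_dist G S (g \<otimes> x) (g \<otimes> y) = word_dist G S x y"
proof -
  have "inv (g \<otimes> x) \<otimes> (g \<otimes> y) = inv x \<otimes> y"
    using assms by (simp add: m_assoc inv_mult_group)
  then show ?thesis by (simp add: word_dist_def)
qed

lemma word_dist_one [simp]: "x \<in> carrier G \<Longrightarrow> word_dist G S \<one> x = word_length G S x"
  by (simp add: word_dist_def)

lemma word_dist_intermediate:
  assumes x: "x \<in> carrier G" and y: "y \<in> carrier G" and i: "i \<le> word_dist G S x y"
  shows "\<exists>z\<in>carrier G. word_dist G S x z = i \<and> word_dist G S z y = word_dist G S x y - i"
proof -
  obtain a b where ab: "a \<in> carrier G" "b \<in> carrier G" "inv x \<otimes> y = a \<otimes> b"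
    "word_length G S a = i" "word_length G S b = word_dist G S x y - i"
    using word_length_split[of "inv x \<otimes> y" i] x y i by (auto simp: word_dist_def)
  have "inv x \<otimes> (x \<otimes> a) = a" using x ab(1) by (simp add: m_assoc[symmetric])
  moreover have "inv (x \<otimes> a) \<otimes> y = b"
  proof -
    have "inv (x \<otimes> a) \<otimes> y = inv a \<otimes> (inv x \<otimes> y)"
      using x y ab by (simp add: inv_mult_group m_assoc)
    then show ?thesis unfolding ab(3) using ab by (simp add: m_assoc[symmetric])
  qed
  ultimately show ?thesis using x ab by (intro bexI[of _ "x \<otimes> a"]) (auto simp: word_dist_def)
qed

lemma hom_length_le:
  assumes H: "generated_group H T" and f: "f \<in> hom G H" and m: "m \<ge> 0"
    and le: "\<And>s. s \<in> S \<Longrightarrow> real (word_length H T (f s)) \<le> m" and g: "g \<in> carrier G"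
  shows "real (word_length H T (f g)) \<le> m * real (word_length G S g)"
proof -
  interpret H: generated_group H T by (rule H)
  interpret f: group_hom G H f by unfold_locales (rule f)
  have *: "real (word_length H T (f (word_val G w))) \<le> m * real (length w)" if "w \<in> words S" for w
    using that
  proof (induction w rule: words_induct)
    case (Cons s b w)
    define a where "a = (if b then s else inv s)"
    have s: "s \<in> carrier G" using Cons generators_closed by auto
    have a: "a \<in> carrier G" "real (word_length H T (f a)) \<le> m"
      using s le[OF Cons(1)] by (auto simp: a_def)
    have "word_length H T (f (a \<otimes> word_val G w)) \<le>
        word_length H T (f a) + word_length H T (f (word_val G w))"
      using a word_val_closed[OF Cons(2)] H.word_length_mult by simp
    then have "real (word_length H T (f (a \<otimes> word_val G w))) \<le> m + m * real (length w)"
      using a(2) Cons(3) by linarith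
    then show ?case by (simp add: a_def algebra_simps)
  qed simp
  then show ?thesis using word_length_attained[OF g] by metis
qed

end

section \<open>Thin triangles in word metrics\<close>

lemma edge_point_0: "edge_point u v 0 = edge_point u u 0"
  and edge_point_1: "edge_point u v 1 = edge_point v v 0"
  by (auto simp: edge_point_def)

lemma edge_point_reverse: "edge_point v u t = edge_point u v (1 - t)"
  by (auto simp: edge_point_def)

text \<open>
  The affine extension to the Cayley graph of a function on the vertices. It is 1-Lipschitz along
  edges when the function is, and so bounds lengths of paths from below.
\<close>

definition affine_extension :: "('a \<Rightarrow> real) \<Rightarrow> ('a \<Rightarrow> real) \<Rightarrow> real" where
  "affine_extension f P = (\<Sum>w | P w \<noteq> 0. P w * f w)"

lemma affine_extension_edge_point:
  "affine_extension f (edge_point u v t) = (1 - t) * f u + t * f v"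
proof -
  have "affine_extension f (edge_point u v t) = (\<Sum>w\<in>{u, v}. edge_point u v t w * f w)"
    unfolding affine_extension_def
    by (rule sum.mono_neutral_left) (auto simp: edge_point_def)
  also have "\<dots> = (1 - t) * f u + t * f v"
    by (cases "u = v") (auto simp: edge_point_def algebra_simps)
  finally show ?thesis .
qed

context generated_group
begin

abbreviation cayley_path where "cayley_path \<equiv> cayley_path_length G S"

lemma edge_point_in_cayley_graph:
  "u \<in> carrier G \<Longrightarrow> s \<in> S \<Longrightarrow> t \<in> {0..1} \<Longrightarrow> edge_point u (u \<otimes> s) t \<in> cayley_graph G S"
  unfolding cayley_graph_def by blast

lemma cayley_path_in_graph:
  assumes "cayley_path p q l" shows "p \<in> cayley_graph G S \<and> q \<in> cayley_graph G S \<and> l \<ge> 0"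
  using assms by induction (auto simp: edge_point_in_cayley_graph)

lemma cayley_path_trans:
  assumes "cayley_path p q l" "cayley_path q r m" shows "cayley_path p r (l + m)"
  using assms(2)
proof induction
  case start
  show ?case using assms(1) by simp
next
  case (step u s a m b)
  then show ?case using cayley_path_length.step[of G S p u s a "l + m" b] by (simp add: add.assoc)
qed

lemma cayley_path_sym:
  assumes "cayley_path p q l" shows "cayley_path q p l"
  using assms
proof induction
  case start
  then show ?case by (rule cayley_path_length.start)
next
  case (step u s a l b)
  have "cayley_path (edge_point u (u \<otimes> s) b) (edge_point u (u \<otimes> s) a) (0 + \<bar>b - a\<bar>)"
    by (intro cayley_path_length.step cayley_path_length.start edge_point_in_cayley_graph) fact+
  from cayley_path_trans[OF this step.IH] show ?case by (simp add: abs_minus_commute add.commute)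
qed

lemma cayley_dist_le: "cayley_path p q l \<Longrightarrow> cayley_dist G S p q \<le> l"
  unfolding cayley_dist_def
  by (rule cInf_lower) (auto intro!: bdd_belowI[of _ 0] dest: cayley_path_in_graph)

text \<open>
  The hypothesis that some path exists matters: the infimum of the empty set is unspecified.
\<close>

lemma cayley_dist_ge:
  assumes "cayley_path p q l" "\<And>m. cayley_path p q m \<Longrightarrow> b \<le> m"
  shows "b \<le> cayley_dist G S p q"
  unfolding cayley_dist_def by (rule cInf_greatest) (use assms in auto)

lemma cayley_dist_commute: "cayley_dist G S p q = cayley_dist G S q p"
proof -
  have "{l. cayley_path p q l} = {l. cayley_path q p l}" using cayley_path_sym by blast
  then show ?thesis by (simp only: cayley_dist_def)
qed

lemma cayley_dist_triangle:
  assumes pq: "cayley_path p q l0" and qr: "cayley_path q r m0"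
  shows "cayley_dist G S p r \<le> cayley_dist G S p q + cayley_dist G S q r"
proof -
  have "cayley_dist G S p r - cayley_dist G S q r \<le> cayley_dist G S p q"
  proof (rule cayley_dist_ge[OF pq])
    fix l assume l: "cayley_path p q l"
    have "cayley_dist G S p r - l \<le> cayley_dist G S q r"
      by (rule cayley_dist_ge[OF qr]) (use cayley_dist_le[OF cayley_path_trans[OF l]] in force)
    then show "cayley_dist G S p r - cayley_dist G S q r \<le> l" by simp
  qed
  then show ?thesis by simp
qed

text \<open>
  The affine extension of the distance to \<open>x\<close> grows along each step of a path by at most the length
  of the step.
\<close>

lemma word_dist_le_cayley_path:
  assumes p: "cayley_path (edge_point x x 0) q l" and x: "x \<in> carrier G"
  shows "affine_extension (\<lambda>y. real (word_dist G S x y)) q \<le> l"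
  using p
proof induction
  case start
  show ?case using x by (simp add: affine_extension_edge_point)
next
  case (step u s a l b)
  let ?f = "\<lambda>y. real (word_dist G S x y)"
  have s: "s \<in> carrier G" using step generators_closed by auto
  have us: "word_dist G S u (u \<otimes> s) \<le> 1"
    using step s word_length_generator by (simp add: word_dist_def)
  have "\<bar>?f (u \<otimes> s) - ?f u\<bar> \<le> 1"
    using word_dist_triangle[of x u "u \<otimes> s"] word_dist_triangle[of x "u \<otimes> s" u]
      word_dist_commute[of u "u \<otimes> s"] us x step(2) s by simp
  then have "\<bar>b - a\<bar> * \<bar>?f (u \<otimes> s) - ?f u\<bar> \<le> \<bar>b - a\<bar>"
    by (intro mult_left_le) auto
  then have "(b - a) * (?f (u \<otimes> s) - ?f u) \<le> \<bar>b - a\<bar>"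
    by (metis abs_le_D1 abs_mult)
  then show ?case using step(6) by (simp add: affine_extension_edge_point algebra_simps)
qed

lemma word_dist_le_cayley_dist:
  assumes "cayley_path (edge_point x x 0) (edge_point y y 0) l" "x \<in> carrier G"
  shows "real (word_dist G S x y) \<le> cayley_dist G S (edge_point x x 0) (edge_point y y 0)"
  by (rule cayley_dist_ge[OF assms(1)])
    (use word_dist_le_cayley_path[OF _ assms(2)] in \<open>fastforce simp: affine_extension_edge_point\<close>)

text \<open>Edges of the Cayley graph, without the orientation given by the generators.\<close>

definition adjacent :: "'a \<Rightarrow> 'a \<Rightarrow> bool" where
  "adjacent x y \<longleftrightarrow> x \<in> carrier G \<and> y \<in> carrier G \<and> (\<exists>s\<in>S. y = x \<otimes> s \<or> x = y \<otimes> s)"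

lemma adjacent_edge_path:
  assumes "adjacent x y" "a \<in> {0..1}" "b \<in> {0..1}"
  shows "cayley_path (edge_point x y a) (edge_point x y b) \<bar>a - b\<bar>"
proof -
  have *: "cayley_path (edge_point u (u \<otimes> s) a) (edge_point u (u \<otimes> s) b) \<bar>a - b\<bar>"
    if "u \<in> carrier G" "s \<in> S" "a \<in> {0..1}" "b \<in> {0..1}" for u s a b
    using cayley_path_length.step[OF cayley_path_length.start that(1,2)] that
      edge_point_in_cayley_graph[OF that(1-3)] by simp
  obtain s where s: "s \<in> S" "y = x \<otimes> s \<or> x = y \<otimes> s" and xy: "x \<in> carrier G" "y \<in> carrier G"
    using assms(1) by (auto simp: adjacent_def)
  show ?thesis
  proof (cases "y = x \<otimes> s")
    case True
    then show ?thesis using *[OF xy(1) s(1)] assms by simp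
  next
    case False
    then have "edge_point x y t = edge_point y (y \<otimes> s) (1 - t)" for t
      using s(2) edge_point_reverse[of x y t] by simp
    then show ?thesis using *[OF xy(2) s(1), of "1 - a" "1 - b"] assms
      by (simp add: abs_minus_commute)
  qed
qed

definition vertex_path :: "nat \<Rightarrow> (nat \<Rightarrow> 'a) \<Rightarrow> bool" where
  "vertex_path n v \<longleftrightarrow> (\<forall>i\<le>n. v i \<in> carrier G) \<and> (\<forall>i<n. adjacent (v i) (v (Suc i)))"

lemma vertex_path_exists:
  assumes "x \<in> carrier G" "y \<in> carrier G" "word_dist G S x y = n"
  shows "\<exists>v. vertex_path n v \<and> v 0 = x \<and> v n = y"
  using assms
proof (induction n arbitrary: y)
  case 0
  have "inv x \<otimes> y \<in> carrier G" using 0 by simp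
  then obtain w where "w \<in> words S" "length w = word_dist G S x y" "word_val G w = inv x \<otimes> y"
    using word_length_attained unfolding word_dist_def by blast
  then have "x \<otimes> \<one> = x \<otimes> (inv x \<otimes> y)" using 0 by simp
  then have "x = y" using 0 by simp
  then show ?case using 0 by (intro exI[of _ "\<lambda>_. x"]) (simp add: vertex_path_def)
next
  case (Suc n)
  obtain z where z: "z \<in> carrier G" "word_dist G S x z = n" "word_dist G S z y = 1"
    using word_dist_intermediate[of x y n] Suc by auto
  obtain v where v: "vertex_path n v" "v 0 = x" "v n = z" using Suc.IH Suc.prems z by blast
  have "inv z \<otimes> y \<in> carrier G" using z Suc by simp
  then obtain w where w: "w \<in> words S" "length w = 1" "word_val G w = inv z \<otimes> y"
    using word_length_attained z(3) unfolding word_dist_def by metis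
  then obtain s b where sb: "w = [(s, b)]" by (metis One_nat_def length_0_conv length_Suc_conv surj_pair)
  have s: "s \<in> S" "s \<in> carrier G" using w sb generators_closed by auto
  have "z \<otimes> (inv z \<otimes> y) = z \<otimes> (if b then s else inv s)"
    using w(3) s sb by simp
  then have y: "y = z \<otimes> (if b then s else inv s)" using z Suc by simp
  have "adjacent z y"
    unfolding adjacent_def using z y s Suc by (auto intro!: bexI[of _ s] simp: m_assoc)
  then show ?case using v Suc.prems
    by (intro exI[of _ "v(Suc n := y)"]) (auto simp: vertex_path_def less_Suc_eq le_Suc_eq)
qed

text \<open>The path of the Cayley graph through the vertices \<open>v 0, v 1, \<dots>\<close> with unit speed.\<close>

definition path_point :: "(nat \<Rightarrow> 'a) \<Rightarrow> real \<Rightarrow> 'a \<Rightarrow> real" where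
  "path_point v t = edge_point (v (nat \<lfloor>t\<rfloor>)) (v (Suc (nat \<lfloor>t\<rfloor>))) (t - \<lfloor>t\<rfloor>)"

lemma path_point_of_nat: "path_point v (real i) = edge_point (v i) (v i) 0"
  unfolding path_point_def using edge_point_0[of "v i" "v (Suc i)"] by simp

lemma path_point_edge:
  assumes "real i \<le> t" "t \<le> real (Suc i)"
  shows "path_point v t = edge_point (v i) (v (Suc i)) (t - real i)"
proof (cases "t = real (Suc i)")
  case True
  then show ?thesis using path_point_of_nat[of v "Suc i"] edge_point_1[of "v i"] by simp
next
  case False
  then have "\<lfloor>t\<rfloor> = int i" using assms by linarith
  then show ?thesis by (simp add: path_point_def)
qed

lemma path_point_path:
  assumes v: "vertex_path n v" and st: "0 \<le> s" "s \<le> t" "t \<le> real n"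
  shows "cayley_path (path_point v s) (path_point v t) (t - s)"
  using assms
proof (induction n arbitrary: s t)
  case 0
  then have "s = 0" "t = 0" by auto
  moreover have "edge_point (v 0) (v 0) 0 \<in> cayley_graph G S"
    using 0 unfolding vertex_path_def cayley_graph_def by blast
  ultimately show ?case
    using cayley_path_length.start[of "path_point v 0" G S] path_point_of_nat[of v 0] by simp
next
  case (Suc n)
  have v: "vertex_path n v" "adjacent (v n) (v (Suc n))"
    using Suc.prems by (auto simp: vertex_path_def)
  have last: "cayley_path (path_point v s) (path_point v t) (t - s)"
    if "real n \<le> s" "s \<le> t" "t \<le> real (Suc n)" for s t
    using adjacent_edge_path[OF v(2), of "s - real n" "t - real n"] that
      path_point_edge[of n s v] path_point_edge[of n t v] by simp
  consider "t \<le> real n" | "real n \<le> s" | "s < real n" "real n < t" by linarith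
  then show ?case
  proof cases
    case 1
    then show ?thesis using Suc.IH[OF v(1)] Suc.prems by simp
  next
    case 2
    then show ?thesis using last Suc.prems by simp
  next
    case 3
    then have "cayley_path (path_point v s) (path_point v t) ((n - s) + (t - n))"
      using Suc.IH[OF v(1), of s n] last[of n t] Suc.prems by (intro cayley_path_trans) auto
    then show ?thesis by simp
  qed
qed

text \<open>
  Such a path is 1-Lipschitz by construction. Since its ends are at distance \<open>n\<close>, no part of it can
  be shortened.
\<close>

lemma geodesic_vertex_path:
  assumes v: "vertex_path n v" and n: "word_dist G S (v 0) (v n) = n"
  shows "geodesic_segment (cayley_graph G S) (cayley_dist G S)
           (edge_point (v 0) (v 0) 0) (edge_point (v n) (v n) 0) (path_point v ` {0..real n})"
proof -
  note path = path_point_path[OF v]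
  have path0: "cayley_path (edge_point (v 0) (v 0) 0) (edge_point (v n) (v n) 0) (real n)"
    using path[of 0 "real n"] path_point_of_nat[of v 0] path_point_of_nat[of v n] by simp
  have lower: "real n \<le> cayley_dist G S (path_point v 0) (path_point v n)"
    using word_dist_le_cayley_dist[OF path0] v n path_point_of_nat[of v 0]
      path_point_of_nat[of v n] by (simp add: vertex_path_def)
  have le: "cayley_dist G S (path_point v s) (path_point v t) = t - s"
    if "0 \<le> s" "s \<le> t" "t \<le> real n" for s t
  proof -
    have "cayley_dist G S (path_point v 0) (path_point v n) \<le>
        cayley_dist G S (path_point v 0) (path_point v s) +
        cayley_dist G S (path_point v s) (path_point v n)"
      by (rule cayley_dist_triangle[OF path path]) (use that in auto)
    moreover have "cayley_dist G S (path_point v s) (path_point v n) \<le>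
        cayley_dist G S (path_point v s) (path_point v t) +
        cayley_dist G S (path_point v t) (path_point v n)"
      by (rule cayley_dist_triangle[OF path path]) (use that in auto)
    ultimately show ?thesis
      using lower cayley_dist_le[OF path, of 0 s] cayley_dist_le[OF path, of s t]
        cayley_dist_le[OF path, of t n] that by simp
  qed
  have dist: "cayley_dist G S (path_point v s) (path_point v t) = \<bar>s - t\<bar>"
    if "s \<in> {0..real n}" "t \<in> {0..real n}" for s t
    using le[of s t] le[of t s] that cayley_dist_commute[of "path_point v s" "path_point v t"]
    by (cases "s \<le> t") auto
  have "path_point v ` {0..real n} \<subseteq> cayley_graph G S"
    using cayley_path_in_graph[OF path[of _ "real n"]] by auto
  moreover have "cayley_dist G S (edge_point (v 0) (v 0) 0) (edge_point (v n) (v n) 0) = real n"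
    using dist[of 0 "real n"] path_point_of_nat[of v 0] path_point_of_nat[of v n] by simp
  ultimately show ?thesis
    unfolding geodesic_segment_def using dist path_point_of_nat[of v 0] path_point_of_nat[of v n]
    by (intro exI[of _ "path_point v"]) auto
qed

lemma word_dist_vertex_path:
  assumes v: "vertex_path n v" and ij: "i \<le> j" "j \<le> n"
  shows "word_dist G S (v i) (v j) \<le> j - i"
proof -
  have *: "cayley_path (path_point v i) (path_point v j) (real j - real i)"
    using path_point_path[OF v, of i j] ij by simp
  have "v i \<in> carrier G" using v ij by (simp add: vertex_path_def)
  then have "real (word_dist G S (v i) (v j)) \<le> real j - real i"
    using word_dist_le_cayley_dist[OF *[unfolded path_point_of_nat]]
      cayley_dist_le[OF *[unfolded path_point_of_nat]] by linarith
  then show ?thesis using ij by linarith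
qed

lemma word_dist_geodesic_path:
  assumes v: "vertex_path n v" and n: "word_dist G S (v 0) (v n) = n" and i: "i \<le> n"
  shows "word_dist G S (v 0) (v i) + word_dist G S (v i) (v n) = n"
  using word_dist_vertex_path[OF v, of 0 i] word_dist_vertex_path[OF v, of i n] i n v
    word_dist_triangle[of "v 0" "v i" "v n"] by (simp add: vertex_path_def)

lemma geodesic_path_near_vertex:
  assumes v: "vertex_path n v" and t: "t \<in> {0..real n}"
  shows "\<exists>i\<le>n. cayley_path (path_point v t) (edge_point (v i) (v i) 0) (t - real i) \<and> t - real i \<le> 1"
proof (intro exI conjI)
  define i where "i = nat \<lfloor>t\<rfloor>"
  have "real i = real_of_int \<lfloor>t\<rfloor>" using t by (simp add: i_def)
  then have i: "real i \<le> t" "t \<le> real i + 1" by linarith+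
  then show "i \<le> n" using t by simp
  show "cayley_path (path_point v t) (edge_point (v i) (v i) 0) (t - real i)"
    using path_point_path[OF v, of i t] i t cayley_path_sym path_point_of_nat[of v i] by simp
  show "t - real i \<le> 1" using i by simp
qed

text \<open>
  Here hyperbolicity is translated into a property of the word metric alone, where betweenness
  replaces geodesics. A vertex between \<open>x\<close> and \<open>y\<close> lies on some geodesic side, hence is \<open>\<delta>\<close>-close to a
  point of another side; moving that point back to a vertex costs at most \<open>1\<close>.
\<close>

lemma word_metric_thin_triangles:
  assumes hyp: "hyperbolic \<delta> (cayley_graph G S) (cayley_dist G S)"
    and x: "x \<in> carrier G" and y: "y \<in> carrier G" and z: "z \<in> carrier G" and p: "p \<in> carrier G"
    and btw: "word_dist G S x p + word_dist G S p y = word_dist G S x y"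
  shows "\<exists>q\<in>carrier G. real (word_dist G S p q) \<le> \<delta> + 1 \<and>
           (word_dist G S y q + word_dist G S q z = word_dist G S y z \<or>
            word_dist G S z q + word_dist G S q x = word_dist G S z x)"
proof -
  let ?V = "\<lambda>x. edge_point x x 0" and ?M = "cayley_graph G S" and ?d = "cayley_dist G S"
  have V: "?V x \<in> ?M" if "x \<in> carrier G" for x
    using that unfolding cayley_graph_def by blast
  obtain a where a: "vertex_path (word_dist G S x p) a" "a 0 = x" "a (word_dist G S x p) = p"
    using vertex_path_exists[OF x p] by blast
  obtain b where b: "vertex_path (word_dist G S p y) b" "b 0 = p" "b (word_dist G S p y) = y"
    using vertex_path_exists[OF p y] by blast
  define m where "m = word_dist G S x p"
  \<comment> \<open>a geodesic from \<open>x\<close> to \<open>y\<close> through \<open>p\<close>\<close>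
  define c where "c = (\<lambda>i. if i \<le> m then a i else b (i - m))"
  have "adjacent (c i) (c (Suc i))" if i: "i < word_dist G S x y" for i
  proof -
    consider "i < m" | "i = m" | "i > m" by linarith
    then show ?thesis
    proof cases
      case 1
      then show ?thesis using a by (simp add: c_def m_def vertex_path_def)
    next
      case 2
      then have "0 < word_dist G S p y" using i btw unfolding m_def by linarith
      then have "adjacent (b 0) (b (Suc 0))" using b(1) unfolding vertex_path_def by blast
      then show ?thesis using 2 a b by (simp add: c_def m_def)
    next
      case 3
      then have "i - m < word_dist G S p y" "Suc i - m = Suc (i - m)"
        using i btw unfolding m_def by auto
      then show ?thesis using 3 b by (simp add: c_def vertex_path_def)
    qed
  qed
  then have c: "vertex_path (word_dist G S x y) c"
    using a b btw unfolding vertex_path_def by (auto simp: c_def m_def)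
  have xy: "word_dist G S x y = m + word_dist G S p y" using btw by (simp add: m_def)
  have cm: "c (m + i) = b i" for i
    using a(3) b(2) by (cases i) (auto simp: c_def m_def)
  have c': "c 0 = x" "c m = p" "c (word_dist G S x y) = y"
    using a(2) cm[of 0] b(2,3) cm[of "word_dist G S p y"] unfolding xy by (simp_all add: c_def)
  obtain e where e: "vertex_path (word_dist G S y z) e" "e 0 = y" "e (word_dist G S y z) = z"
    using vertex_path_exists[OF y z] by blast
  obtain f where f: "vertex_path (word_dist G S z x) f" "f 0 = z" "f (word_dist G S z x) = x"
    using vertex_path_exists[OF z x] by blast
  have "?V p \<in> path_point c ` {0..real (word_dist G S x y)}"
    using path_point_of_nat[of c m] c' btw by (intro image_eqI[of _ _ "real m"]) (auto simp: m_def)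
  then obtain q where q: "q \<in> path_point e ` {0..real (word_dist G S y z)} \<union>
      path_point f ` {0..real (word_dist G S z x)}" "?d (?V p) q \<le> \<delta>"
    using hyperbolicD[OF hyp V[OF x] V[OF y] V[OF z], of "path_point c ` {0..real (word_dist G S x y)}"]
      geodesic_vertex_path[OF c] geodesic_vertex_path[OF e(1)] geodesic_vertex_path[OF f(1)] c' e f
    by metis
  have connected: "\<exists>l. cayley_path (?V u) (?V w) l" if uw: "u \<in> carrier G" "w \<in> carrier G" for u w
  proof -
    obtain v where v: "vertex_path (word_dist G S u w) v" "v 0 = u" "v (word_dist G S u w) = w"
      using vertex_path_exists[OF uw] by blast
    then show ?thesis
      using path_point_path[OF v(1), of 0 "real (word_dist G S u w)"] path_point_of_nat[of v 0]
        path_point_of_nat[of v "word_dist G S u w"] by auto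
  qed
  have near: "\<exists>r\<in>carrier G. real (word_dist G S p r) \<le> \<delta> + 1 \<and>
      word_dist G S u r + word_dist G S r w = word_dist G S u w"
    if g: "vertex_path (word_dist G S u w) g" "g 0 = u" "g (word_dist G S u w) = w"
      and q: "q \<in> path_point g ` {0..real (word_dist G S u w)}" for g u w
  proof -
    obtain t where t: "t \<in> {0..real (word_dist G S u w)}" "q = path_point g t" using q by auto
    obtain i where i: "i \<le> word_dist G S u w" "cayley_path q (?V (g i)) (t - real i)"
      "t - real i \<le> 1" using geodesic_path_near_vertex[OF g(1) t(1)] t(2) by blast
    have gi: "g i \<in> carrier G" using g i by (auto simp: vertex_path_def)
    obtain l where l: "cayley_path (?V p) (?V (g i)) l" using connected[OF p gi] by blast
    have "?d (?V p) (?V (g i)) \<le> ?d (?V p) q + ?d q (?V (g i))"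
      by (rule cayley_dist_triangle[OF cayley_path_trans[OF l cayley_path_sym[OF i(2)]] i(2)])
    then have "real (word_dist G S p (g i)) \<le> \<delta> + 1"
      using word_dist_le_cayley_dist[OF l p] cayley_dist_le[OF i(2)] i(3) \<open>?d (?V p) q \<le> \<delta>\<close> by linarith
    then show ?thesis using word_dist_geodesic_path[OF g(1) _ i(1)] g gi by auto
  qed
  show ?thesis using q(1) near[OF e] near[OF f] by blast
qed

end

section \<open>Pseudometric trees\<close>

text \<open>
  Real trees in terms of betweenness, where \<open>p\<close> is between \<open>x\<close> and \<open>y\<close> if \<open>D x p + D p y = D x y\<close>.
  This form avoids geodesics, which is what makes it easy to obtain from a limit of discrete spaces;
  for the same reason distinct points may have distance \<open>0\<close>. The last condition replaces hyperbolicity: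
  each side of a triangle is covered by the other two.
\<close>

locale pseudo_tree =
  fixes Y :: "'x set" and D :: "'x \<Rightarrow> 'x \<Rightarrow> real"
  assumes nonempty: "Y \<noteq> {}"
    and D_nonneg: "x \<in> Y \<Longrightarrow> y \<in> Y \<Longrightarrow> 0 \<le> D x y"
    and D_self: "x \<in> Y \<Longrightarrow> D x x = 0"
    and D_commute: "x \<in> Y \<Longrightarrow> y \<in> Y \<Longrightarrow> D x y = D y x"
    and D_triangle: "x \<in> Y \<Longrightarrow> y \<in> Y \<Longrightarrow> z \<in> Y \<Longrightarrow> D x z \<le> D x y + D y z"
    and D_intermediate: "x \<in> Y \<Longrightarrow> y \<in> Y \<Longrightarrow> 0 \<le> t \<Longrightarrow> t \<le> D x y \<Longrightarrow>
      \<exists>z\<in>Y. D x z = t \<and> D z y = D x y - t"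
    and D_thin: "x \<in> Y \<Longrightarrow> y \<in> Y \<Longrightarrow> z \<in> Y \<Longrightarrow> p \<in> Y \<Longrightarrow> D x p + D p y = D x y \<Longrightarrow>
      D y p + D p z = D y z \<or> D z p + D p x = D z x"
begin

text \<open>
  Segments are thus unique and isometric to intervals: of two points between \<open>x\<close> and \<open>y\<close>, the one
  closer to \<open>x\<close> is between \<open>x\<close> and the other.
\<close>

lemma between_dist:
  assumes Y: "x \<in> Y" "y \<in> Y" "p \<in> Y" "q \<in> Y"
    and p: "D x p + D p y = D x y" and q: "D x q + D q y = D x y" and le: "D x p \<le> D x q"
  shows "D p q = D x q - D x p"
  using D_thin[OF Y(1,2,4,3) p] D_nonneg[OF Y(3,4)] p q le
  by (auto simp: D_commute[OF Y(2,3)] D_commute[OF Y(2,4)] D_commute[OF Y(2,1)]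
      D_commute[OF Y(4,3)] D_commute[OF Y(4,1)] D_commute[OF Y(3,1)])

text \<open>
  The quotient by the relation \<open>D x y = 0\<close>, realised by a choice of representatives, so that points and
  distance remain those of the given space.
\<close>

definition representative :: "'x \<Rightarrow> 'x" where
  "representative x = (SOME y. y \<in> Y \<and> D x y = 0)"

definition representatives :: "'x set" where "representatives = representative ` Y"

lemma representative:
  assumes "x \<in> Y" shows "representative x \<in> Y" "D x (representative x) = 0"
proof -
  have "\<exists>y. y \<in> Y \<and> D x y = 0" using assms D_self by blast
  from someI_ex[OF this] show "representative x \<in> Y" "D x (representative x) = 0"
    unfolding representative_def by auto
qed

lemma D_cong:
  assumes Y: "x \<in> Y" "y \<in> Y" "z \<in> Y" and 0: "D x y = 0"
  shows "D x z = D y z" "D z x = D z y"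
proof -
  show *: "D x z = D y z"
    using D_triangle[OF Y] D_triangle[OF Y(2,1,3)] 0 D_commute[OF Y(1,2)] by linarith
  show "D z x = D z y" using * D_commute Y by metis
qed

lemma representative_eq:
  assumes Y: "x \<in> Y" "y \<in> Y" and 0: "D x y = 0"
  shows "representative x = representative y"
proof -
  have "(\<lambda>z. z \<in> Y \<and> D x z = 0) = (\<lambda>z. z \<in> Y \<and> D y z = 0)"
    using D_cong(1)[OF Y _ 0] by auto
  then show ?thesis by (simp add: representative_def)
qed

lemma D_representative:
  assumes "x \<in> Y" "y \<in> Y"
  shows "D (representative x) (representative y) = D x y"
  using D_cong[of x "representative x" "representative y"] D_cong[of y "representative y" x]
    representative assms by metis

lemma representatives_subset: "representatives \<subseteq> Y"
  using representative by (auto simp: representatives_def)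

lemma representative_idem: "x \<in> representatives \<Longrightarrow> representative x = x"
  unfolding representatives_def using representative representative_eq by (metis imageE)

text \<open>
  The predicate \<open>Metric_space\<close> asks for nonnegativity and symmetry on the whole type; hence the value
  \<open>0\<close> outside \<open>Y\<close>.
\<close>

definition tree_dist :: "'x \<Rightarrow> 'x \<Rightarrow> real" where
  "tree_dist x y = (if x \<in> Y \<and> y \<in> Y then D x y else 0)"

lemma Metric_space_representatives: "Metric_space representatives tree_dist"
proof
  fix x y z
  show "0 \<le> tree_dist x y" "tree_dist x y = tree_dist y x"
    by (auto simp: tree_dist_def D_nonneg D_commute)
  show "tree_dist x y = 0 \<longleftrightarrow> x = y" if "x \<in> representatives" "y \<in> representatives"
    using that representatives_subset representative_idem representative_eq D_self
    unfolding tree_dist_def by (metis subsetD)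
  show "tree_dist x z \<le> tree_dist x y + tree_dist y z"
    if "x \<in> representatives" "y \<in> representatives" "z \<in> representatives"
    using that representatives_subset D_triangle by (auto simp: tree_dist_def subset_iff)
qed

text \<open>
  A geodesic is obtained by choosing, for each \<open>t\<close>, any point between \<open>x\<close> and \<open>y\<close> at distance \<open>t\<close> from
  \<open>x\<close>: by \<open>between_dist\<close> the choices fit together. The same lemma shows that points between two others
  lie on every segment that joins them, so thinness of betweenness gives thin triangles.
\<close>

lemma real_tree_representatives: "real_tree representatives tree_dist"
  unfolding real_tree_def
proof (intro conjI)
  interpret M: Metric_space representatives tree_dist by (rule Metric_space_representatives)
  show "representatives \<noteq> {}" using nonempty by (simp add: representatives_def)
  show "Metric_space representatives tree_dist" by (rule Metric_space_representatives)
  have sub: "x \<in> Y" if "x \<in> representatives" for x using that representatives_subset by auto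
  have td: "tree_dist x y = D x y" if "x \<in> representatives" "y \<in> representatives" for x y
    using that sub by (simp add: tree_dist_def)
  show "geodesic_space representatives tree_dist"
    unfolding geodesic_space_def
  proof (intro ballI)
    fix x y assume xy: "x \<in> representatives" "y \<in> representatives"
    have "\<exists>z\<in>representatives. D x z = t \<and> D z y = D x y - t" if t: "t \<in> {0..D x y}" for t
    proof -
      obtain z where z: "z \<in> Y" "D x z = t" "D z y = D x y - t"
        using D_intermediate[OF sub[OF xy(1)] sub[OF xy(2)], of t] t by auto
      then have "D x (representative z) = t" "D (representative z) y = D x y - t"
        using D_cong[of z "representative z"] representative z sub xy by metis+
      then show ?thesis using z(1) by (auto simp: representatives_def)
    qed
    then obtain \<gamma> where \<gamma>: "\<And>t. t \<in> {0..D x y} \<Longrightarrow> \<gamma> t \<in> representatives \<and> D x (\<gamma> t) = t \<and>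
        D (\<gamma> t) y = D x y - t" by metis
    have le: "D (\<gamma> s) (\<gamma> t) = t - s" if "s \<in> {0..D x y}" "t \<in> {0..D x y}" "s \<le> t" for s t
      using between_dist[of x y "\<gamma> s" "\<gamma> t"] \<gamma>[OF that(1)] \<gamma>[OF that(2)] that sub xy by simp
    have dist: "tree_dist (\<gamma> s) (\<gamma> t) = \<bar>s - t\<bar>"
      if "s \<in> {0..tree_dist x y}" "t \<in> {0..tree_dist x y}" for s t
    proof -
      have st: "s \<in> {0..D x y}" "t \<in> {0..D x y}" using that td xy by auto
      then have "tree_dist (\<gamma> s) (\<gamma> t) = D (\<gamma> s) (\<gamma> t)" "tree_dist (\<gamma> s) (\<gamma> t) = D (\<gamma> t) (\<gamma> s)"
        using td \<gamma> M.commute by metis+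
      then show ?thesis using le[OF st] le[OF st(2,1)] by linarith
    qed
    have I: "0 \<in> {0..D x y}" "D x y \<in> {0..D x y}" using D_nonneg sub xy by auto
    have "tree_dist x (\<gamma> 0) = 0" "tree_dist (\<gamma> (D x y)) y = 0"
      using \<gamma>[OF I(1)] \<gamma>[OF I(2)] td xy by auto
    then have \<gamma>_ends: "\<gamma> 0 = x" "\<gamma> (tree_dist x y) = y" using \<gamma> I M.zero xy td by metis+
    have \<gamma>_sub: "\<gamma> ` {0..tree_dist x y} \<subseteq> representatives"
      unfolding td[OF xy] using \<gamma> by blast
    have "geodesic_segment representatives tree_dist x y (\<gamma> ` {0..tree_dist x y})"
      unfolding geodesic_segment_def by (intro exI[of _ \<gamma>] conjI ballI dist \<gamma>_ends \<gamma>_sub HOL.refl)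
    then show "\<exists>A. geodesic_segment representatives tree_dist x y A" by blast
  qed
  show "hyperbolic 0 representatives tree_dist"
    unfolding hyperbolic_def
  proof (intro ballI allI impI, elim conjE)
    fix x y z A B C p
    assume xyz: "x \<in> representatives" "y \<in> representatives" "z \<in> representatives"
      and A: "geodesic_segment representatives tree_dist x y A"
      and B: "geodesic_segment representatives tree_dist y z B"
      and C: "geodesic_segment representatives tree_dist z x C" and p: "p \<in> A"
    have btw: "r \<in> representatives \<and> D u r + D r v = D u v"
      if "geodesic_segment representatives tree_dist u v E" "r \<in> E"
        "u \<in> representatives" "v \<in> representatives" for u v r E
    proof -
      have "r \<in> representatives" using that(1,2) unfolding geodesic_segment_def by auto
      moreover have "tree_dist r v = \<bar>tree_dist u r - tree_dist u v\<bar>" "tree_dist u v \<ge> tree_dist u r"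
        using geodesic_segment_dist[OF that(1,2) geodesic_segment_ends(2)[OF that(1)]]
          M.Metric_space_axioms that(1,2) unfolding geodesic_segment_def by auto
      ultimately show ?thesis using td that by simp
    qed
    have pt: "\<exists>q\<in>E. tree_dist p q \<le> 0"
      if E: "geodesic_segment representatives tree_dist u v E" and uv: "u \<in> representatives" "v \<in> representatives"
        and pE: "p \<in> representatives" "D u p + D p v = D u v" for u v E
    proof -
      obtain c where c: "c 0 = u" "E = c ` {0..tree_dist u v}" "E \<subseteq> representatives"
        "\<And>s t. s \<in> {0..tree_dist u v} \<Longrightarrow> t \<in> {0..tree_dist u v} \<Longrightarrow> tree_dist (c s) (c t) = \<bar>s - t\<bar>"
        using E unfolding geodesic_segment_def by blast
      have t: "D u p \<in> {0..tree_dist u v}" "0 \<in> {0..tree_dist u v}"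
        using pE td uv D_nonneg sub by (metis atLeastAtMost_iff add_increasing2 le_add_same_cancel1 order_refl)+
      define q where "q = c (D u p)"
      have q: "q \<in> E" using c t by (simp add: q_def)
      have "D u q = D u p" using c(4)[OF t(2,1)] c(1,3) td[OF uv(1), of q] q t(1)
        by (auto simp: q_def)
      moreover have "D u q + D q v = D u v" using btw[OF E q uv] by simp
      ultimately have "D p q = 0" using between_dist[of u v p q] pE uv sub c(3) q by auto
      then have "tree_dist p q \<le> 0" using td[OF pE(1)] q c(3) by auto
      then show ?thesis using q by blast
    qed
    have "D y p + D p z = D y z \<or> D z p + D p x = D z x"
      using D_thin btw[OF A p] xyz sub by blast
    then show "\<exists>q\<in>B \<union> C. tree_dist p q \<le> 0"
      using pt[OF B] pt[OF C] btw[OF A p] xyz by blast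
  qed
qed

text \<open>
  An action up to points at distance \<open>0\<close> descends to the tree, so property (FR) applies to it.
\<close>

lemma property_FR_fixed_point:
  fixes G :: "'a monoid"
  assumes FR: "property_FR G" and G: "group G" and ctbl: "countable (carrier G)"
    and act_closed: "\<And>g x. g \<in> carrier G \<Longrightarrow> x \<in> Y \<Longrightarrow> act g x \<in> Y"
    and act_iso: "\<And>g x y. g \<in> carrier G \<Longrightarrow> x \<in> Y \<Longrightarrow> y \<in> Y \<Longrightarrow> D (act g x) (act g y) = D x y"
    and act_one: "\<And>x. x \<in> Y \<Longrightarrow> D (act \<one>\<^bsub>G\<^esub> x) x = 0"
    and act_mult: "\<And>g h x. g \<in> carrier G \<Longrightarrow> h \<in> carrier G \<Longrightarrow> x \<in> Y \<Longrightarrow>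
      D (act (g \<otimes>\<^bsub>G\<^esub> h) x) (act g (act h x)) = 0"
  shows "\<exists>x\<in>Y. \<forall>g\<in>carrier G. D (act g x) x = 0"
proof -
  interpret G: group G by (rule G)
  let ?T = representatives
  define \<rho> where "\<rho> = (\<lambda>g. \<lambda>x\<in>?T. representative (act g x))"
  have sub: "x \<in> Y" if "x \<in> ?T" for x using that representatives_subset by auto
  have \<rho>: "\<rho> g x = representative (act g x)" if "x \<in> ?T" for g x using that by (simp add: \<rho>_def)
  have \<rho>T: "\<rho> g x \<in> ?T" if "g \<in> carrier G" "x \<in> ?T" for g x
    using that act_closed sub by (auto simp: \<rho> representatives_def)
  have \<rho>1: "\<rho> \<one>\<^bsub>G\<^esub> x = x" if "x \<in> ?T" for x
    using that \<rho> representative_eq[OF _ _ act_one] act_closed sub representative_idem by simp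
  have \<rho>m: "\<rho> (g \<otimes>\<^bsub>G\<^esub> h) x = \<rho> g (\<rho> h x)" if gh: "g \<in> carrier G" "h \<in> carrier G" "x \<in> ?T" for g h x
  proof -
    have x: "x \<in> Y" "act h x \<in> Y" using gh sub act_closed by auto
    have r: "representative (act h x) \<in> Y" "D (act h x) (representative (act h x)) = 0"
      using representative x by auto
    have "representative (act (g \<otimes>\<^bsub>G\<^esub> h) x) = representative (act g (act h x))"
      using representative_eq[OF _ _ act_mult] gh x act_closed by simp
    also have "\<dots> = representative (act g (representative (act h x)))"
      using act_iso[OF gh(1) x(2) r(1)] r(2) act_closed gh(1) x r by (intro representative_eq) auto
    finally show ?thesis using gh \<rho>T by (simp add: \<rho>)
  qed
  have bij: "bij_betw (\<rho> g) ?T ?T" if "g \<in> carrier G" for g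
    by (rule bij_betwI[of _ _ _ "\<rho> (inv\<^bsub>G\<^esub> g)"]) (use that \<rho>T \<rho>m[symmetric] \<rho>1 in auto)
  have Bij: "\<rho> g \<in> Bij ?T" if "g \<in> carrier G" for g
    using bij[OF that] by (auto simp: Bij_def \<rho>_def)
  have "isometric_action G ?T tree_dist \<rho>"
    unfolding isometric_action_def
  proof
    have "\<rho> \<in> hom G (BijGroup ?T)"
    proof (rule homI)
      fix g h assume gh: "g \<in> carrier G" "h \<in> carrier G"
      show "\<rho> g \<in> carrier (BijGroup ?T)" using Bij gh by (simp add: BijGroup_def)
      show "\<rho> (g \<otimes>\<^bsub>G\<^esub> h) = \<rho> g \<otimes>\<^bsub>BijGroup ?T\<^esub> \<rho> h"
      proof
        fix x show "\<rho> (g \<otimes>\<^bsub>G\<^esub> h) x = (\<rho> g \<otimes>\<^bsub>BijGroup ?T\<^esub> \<rho> h) x"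
          using gh Bij \<rho>m
          by (cases "x \<in> ?T") (auto simp: BijGroup_def compose_def, simp add: \<rho>_def)
      qed
    qed
    then show "group_action G ?T \<rho>"
      by (simp add: group_action_def group_hom_def group_hom_axioms_def G group_BijGroup)
    show "\<forall>g\<in>carrier G. \<forall>x\<in>?T. \<forall>y\<in>?T. tree_dist (\<rho> g x) (\<rho> g y) = tree_dist x y"
      using \<rho>T sub act_closed by (auto simp: tree_dist_def \<rho> D_representative act_iso)
  qed
  then obtain x where x: "x \<in> ?T" "\<And>g. g \<in> carrier G \<Longrightarrow> \<rho> g x = x"
    using property_FR_all_types[OF FR G ctbl real_tree_representatives] by blast
  have "D (act g x) x = 0" if g: "g \<in> carrier G" for g
    using x(2)[OF g] representative(2)[of "act g x"] act_closed g sub x(1) \<rho> by simp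
  then show ?thesis using sub x(1) by blast
qed

end

section \<open>Ultralimits of asymptotically thin spaces\<close>

text \<open>
  The tree on which the group acts is a limit of rescaled Cayley graphs. An ultrafilter makes all
  bounded sequences of distances converge at once and decides which of two sides of a triangle a
  sequence of points is close to.
\<close>

definition ultrafilter :: "'i filter \<Rightarrow> bool" where
  "ultrafilter U \<longleftrightarrow> U \<noteq> bot \<and> (\<forall>P. eventually P U \<or> eventually (\<lambda>i. \<not> P i) U)"

lemma ultrafilter_exists:
  fixes F :: "'i filter"
  assumes F: "F \<noteq> bot"
  shows "\<exists>U\<le>F. ultrafilter U"
proof -
  \<comment> \<open>Zorn's lemma for proper filters, encoded by their sets of eventual predicates\<close>
  define A where "A = {H. H \<noteq> bot \<and> H \<le> F}"
  define ev where "ev = (\<lambda>H :: 'i filter. {P. eventually P H})"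
  have le: "H \<le> K \<longleftrightarrow> ev K \<subseteq> ev H" for H K by (auto simp: ev_def le_filter_def)
  have "\<exists>M\<in>ev ` A. \<forall>H\<in>ev ` A. M \<subseteq> H \<longrightarrow> H = M"
  proof (rule Zorn_Lemma2, intro ballI)
    fix C assume C: "C \<in> chains (ev ` A)"
    show "\<exists>H\<in>ev ` A. \<forall>M\<in>C. M \<subseteq> H"
    proof (cases "C = {}")
      case True
      then show ?thesis using F by (auto simp: A_def)
    next
      case False
      define B where "B = {H\<in>A. ev H \<in> C}"
      have C_eq: "C = ev ` B" using chainsD2[OF C] by (auto simp: B_def)
      have B: "B \<noteq> {}" using False C_eq by auto
      have dir: "\<exists>x\<in>B. x \<le> inf H K" if HK: "H \<in> B" "K \<in> B" for H K
        using chainsD[OF C, of "ev H" "ev K"] HK le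
        by (metis (no_types, lifting) B_def inf.absorb1 inf.absorb2 mem_Collect_eq order_refl)
      have "Inf B \<noteq> bot"
        using eventually_Inf_base[OF B dir, of "\<lambda>_. False"]
        by (auto simp: trivial_limit_def B_def A_def)
      moreover have "Inf B \<le> F" using B by (auto simp: B_def A_def intro: Inf_lower2)
      ultimately have "Inf B \<in> A" by (simp add: A_def)
      moreover have "ev H \<subseteq> ev (Inf B)" if "H \<in> B" for H using le Inf_lower[OF that] by blast
      ultimately show ?thesis using C_eq by blast
    qed
  qed
  then obtain U where U: "U \<in> A" "\<And>H. H \<in> A \<Longrightarrow> H \<le> U \<Longrightarrow> ev H = ev U" using le by auto
  have "eventually P U \<or> eventually (\<lambda>i. \<not> P i) U" for P
  proof (rule disjCI)
    assume np: "\<not> eventually (\<lambda>i. \<not> P i) U"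
    define H where "H = inf U (principal (Collect P))"
    have "H \<noteq> bot" using np by (simp add: H_def trivial_limit_def eventually_inf_principal)
    then have "H \<in> A" "H \<le> U" using U(1) by (auto simp: A_def H_def intro: le_infI1)
    then have "ev H = ev U" by (rule U(2))
    moreover have "eventually P H" by (simp add: H_def eventually_inf_principal)
    ultimately show "eventually P U" by (auto simp: ev_def)
  qed
  then show ?thesis using U(1) by (auto simp: A_def ultrafilter_def)
qed

lemma ultrafilter_disj:
  assumes "ultrafilter U" "eventually (\<lambda>i. P i \<or> Q i) U"
  shows "eventually P U \<or> eventually Q U"
proof (cases "eventually P U")
  case False
  then have "eventually (\<lambda>i. \<not> P i) U" using assms(1) by (auto simp: ultrafilter_def)
  with assms(2) have "eventually Q U" by eventually_elim auto
  then show ?thesis ..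
qed simp

lemma ultrafilter_finite_Bex:
  assumes U: "ultrafilter U" and "finite A" and "eventually (\<lambda>i. \<exists>a\<in>A. P a i) U"
  shows "\<exists>a\<in>A. eventually (P a) U"
  using assms(2,3)
proof (induction A)
  case empty
  then show ?case using U by (simp add: ultrafilter_def trivial_limit_def)
next
  case (insert a A)
  then show ?case using ultrafilter_disj[OF U, of "P a" "\<lambda>i. \<exists>a\<in>A. P a i"] by auto
qed

text \<open>An ultrafilter converges to each of its cluster points, and a compact interval provides one.\<close>

lemma ultrafilter_bounded_tendsto:
  fixes f :: "'i \<Rightarrow> real"
  assumes U: "ultrafilter U" and bd: "\<And>i. \<bar>f i\<bar> \<le> C"
  shows "\<exists>l. filterlim f (nhds l) U"
proof -
  have "eventually (\<lambda>x. x \<in> {-C..C}) (filtermap f U)"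
    using bd by (auto simp: eventually_filtermap abs_le_iff minus_le_iff intro!: always_eventually)
  moreover have "filtermap f U \<noteq> bot" using U by (simp add: ultrafilter_def filtermap_bot_iff)
  ultimately obtain l where l: "inf (nhds l) (filtermap f U) \<noteq> bot"
    using compact_Icc[of "-C" C] unfolding compact_filter by blast
  have "eventually (\<lambda>i. f i \<in> V) U" if V: "open V" "l \<in> V" for V
  proof (rule ccontr)
    assume "\<not> ?thesis"
    then have "eventually (\<lambda>i. f i \<notin> V) U" using U by (auto simp: ultrafilter_def)
    then have "eventually (\<lambda>x. x \<notin> V) (filtermap f U)" by (simp add: eventually_filtermap)
    moreover have "eventually (\<lambda>x. x \<in> V) (nhds l)" using V by (simp add: eventually_nhds_in_open)
    ultimately have "eventually (\<lambda>x. False) (inf (nhds l) (filtermap f U))"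
      unfolding eventually_inf by blast
    then show False using l by (simp add: trivial_limit_def)
  qed
  then show ?thesis by (intro exI[of _ l] topological_tendstoI) auto
qed

text \<open>
  Spaces that satisfy the axioms of a pseudometric tree up to an error \<open>e\<close> that tends to \<open>0\<close>. In the
  application \<open>e\<close> covers both the discreteness of the word metrics and the thinness of their triangles.
\<close>

locale asymptotically_thin_spaces =
  fixes U :: "nat filter" and M :: "nat \<Rightarrow> 'x set" and d :: "nat \<Rightarrow> 'x \<Rightarrow> 'x \<Rightarrow> real"
    and b :: "nat \<Rightarrow> 'x" and e :: "nat \<Rightarrow> real"
  assumes U: "ultrafilter U"
    and base: "b n \<in> M n"
    and d_nonneg: "x \<in> M n \<Longrightarrow> y \<in> M n \<Longrightarrow> 0 \<le> d n x y"
    and d_self: "x \<in> M n \<Longrightarrow> d n x x = 0"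
    and d_commute: "x \<in> M n \<Longrightarrow> y \<in> M n \<Longrightarrow> d n x y = d n y x"
    and d_triangle: "x \<in> M n \<Longrightarrow> y \<in> M n \<Longrightarrow> z \<in> M n \<Longrightarrow> d n x z \<le> d n x y + d n y z"
    and error_tendsto: "filterlim e (nhds 0) U"
    and d_intermediate: "x \<in> M n \<Longrightarrow> y \<in> M n \<Longrightarrow> 0 \<le> t \<Longrightarrow> t \<le> d n x y \<Longrightarrow>
      \<exists>z\<in>M n. d n x z + d n z y = d n x y \<and> \<bar>d n x z - t\<bar> \<le> e n"
    and d_thin: "x \<in> M n \<Longrightarrow> y \<in> M n \<Longrightarrow> z \<in> M n \<Longrightarrow> p \<in> M n \<Longrightarrow>
      d n x p + d n p y = d n x y \<Longrightarrow>
      \<exists>q\<in>M n. d n p q \<le> e n \<and> (d n y q + d n q z = d n y z \<or> d n z q + d n q x = d n z x)"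
begin

text \<open>The ultralimit, with sequences of points as its points.\<close>

definition bounded_seqs :: "(nat \<Rightarrow> 'x) set" where
  "bounded_seqs = {x. (\<forall>n. x n \<in> M n) \<and> (\<exists>C. \<forall>n. d n (b n) (x n) \<le> C)}"

definition ultradist :: "(nat \<Rightarrow> 'x) \<Rightarrow> (nat \<Rightarrow> 'x) \<Rightarrow> real" where
  "ultradist x y = Lim U (\<lambda>n. d n (x n) (y n))"

lemma not_bot: "U \<noteq> bot" using U by (simp add: ultrafilter_def)

lemma bounded_seqs_in: "x \<in> bounded_seqs \<Longrightarrow> x n \<in> M n" by (simp add: bounded_seqs_def)

lemma bounded_seqsI:
  assumes x: "x \<in> bounded_seqs" and z: "\<And>n. z n \<in> M n" and C: "\<And>n. d n (x n) (z n) \<le> C"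
  shows "z \<in> bounded_seqs"
proof -
  obtain D where D: "\<And>n. d n (b n) (x n) \<le> D" using x by (auto simp: bounded_seqs_def)
  have "d n (b n) (z n) \<le> D + C" for n
    using d_triangle[of "b n" n "x n" "z n"] base bounded_seqs_in[OF x] z C[of n] D[of n]
    by (smt (verit))
  then show ?thesis using z by (auto simp: bounded_seqs_def)
qed

lemma bounded_seqs_dist:
  assumes x: "x \<in> bounded_seqs" and y: "y \<in> bounded_seqs"
  shows "\<exists>C. \<forall>n. d n (x n) (y n) \<le> C"
proof -
  obtain C D where "\<And>n. d n (b n) (x n) \<le> C" "\<And>n. d n (b n) (y n) \<le> D"
    using x y by (auto simp: bounded_seqs_def)
  then have "d n (x n) (y n) \<le> C + D" for n
    using d_triangle[of "x n" n "b n" "y n"] d_commute[of "x n" n "b n"] base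
      bounded_seqs_in[OF x] bounded_seqs_in[OF y] by (smt (verit))
  then show ?thesis by blast
qed

lemma tendsto_ultradist:
  assumes x: "x \<in> bounded_seqs" and y: "y \<in> bounded_seqs"
  shows "filterlim (\<lambda>n. d n (x n) (y n)) (nhds (ultradist x y)) U"
proof -
  obtain C where "\<And>n. d n (x n) (y n) \<le> C" using bounded_seqs_dist[OF x y] by blast
  then have bd: "\<bar>d n (x n) (y n)\<bar> \<le> C" for n
    using d_nonneg bounded_seqs_in x y by simp
  obtain l where "filterlim (\<lambda>n. d n (x n) (y n)) (nhds l) U"
    using ultrafilter_bounded_tendsto[OF U, of "\<lambda>n. d n (x n) (y n)" C, OF bd] by blast
  then show ?thesis unfolding ultradist_def using tendsto_Lim[OF not_bot] by metis
qed

lemma ultradist_eqI: "filterlim (\<lambda>n. d n (x n) (y n)) (nhds l) U \<Longrightarrow> ultradist x y = l"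
  unfolding ultradist_def using tendsto_Lim[OF not_bot] .

lemma ultradist_eventually_eq:
  assumes "x \<in> bounded_seqs" "eventually (\<lambda>n. x n = y n) U"
  shows "ultradist x y = 0"
proof (rule ultradist_eqI)
  have "eventually (\<lambda>n. d n (x n) (y n) = 0) U"
    using assms(2) by eventually_elim (metis assms(1) bounded_seqs_in d_self)
  then show "filterlim (\<lambda>n. d n (x n) (y n)) (nhds 0) U"
    by (rule tendsto_eventually)
qed

text \<open>
  Thinness for a limit of points that are exactly between. At each stage one of the other two sides
  comes close to \<open>p\<close>, and the ultrafilter selects one that does so for almost all stages.
\<close>

lemma ultradist_thin:
  assumes x: "x \<in> bounded_seqs" and y: "y \<in> bounded_seqs" and z: "z \<in> bounded_seqs"
    and p: "p \<in> bounded_seqs" and btw: "\<And>n. d n (x n) (p n) + d n (p n) (y n) = d n (x n) (y n)"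
  shows "ultradist y p + ultradist p z = ultradist y z \<or> ultradist z p + ultradist p x = ultradist z x"
proof -
  have "\<forall>n. \<exists>q\<in>M n. d n (p n) q \<le> e n \<and>
      (d n (y n) q + d n q (z n) = d n (y n) (z n) \<or> d n (z n) q + d n q (x n) = d n (z n) (x n))"
    using d_thin bounded_seqs_in x y z p btw by blast
  then obtain q where q: "\<And>n. q n \<in> M n" "\<And>n. d n (p n) (q n) \<le> e n"
    "\<And>n. d n (y n) (q n) + d n (q n) (z n) = d n (y n) (z n) \<or>
      d n (z n) (q n) + d n (q n) (x n) = d n (z n) (x n)" by metis
  have side: "ultradist u p + ultradist p v = ultradist u v"
    if u: "u \<in> bounded_seqs" and v: "v \<in> bounded_seqs"
      and ev: "eventually (\<lambda>n. d n (u n) (q n) + d n (q n) (v n) = d n (u n) (v n)) U" for u v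
  proof (rule tendsto_unique[OF not_bot _ tendsto_ultradist[OF u v]])
    have lim: "filterlim (\<lambda>n. d n (u n) (p n) + d n (p n) (v n))
        (nhds (ultradist u p + ultradist p v)) U"
      by (intro tendsto_add tendsto_ultradist u v p)
    have "filterlim (\<lambda>n. (d n (u n) (p n) + d n (p n) (v n)) - d n (u n) (v n)) (nhds 0) U"
    proof (rule tendsto_sandwich[of "\<lambda>_. 0" _ _ "\<lambda>n. 2 * e n"])
      show "filterlim (\<lambda>n. 2 * e n) (nhds 0) U"
        using tendsto_mult_left[OF error_tendsto, of 2] by simp
      show "eventually (\<lambda>n. 0 \<le> (d n (u n) (p n) + d n (p n) (v n)) - d n (u n) (v n)) U"
        using d_triangle[OF bounded_seqs_in[OF u] bounded_seqs_in[OF p] bounded_seqs_in[OF v]]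
        by (intro always_eventually) simp
      show "eventually (\<lambda>n. (d n (u n) (p n) + d n (p n) (v n)) - d n (u n) (v n) \<le> 2 * e n) U"
        using ev
      proof eventually_elim
        case (elim n)
        have i: "u n \<in> M n" "v n \<in> M n" "p n \<in> M n" "q n \<in> M n"
          using bounded_seqs_in u v p q(1) by auto
        show ?case using d_triangle[OF i(1,4,3)] d_triangle[OF i(3,4,2)] d_commute[OF i(4,3)] q(2)[of n] elim
          by linarith
      qed
    qed simp
    then have "filterlim (\<lambda>n. d n (u n) (v n) + ((d n (u n) (p n) + d n (p n) (v n)) - d n (u n) (v n)))
        (nhds (ultradist u v + 0)) U"
      by (intro tendsto_add tendsto_ultradist u v)
    then have "filterlim (\<lambda>n. d n (u n) (p n) + d n (p n) (v n)) (nhds (ultradist u v)) U" by simp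
    then have "ultradist u v = ultradist u p + ultradist p v"
      using tendsto_unique[OF not_bot _ lim] by blast
    then show "filterlim (\<lambda>n. d n (u n) (v n)) (nhds (ultradist u p + ultradist p v)) U"
      using tendsto_ultradist[OF u v] by simp
  qed
  have "eventually (\<lambda>n. d n (y n) (q n) + d n (q n) (z n) = d n (y n) (z n) \<or>
      d n (z n) (q n) + d n (q n) (x n) = d n (z n) (x n)) U"
    using q(3) by (intro always_eventually) blast
  from ultrafilter_disj[OF U this] show ?thesis using side[OF y z] side[OF z x] by blast
qed

lemma ultradist_intermediate:
  assumes x: "x \<in> bounded_seqs" and y: "y \<in> bounded_seqs" and t: "0 \<le> t" "t \<le> ultradist x y"
  shows "\<exists>z\<in>bounded_seqs. ultradist x z = t \<and> ultradist z y = ultradist x y - t \<and>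
           (\<forall>n. d n (x n) (z n) + d n (z n) (y n) = d n (x n) (y n))"
proof -
  have i: "x n \<in> M n" "y n \<in> M n" for n using bounded_seqs_in x y by auto
  have "\<forall>n. \<exists>z\<in>M n. d n (x n) z + d n z (y n) = d n (x n) (y n) \<and>
      \<bar>d n (x n) z - min t (d n (x n) (y n))\<bar> \<le> e n"
    using d_intermediate[OF i, of "min t _"] t d_nonneg[OF i] by simp
  then obtain z where z: "\<And>n. z n \<in> M n"
    "\<And>n. d n (x n) (z n) + d n (z n) (y n) = d n (x n) (y n)"
    "\<And>n. \<bar>d n (x n) (z n) - min t (d n (x n) (y n))\<bar> \<le> e n" by metis
  obtain C where C: "\<And>n. d n (x n) (y n) \<le> C" using bounded_seqs_dist[OF x y] by blast
  have "d n (x n) (z n) \<le> C" for n using z(2)[of n] C[of n] d_nonneg[OF z(1) i(2), of n] by linarith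
  then have zb: "z \<in> bounded_seqs" using bounded_seqsI[OF x z(1)] by blast
  have "filterlim (\<lambda>n. d n (x n) (z n) - min t (d n (x n) (y n))) (nhds 0) U"
    by (rule Lim_null_comparison[OF _ error_tendsto]) (use z(3) in simp)
  moreover have "filterlim (\<lambda>n. min t (d n (x n) (y n))) (nhds (min t (ultradist x y))) U"
    by (intro tendsto_min tendsto_const tendsto_ultradist x y)
  ultimately have "filterlim (\<lambda>n. d n (x n) (z n)) (nhds (min t (ultradist x y))) U"
    using tendsto_add by fastforce
  then have xz: "ultradist x z = t" using ultradist_eqI t by (simp add: min_def)
  have "filterlim (\<lambda>n. d n (x n) (z n) + d n (z n) (y n)) (nhds (ultradist x z + ultradist z y)) U"
    by (intro tendsto_add tendsto_ultradist x y zb)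
  then have "ultradist x z + ultradist z y = ultradist x y"
    using ultradist_eqI[of x y] z(2) by simp
  then show ?thesis using zb xz z(2) by (intro bexI[of _ z]) auto
qed

text \<open>
  A point \<open>p\<close> between \<open>x\<close> and \<open>y\<close> in the limit is only approximately between at each stage, so
  \<open>ultradist_thin\<close> does not apply to it. It applies to a limit \<open>r\<close> of points between with the same
  distance to \<open>x\<close>; with \<open>p\<close> as third vertex it gives that \<open>p\<close> and \<open>r\<close> have distance \<open>0\<close>.
\<close>

lemma pseudo_tree_ultradist: "pseudo_tree bounded_seqs ultradist"
proof
  show "bounded_seqs \<noteq> {}"
  proof -
    have "b \<in> bounded_seqs" using base d_self by (auto simp: bounded_seqs_def)
    then show ?thesis by blast
  qed
  note lim = tendsto_ultradist and i = bounded_seqs_in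
  show nonneg: "0 \<le> ultradist x y" if "x \<in> bounded_seqs" "y \<in> bounded_seqs" for x y
    by (rule tendsto_lowerbound[OF lim[OF that] _ not_bot]) (use d_nonneg i that in simp)
  show "ultradist x x = 0" if "x \<in> bounded_seqs" for x
    by (rule ultradist_eventually_eq[OF that]) simp
  show commute: "ultradist x y = ultradist y x" if "x \<in> bounded_seqs" "y \<in> bounded_seqs" for x y
  proof -
    have "(\<lambda>n. d n (x n) (y n)) = (\<lambda>n. d n (y n) (x n))" using d_commute i that by blast
    then show ?thesis by (simp only: ultradist_def)
  qed
  show triangle: "ultradist x z \<le> ultradist x y + ultradist y z"
    if "x \<in> bounded_seqs" "y \<in> bounded_seqs" "z \<in> bounded_seqs" for x y z
    by (rule tendsto_le[OF not_bot tendsto_add[OF lim lim] lim])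
      (use d_triangle i that in auto)
  show "\<exists>z\<in>bounded_seqs. ultradist x z = t \<and> ultradist z y = ultradist x y - t"
    if "x \<in> bounded_seqs" "y \<in> bounded_seqs" "0 \<le> t" "t \<le> ultradist x y" for x y t
    using ultradist_intermediate[OF that] by blast
  show "ultradist y p + ultradist p z = ultradist y z \<or> ultradist z p + ultradist p x = ultradist z x"
    if x: "x \<in> bounded_seqs" and y: "y \<in> bounded_seqs" and z: "z \<in> bounded_seqs"
      and p: "p \<in> bounded_seqs" and btw: "ultradist x p + ultradist p y = ultradist x y" for x y z p
  proof -
    obtain r where r: "r \<in> bounded_seqs" "ultradist x r = ultradist x p"
      "ultradist r y = ultradist x y - ultradist x p"
      "\<And>n. d n (x n) (r n) + d n (r n) (y n) = d n (x n) (y n)"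
      using ultradist_intermediate[OF x y, of "ultradist x p"] nonneg[OF x p] nonneg[OF p y] btw
      by auto
    have "ultradist y r + ultradist r p = ultradist y p \<or> ultradist p r + ultradist r x = ultradist p x"
      by (rule ultradist_thin[OF x y p r(1,4)])
    then have pr: "ultradist p r = 0"
      using r(2,3) btw commute[OF r(1) p] commute[OF r(1) y] commute[OF r(1) x] commute[OF p y]
        commute[OF p x] by linarith
    have eq: "ultradist u p = ultradist u r" "ultradist p u = ultradist r u"
      if u: "u \<in> bounded_seqs" for u
      using triangle[OF u p r(1)] triangle[OF u r(1) p] pr commute[OF r(1) p] commute[OF u p]
        commute[OF u r(1)] by linarith+
    show ?thesis using ultradist_thin[OF x y z r(1,4)] eq[OF x] eq[OF y] eq[OF z] by simp
  qed
qed

end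

section \<open>Lifting endomorphisms along injective balls\<close>

lemma map_apfst_words: "w \<in> words S \<Longrightarrow> f ` S \<subseteq> T \<Longrightarrow> map (apfst f) w \<in> words T"
  by (induction w rule: words_induct) auto

lemma (in group_hom) hom_word_val:
  "w \<in> words T \<Longrightarrow> T \<subseteq> carrier G \<Longrightarrow> h (word_val G w) = word_val H (map (apfst h) w)"
  by (induction w rule: words_induct) (auto simp: G.word_val_in_carrier subset_iff)

text \<open>Von Dyck's theorem: a map on the generators that respects the relators extends.\<close>

lemma presentation_hom:
  assumes pres: "is_presentation G S R" and G: "group G" and H: "group H" and f: "f ` S \<subseteq> carrier H"
    and rel: "\<And>r. r \<in> R \<Longrightarrow> word_val H (map (apfst f) r) = \<one>\<^bsub>H\<^esub>"
  shows "\<exists>h\<in>hom G H. \<forall>s\<in>S. h s = f s"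
proof -
  interpret H: group H by (rule H)
  interpret G: generated_group G S
    using pres G by (simp add: is_presentation_def generated_group_def generated_group_axioms_def)
  let ?e = "\<lambda>w. word_val H (map (apfst f) w)"
  have m: "map (apfst f) w \<in> words (f ` S)" if "w \<in> words S" for w
    using map_apfst_words[OF that order_refl] .
  have app: "?e (v @ w) = ?e v \<otimes>\<^bsub>H\<^esub> ?e w" if "v \<in> words S" "w \<in> words S" for v w
    using H.word_val_mult[OF m[OF that(1)] m[OF that(2)] f] by simp
  have closed: "?e w \<in> carrier H" if "w \<in> words S" for w
    using H.word_val_in_carrier[OF m[OF that] f] .
  have "presentation_eq S R v w \<Longrightarrow> ?e v = ?e w" for v w
  proof (induction rule: presentation_eq.induct)
    case (cancel u v s b)
    have fs: "f s \<in> carrier H" using f cancel by auto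
    have "?e [(s, b), (s, \<not> b)] = \<one>\<^bsub>H\<^esub>" using fs by auto
    then show ?case using cancel app[of u "[(s, b), (s, \<not> b)] @ v"] app[of "[(s, b), (s, \<not> b)]" v]
        app[of u v] closed by simp
  next
    case (relator u v r)
    then have "r \<in> words S" using pres by (auto simp: is_presentation_def)
    then show ?case using relator app[of u "r @ v"] app[of r v] app[of u v] closed rel by simp
  qed auto
  then have wd: "?e v = ?e w" if "v \<in> words S" "w \<in> words S" "word_val G v = word_val G w" for v w
    using that pres by (auto simp: is_presentation_def)
  have "\<exists>w. w \<in> words S \<and> word_val G w = g" if "g \<in> carrier G" for g
    using G.word_exists[OF that] by blast
  then obtain c where c: "\<And>g. g \<in> carrier G \<Longrightarrow> c g \<in> words S \<and> word_val G (c g) = g" by metis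
  have "(\<lambda>g. ?e (c g)) \<in> hom G H"
  proof (rule homI)
    fix g h assume gh: "g \<in> carrier G" "h \<in> carrier G"
    then show "?e (c g) \<in> carrier H" using c closed by blast
    have "?e (c (g \<otimes>\<^bsub>G\<^esub> h)) = ?e (c g @ c h)"
      using c gh by (intro wd) (auto simp: G.word_val_append)
    then show "?e (c (g \<otimes>\<^bsub>G\<^esub> h)) = ?e (c g) \<otimes>\<^bsub>H\<^esub> ?e (c h)" using c gh app by simp
  qed
  moreover have "?e (c s) = f s" if s: "s \<in> S" for s
  proof -
    have "s \<in> carrier G" using s G.generators_closed by auto
    then have "?e (c s) = ?e [(s, True)]" using c s by (intro wd) auto
    then show ?thesis using s f by auto
  qed
  ultimately show ?thesis by (intro bexI[of _ "\<lambda>g. ?e (c g)"] ballI)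
qed

lemma (in generated_group) hom_eqI:
  assumes H: "group H" and f: "f \<in> hom G H" and h: "h \<in> hom G H"
    and eq: "\<And>s. s \<in> S \<Longrightarrow> f s = h s" and g: "g \<in> carrier G"
  shows "f g = h g"
proof -
  interpret H: group H by (rule H)
  interpret f: group_hom G H f by unfold_locales (rule f)
  interpret h: group_hom G H h by unfold_locales (rule h)
  obtain w where w: "w \<in> words S" "word_val G w = g" using word_exists[OF g] by blast
  have "map (apfst f) w = map (apfst h) w"
    using w(1) eq by (induction w rule: words_induct) auto
  then show ?thesis
    using f.hom_word_val[OF w(1) generators_closed] h.hom_word_val[OF w(1) generators_closed] w(2)
    by metis
qed

locale generated_group_epi =
  K: generated_group K T + G: generated_group G S + group_hom K G h
  for K :: "'b monoid" and T and G :: "'a monoid" and S and h +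
  assumes image_generators: "h ` T = S"
begin

lemma word_length_image_le:
  assumes "x \<in> carrier K" shows "word_length G S (h x) \<le> word_length K T x"
proof -
  have "real (word_length G S (h x)) \<le> 1 * real (word_length K T x)"
  proof (rule K.hom_length_le)
    show "generated_group G S" by (rule G.generated_group_axioms)
    fix t assume "t \<in> T"
    then have "h t \<in> S" using image_generators by auto
    then show "real (word_length G S (h t)) \<le> 1" using G.word_length_generator[of "h t"] by simp
  qed (use homh assms in auto)
  then show ?thesis by simp
qed

lemma lift_element:
  assumes g: "g \<in> carrier G"
  shows "\<exists>x\<in>carrier K. h x = g \<and> word_length K T x \<le> word_length G S g"
proof -
  have lift: "\<exists>v\<in>words T. length v = length w \<and> map (apfst h) v = w" if "w \<in> words S" for w
    using that
  proof (induction w rule: words_induct)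
    case Nil
    show ?case by (rule bexI[of _ "[]"]) auto
  next
    case (Cons s b w)
    then obtain v t where "v \<in> words T" "length v = length w" "map (apfst h) v = w" "t \<in> T" "h t = s"
      using image_generators by auto
    then show ?case by (intro bexI[of _ "(t, b) # v"]) auto
  qed
  obtain w where w: "w \<in> words S" "length w = word_length G S g" "word_val G w = g"
    using G.word_length_attained[OF g] by blast
  obtain v where v: "v \<in> words T" "length v = length w" "map (apfst h) v = w"
    using lift[OF w(1)] by blast
  then have "h (word_val K v) = g" using hom_word_val[OF v(1) K.generators_closed] w by simp
  then show ?thesis using v w K.word_length_le[OF v(1)] K.word_val_closed[OF v(1)]
    by (intro bexI[of _ "word_val K v"]) auto
qed

text \<open>Strict inequality in \<open>ereal\<close> treats finite and infinite injectivity radii alike.\<close>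

lemma inj_radius_kernel:
  assumes x: "x \<in> carrier K" and hx: "h x = \<one>\<^bsub>G\<^esub>"
    and less: "ereal (real (word_length K T x)) < ereal_of_enat (inj_radius K T h)"
  shows "x = \<one>\<^bsub>K\<^esub>"
proof -
  have "ereal_of_enat (enat (word_length K T x)) < ereal_of_enat (inj_radius K T h)"
    using less by simp
  then have "enat (word_length K T x) < inj_radius K T h" by (simp only: ereal_of_enat_less_iff)
  then obtain r where r: "word_length K T x < r"
    "inj_on h {y \<in> carrier K. word_dist K T \<one>\<^bsub>K\<^esub> y \<le> r}"
    unfolding inj_radius_def less_Sup_iff by auto
  have "h x = h \<one>\<^bsub>K\<^esub>" using hx by simp
  from inj_onD[OF r(2) this] show ?thesis using x r(1) by simp
qed

text \<open>
  Lift the images of the generators to elements of length at most \<open>m\<close>. A relator of length at most \<open>l\<close>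
  is then sent to an element of length at most \<open>l * m\<close> in the kernel of \<open>h\<close>. This element is trivial,
  because \<open>h\<close> is injective on balls of radius \<open>l * m\<close>. So the lifts define an endomorphism.
\<close>

lemma lift_endomorphism:
  assumes pres: "is_presentation K T R" and len: "\<And>r. r \<in> R \<Longrightarrow> real (length r) \<le> l"
    and f: "f \<in> hom G G" and m: "m \<ge> 0"
    and fm: "\<And>s. s \<in> S \<Longrightarrow> real (word_length G S (f s)) \<le> m"
    and inj: "ereal (l * m) < ereal_of_enat (inj_radius K T h)"
  shows "\<exists>F\<in>hom K K. \<forall>x\<in>carrier K. h (F x) = f (h x)"
proof -
  interpret f: group_hom G G f by unfold_locales (rule f)
  have "\<exists>y. y \<in> carrier K \<and> h y = f (h t) \<and> real (word_length K T y) \<le> m" if "t \<in> T" for t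
  proof -
    have t: "h t \<in> S" "h t \<in> carrier G" using that image_generators G.generators_closed by auto
    obtain y where "y \<in> carrier K" "h y = f (h t)" "word_length K T y \<le> word_length G S (f (h t))"
      using lift_element[of "f (h t)"] t by auto
    then show ?thesis using fm[OF t(1)] by force
  qed
  then obtain c where c: "\<And>t. t \<in> T \<Longrightarrow> c t \<in> carrier K \<and> h (c t) = f (h t) \<and>
      real (word_length K T (c t)) \<le> m" by metis
  have cT: "c ` T \<subseteq> carrier K" using c by auto
  have bound: "real (word_length K T (word_val K (map (apfst c) w))) \<le> real (length w) * m"
    if "w \<in> words T" for w
    using that
  proof (induction w rule: words_induct)
    case (Cons t b w)
    define a where "a = (if b then c t else inv\<^bsub>K\<^esub> c t)"
    have a: "a \<in> carrier K" "real (word_length K T a) \<le> m"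
      using c[OF Cons(1)] by (auto simp: a_def)
    have v: "word_val K (map (apfst c) w) \<in> carrier K"
      using K.word_val_in_carrier[OF map_apfst_words[OF Cons(2) order_refl] cT] .
    have "real (word_length K T (a \<otimes>\<^bsub>K\<^esub> word_val K (map (apfst c) w))) \<le> m + real (length w) * m"
      using K.word_length_mult[OF a(1) v] a(2) Cons(3) by linarith
    then show ?case by (simp add: a_def algebra_simps)
  qed simp
  have img: "h (word_val K (map (apfst c) w)) = f (h (word_val K w))" if w: "w \<in> words T" for w
  proof -
    have "map (apfst h) (map (apfst c) w) = map (apfst f) (map (apfst h) w)"
      using w c by (induction w rule: words_induct) auto
    moreover have "h ` T \<subseteq> carrier G" using image_generators G.generators_closed by simp
    ultimately show ?thesis
      using hom_word_val[OF map_apfst_words[OF w order_refl] cT] hom_word_val[OF w K.generators_closed]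
        f.hom_word_val[OF map_apfst_words[OF w order_refl]] by metis
  qed
  obtain F where F: "F \<in> hom K K" "\<And>t. t \<in> T \<Longrightarrow> F t = c t"
  proof -
    have "word_val K (map (apfst c) r) = \<one>\<^bsub>K\<^esub>" if r: "r \<in> R" for r
    proof (rule inj_radius_kernel)
      have w: "r \<in> words T" using pres r by (auto simp: is_presentation_def)
      show "word_val K (map (apfst c) r) \<in> carrier K"
        using K.word_val_in_carrier[OF map_apfst_words[OF w order_refl] cT] .
      have "presentation_eq T R r []" using presentation_eq.relator[of "[]" T "[]" r R] r by simp
      then have "word_val K r = word_val K []"
        using pres w words_simps(1) unfolding is_presentation_def by blast
      then show "h (word_val K (map (apfst c) r)) = \<one>\<^bsub>G\<^esub>" using img[OF w] by simp
      have "real (word_length K T (word_val K (map (apfst c) r))) \<le> l * m"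
        using bound[OF w] mult_right_mono[OF len[OF r] m] by linarith
      then show "ereal (real (word_length K T (word_val K (map (apfst c) r)))) <
          ereal_of_enat (inj_radius K T h)" using inj by (meson ereal_less_eq(3) le_less_trans)
    qed
    then show thesis using presentation_hom[OF pres K.is_group K.is_group cT] that by blast
  qed
  have "h (F x) = f (h x)" if x: "x \<in> carrier K" for x
  proof -
    have "(h \<circ> F) x = (f \<circ> h) x"
    proof (rule K.hom_eqI[OF G.is_group _ _ _ x])
      show "h \<circ> F \<in> hom K G" "f \<circ> h \<in> hom K G"
        using hom_compose[OF F(1) homh] hom_compose[OF homh f] by auto
    qed (use F(2) c in auto)
    then show ?thesis by simp
  qed
  then show ?thesis using F(1) by blast
qed

end

section \<open>The approximating sequence\<close>

context lacunary_hyperbolic_approximation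
begin

lemma generated_limit: "generated_group G S"
  using group_limit gen_limit
  by (simp add: generated_group_def generated_group_axioms_def finite_generating_set_def)

lemma generated_stage: "generated_group (Gs k) (Ss k)"
  using group_stage[of k] gen_stage[of k]
  by (simp add: generated_group_def generated_group_axioms_def finite_generating_set_def)

lemma eta_hom: "\<eta> k \<in> hom (Gs k) G" using direct_limit by (simp add: is_direct_limit_def)

lemma eta_epi: "generated_group_epi (Gs k) (Ss k) G S (\<eta> k)"
  using generated_stage generated_limit group_stage group_limit eta_hom limit_gen
  by (simp add: generated_group_epi_def generated_group_epi_axioms_def group_hom_def group_hom_axioms_def)

abbreviation stage_map :: "nat \<Rightarrow> 'b \<Rightarrow> 'b" where "stage_map \<equiv> iterated_map \<alpha> 0"

lemma stage_map_hom: "stage_map k \<in> hom (Gs 0) (Gs k)"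
proof (induction k)
  case (Suc k)
  have "\<alpha> k \<in> hom (Gs k) (Gs (Suc k))" using direct_limit by (simp add: is_direct_limit_def)
  from hom_compose[OF Suc this] show ?case by (simp add: comp_def)
qed (simp add: hom_def)

lemma stage_map_generators: "stage_map k ` Ss 0 = Ss k"
proof (induction k)
  case (Suc k)
  then show ?case using epi_gen[of k] by (metis add_0 image_comp iterated_map.simps(2))
qed simp

lemma stage_map_epi: "generated_group_epi (Gs 0) (Ss 0) (Gs k) (Ss k) (stage_map k)"
  using generated_stage group_stage stage_map_hom stage_map_generators
  by (simp add: generated_group_epi_def generated_group_epi_axioms_def group_hom_def group_hom_axioms_def)

lemma stage_map_eventually_eq:
  assumes "x \<in> carrier (Gs 0)" "y \<in> carrier (Gs 0)" "\<eta> 0 x = \<eta> 0 y"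
  shows "eventually (\<lambda>k. stage_map k x = stage_map k y) sequentially"
proof -
  obtain n where n: "stage_map n x = stage_map n y"
    using direct_limit assms unfolding is_direct_limit_def by blast
  have "stage_map k x = stage_map k y" if "n \<le> k" for k
    using that n by (induction k rule: dec_induct) auto
  then show ?thesis unfolding eventually_sequentially by blast
qed

text \<open>
  A lift to the initial stage, whose images under \<open>stage_map\<close> are compatible lifts to all stages. For
  two given elements these are multiplicative at late stages only, which is enough for an action on
  an ultralimit.
\<close>

definition preimage :: "'a \<Rightarrow> 'b" where
  "preimage g = (SOME x. x \<in> carrier (Gs 0) \<and> \<eta> 0 x = g)"

lemma preimage:
  assumes "g \<in> carrier G" shows "preimage g \<in> carrier (Gs 0)" "\<eta> 0 (preimage g) = g"
proof -
  have "\<exists>x. x \<in> carrier (Gs 0) \<and> \<eta> 0 x = g"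
    using generated_group_epi.lift_element[OF eta_epi assms] by blast
  from someI_ex[OF this] show "preimage g \<in> carrier (Gs 0)" "\<eta> 0 (preimage g) = g"
    unfolding preimage_def by auto
qed

lemma preimage_mult_eventually:
  assumes gh: "g \<in> carrier G" "h \<in> carrier G"
  shows "eventually (\<lambda>k. stage_map k (preimage (g \<otimes>\<^bsub>G\<^esub> h)) =
           stage_map k (preimage g) \<otimes>\<^bsub>Gs k\<^esub> stage_map k (preimage h)) sequentially"
proof -
  interpret G: group G by (rule group_limit)
  interpret G0: group "Gs 0" by (rule group_stage)
  have "eventually (\<lambda>k. stage_map k (preimage (g \<otimes>\<^bsub>G\<^esub> h)) =
      stage_map k (preimage g \<otimes>\<^bsub>Gs 0\<^esub> preimage h)) sequentially"
    using gh preimage hom_mult[OF eta_hom] by (intro stage_map_eventually_eq) auto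
  then show ?thesis
    using hom_mult[OF stage_map_hom] preimage gh by simp
qed

lemma preimage_one_eventually:
  "eventually (\<lambda>k. stage_map k (preimage \<one>\<^bsub>G\<^esub>) = \<one>\<^bsub>Gs k\<^esub>) sequentially"
proof -
  interpret G: group G by (rule group_limit)
  interpret G0: group "Gs 0" by (rule group_stage)
  have "eventually (\<lambda>k. stage_map k (preimage \<one>\<^bsub>G\<^esub>) = stage_map k \<one>\<^bsub>Gs 0\<^esub>) sequentially"
    using preimage[of "\<one>\<^bsub>G\<^esub>"] hom_one[OF eta_hom group_stage group_limit]
    by (intro stage_map_eventually_eq) auto
  then show ?thesis using hom_one[OF stage_map_hom group_stage group_stage] by simp
qed

lemma countable_limit: "countable (carrier G)"
proof -
  interpret G: generated_group G S by (rule generated_limit)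
  have "countable (words S)"
    unfolding words_def using gen_limit by (intro countable_lists countable_SIGMA countable_finite)
      (auto simp: finite_generating_set_def)
  moreover have "carrier G \<subseteq> word_val G ` words S" using G.word_exists by blast
  ultimately show ?thesis using countable_subset countable_image by blast
qed

text \<open>A homomorphism to the integers acts by translations on the real line, which is a tree.\<close>

lemma property_FR_no_integer_hom:
  assumes FR: "property_FR G" and \<kappa>: "\<kappa> \<in> hom G integer_group" and g: "g \<in> carrier G"
  shows "\<kappa> g = 0"
proof -
  interpret R: pseudo_tree "UNIV :: real set" "\<lambda>x y. \<bar>x - y\<bar>"
  proof
    fix x y t :: real assume "0 \<le> t" "t \<le> \<bar>x - y\<bar>"
    then show "\<exists>z\<in>UNIV. \<bar>x - z\<bar> = t \<and> \<bar>z - y\<bar> = \<bar>x - y\<bar> - t"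
      by (intro bexI[of _ "if x \<le> y then x + t else x - t"]) auto
  next
    fix x y z p :: real assume "\<bar>x - p\<bar> + \<bar>p - y\<bar> = \<bar>x - y\<bar>"
    then show "\<bar>y - p\<bar> + \<bar>p - z\<bar> = \<bar>y - z\<bar> \<or> \<bar>z - p\<bar> + \<bar>p - x\<bar> = \<bar>z - x\<bar>"
      by (smt (verit))
  qed simp_all
  have one: "\<kappa> \<one>\<^bsub>G\<^esub> = 0"
    using hom_one[OF \<kappa> group_limit group_integer_group] by (simp add: one_integer_group)
  have mult: "\<kappa> (x \<otimes>\<^bsub>G\<^esub> y) = \<kappa> x + \<kappa> y" if "x \<in> carrier G" "y \<in> carrier G" for x y
    using hom_mult[OF \<kappa> that] by (simp add: mult_integer_group)
  obtain x :: real where "\<And>g. g \<in> carrier G \<Longrightarrow> \<bar>x + real_of_int (\<kappa> g) - x\<bar> = 0"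
    using R.property_FR_fixed_point[OF FR group_limit countable_limit,
        of "\<lambda>g x. x + real_of_int (\<kappa> g)"] one mult by auto
  then show ?thesis using g by simp
qed

text \<open>
  Where \<open>\<delta> k < 1 / 10\<close>, the \<open>k\<close>-th group is free on its generators, so it has the exponent sum as a
  homomorphism to the integers. If this happens for infinitely many \<open>k\<close>, then the exponent sum is
  defined on the limit and nonzero on the generators, which property (FR) excludes. The lower
  bound is what makes the discreteness of the word metrics negligible after rescaling.
\<close>

lemma delta_bounded_below:
  assumes FR: "property_FR G" and S: "S \<noteq> {}"
  shows "eventually (\<lambda>k. 1 / 10 \<le> \<delta> k) sequentially"
proof (rule ccontr)
  assume "\<not> ?thesis"
  then have freq: "frequently (\<lambda>k. \<delta> k < 1 / 10) sequentially"
    by (simp add: not_eventually not_le)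
  interpret G0: generated_group "Gs 0" "Ss 0" by (rule generated_stage)
  interpret G: group G by (rule group_limit)
  interpret E: generated_group_epi "Gs 0" "Ss 0" G S "\<eta> 0" by (rule eta_epi)
  have free: "\<exists>\<epsilon>\<in>hom (Gs k) integer_group. \<forall>s\<in>Ss k. \<epsilon> s = 1" if "\<delta> k < 1 / 10" for k
  proof -
    obtain R where R: "is_presentation (Gs k) (Ss k) R" "\<And>r. r \<in> R \<Longrightarrow> real (length r) \<le> 10 * \<delta> k"
      using short_presentation[of k] by blast
    \<comment> \<open>a relator has length less than \<open>1\<close>, hence is empty\<close>
    have empty: "r = []" if "r \<in> R" for r
      using R(2)[OF that] \<open>\<delta> k < 1 / 10\<close> by (cases r) auto
    have "word_val integer_group (map (apfst (\<lambda>_. 1)) r) = \<one>\<^bsub>integer_group\<^esub>" if "r \<in> R" for r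
      unfolding empty[OF that] by simp
    then show ?thesis
      by (intro presentation_hom[OF R(1) group_stage group_integer_group]) auto
  qed
  then obtain \<epsilon> where \<epsilon>: "\<And>k. \<delta> k < 1 / 10 \<Longrightarrow>
      \<epsilon> k \<in> hom (Gs k) integer_group \<and> (\<forall>s\<in>Ss k. \<epsilon> k s = 1)" by metis
  obtain k0 where k0: "\<delta> k0 < 1 / 10" using freq frequently_ex by blast
  define e where "e = \<epsilon> k0 \<circ> stage_map k0"
  have hom_e: "\<epsilon> k \<circ> stage_map k \<in> hom (Gs 0) integer_group" if "\<delta> k < 1 / 10" for k
    using hom_compose[OF stage_map_hom] \<epsilon>[OF that] by blast
  have gen_e: "(\<epsilon> k \<circ> stage_map k) s = 1" if "\<delta> k < 1 / 10" "s \<in> Ss 0" for k s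
    using \<epsilon>[OF that(1)] stage_map_generators[of k] that(2) by auto
  have e_eq: "(\<epsilon> k \<circ> stage_map k) x = e x" if "\<delta> k < 1 / 10" "x \<in> carrier (Gs 0)" for k x
    unfolding e_def
    by (rule G0.hom_eqI[OF group_integer_group hom_e hom_e _ that(2)]) (use gen_e that k0 in auto)
  \<comment> \<open>elements with the same image in the limit agree at a late stage where the exponent sum exists\<close>
  have e_cong: "e x = e y" if xy: "x \<in> carrier (Gs 0)" "y \<in> carrier (Gs 0)" "\<eta> 0 x = \<eta> 0 y" for x y
  proof -
    obtain k where k: "\<delta> k < 1 / 10" "stage_map k x = stage_map k y"
      using frequently_ex[OF frequently_eventually_frequently[OF freq stage_map_eventually_eq[OF xy]]]
      by blast
    then show ?thesis using e_eq[OF k(1) xy(1)] e_eq[OF k(1) xy(2)] by simp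
  qed
  have e_hom: "e \<in> hom (Gs 0) integer_group" using hom_e[OF k0] by (simp add: e_def)
  have "(\<lambda>g. e (preimage g)) \<in> hom G integer_group"
  proof (rule homI)
    fix g h assume gh: "g \<in> carrier G" "h \<in> carrier G"
    show "e (preimage g) \<in> carrier integer_group" by (simp add: integer_group_def)
    have "e (preimage (g \<otimes>\<^bsub>G\<^esub> h)) = e (preimage g \<otimes>\<^bsub>Gs 0\<^esub> preimage h)"
      using gh preimage hom_mult[OF eta_hom] by (intro e_cong) auto
    then show "e (preimage (g \<otimes>\<^bsub>G\<^esub> h)) = e (preimage g) \<otimes>\<^bsub>integer_group\<^esub> e (preimage h)"
      using hom_mult[OF e_hom] preimage gh by simp
  qed
  from property_FR_no_integer_hom[OF FR this] have zero: "e (preimage g) = 0" if "g \<in> carrier G" for g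
    using that by blast
  obtain s where s: "s \<in> Ss 0" using S limit_gen[of 0] by blast
  then have sG: "s \<in> carrier (Gs 0)" using G0.generators_closed by auto
  have "e s = e (preimage (\<eta> 0 s))" using sG preimage[of "\<eta> 0 s"] by (intro e_cong) auto
  then show False using zero[of "\<eta> 0 s"] gen_e[OF k0 s] sG by (simp add: e_def)
qed

end

section \<open>Displacement of endomorphisms of the approximating groups\<close>

text \<open>
  Conjugating by a point where the displacement is minimal moves that point to \<open>\<one>\<close>. This normalises
  an endomorphism so that its values on the generators are no longer than the displacement of any point.
\<close>

lemma (in generated_group) minimal_displacement:
  assumes fin: "finite S" "S \<noteq> {}" and \<phi>: "\<phi> \<in> hom G G"
    and big: "\<And>x. x \<in> carrier G \<Longrightarrow> \<exists>s\<in>S. B < real (word_dist G S x (\<phi> s \<otimes> x))"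
  shows "\<exists>\<psi>\<in>hom G G. \<exists>m :: nat. B < real m \<and> (\<forall>s\<in>S. word_length G S (\<psi> s) \<le> m) \<and>
           (\<forall>x\<in>carrier G. \<exists>s\<in>S. m \<le> word_dist G S x (\<psi> s \<otimes> x))"
proof -
  interpret \<phi>: group_hom G G \<phi> by unfold_locales (rule \<phi>)
  define disp where "disp = (\<lambda>x. Max ((\<lambda>s. word_dist G S x (\<phi> s \<otimes> x)) ` S))"
  have ge: "word_dist G S x (\<phi> s \<otimes> x) \<le> disp x" if "s \<in> S" for s x
    unfolding disp_def using fin that by (intro Max_ge) auto
  have attained: "\<exists>s\<in>S. disp x = word_dist G S x (\<phi> s \<otimes> x)" for x
  proof -
    have "disp x \<in> (\<lambda>s. word_dist G S x (\<phi> s \<otimes> x)) ` S"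
      unfolding disp_def using fin by (intro Max_in) auto
    then show ?thesis by auto
  qed
  obtain a where a: "a \<in> carrier G" "\<And>y. y \<in> carrier G \<Longrightarrow> disp a \<le> disp y"
    using ex_has_least_nat[of "\<lambda>x. x \<in> carrier G" \<one> disp] by auto
  define \<psi> where "\<psi> = (\<lambda>g. inv a \<otimes> (\<phi> g \<otimes> a))"
  have "\<psi> \<in> hom G G"
    unfolding \<psi>_def using a(1) by (intro homI) (auto simp: m_assoc)
  moreover have "B < real (disp a)"
    using big[OF a(1)] ge by (meson less_le_trans of_nat_le_iff)
  moreover have "word_length G S (\<psi> s) \<le> disp a" if "s \<in> S" for s
    using ge[OF that, of a] by (simp add: \<psi>_def word_dist_def)
  moreover have "\<exists>s\<in>S. disp a \<le> word_dist G S x (\<psi> s \<otimes> x)" if x: "x \<in> carrier G" for x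
  proof -
    obtain s where s: "s \<in> S" "disp (a \<otimes> x) = word_dist G S (a \<otimes> x) (\<phi> s \<otimes> (a \<otimes> x))"
      using attained by blast
    have sG: "s \<in> carrier G" using s generators_closed by auto
    have "\<phi> s \<otimes> (a \<otimes> x) = a \<otimes> (\<psi> s \<otimes> x)"
      using a(1) x sG by (simp add: \<psi>_def m_assoc)
    then have "disp (a \<otimes> x) = word_dist G S x (\<psi> s \<otimes> x)"
      using s(2) word_dist_translate[OF a(1) x, of "\<psi> s \<otimes> x"] a(1) x sG by (simp add: \<psi>_def)
    then show ?thesis using a(2)[of "a \<otimes> x"] a(1) x s(1) by auto
  qed
  ultimately show ?thesis by blast
qed

context lacunary_hyperbolic_approximation
begin

text \<open>
  The error \<open>(\<delta> + 1) / m\<close> tends to \<open>0\<close>: as \<open>\<delta> \<ge> 1 / 10\<close>, its numerator is at most \<open>11 * \<delta>\<close>,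
  and \<open>m\<close> is larger than \<open>(n + 1) * \<delta>\<close>.
\<close>

lemma rescaled_stages_thin:
  assumes U: "ultrafilter U" "U \<le> sequentially"
    and \<delta>: "\<And>n. 1 / 10 \<le> \<delta> (k n)" and m: "\<And>n. real (n + 1) * \<delta> (k n) < real (m n)"
  shows "asymptotically_thin_spaces U (\<lambda>n. carrier (Gs (k n)))
           (\<lambda>n x y. real (word_dist (Gs (k n)) (Ss (k n)) x y) / real (m n))
           (\<lambda>n. \<one>\<^bsub>Gs (k n)\<^esub>) (\<lambda>n. (\<delta> (k n) + 1) / real (m n))"
proof
  have gen: "generated_group (Gs j) (Ss j)" for j by (rule generated_stage)
  have grp: "group (Gs j)" for j by (rule group_stage)
  have pos: "0 < real (m n)" for n
  proof -
    have "0 < real (n + 1) * \<delta> (k n)" using delta_pos by simp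
    then show ?thesis using m[of n] by linarith
  qed
  have add_div: "a / real (m n) + b / real (m n) = c / real (m n) \<longleftrightarrow> a + b = c" for a b c n
    using pos[of n] by (simp add: add_divide_distrib[symmetric])
  have add_div_le: "c / real (m n) \<le> a / real (m n) + b / real (m n) \<longleftrightarrow> c \<le> a + b" for a b c n
    using pos[of n] by (simp add: add_divide_distrib[symmetric] divide_le_cancel)
  show "ultrafilter U" by fact
  show "filterlim (\<lambda>n. (\<delta> (k n) + 1) / real (m n)) (nhds 0) U"
  proof (rule tendsto_mono[OF U(2)], rule tendsto_sandwich[of "\<lambda>_. 0" _ _ "\<lambda>n. 11 / real (n + 1)"])
    show "eventually (\<lambda>n. 0 \<le> (\<delta> (k n) + 1) / real (m n)) sequentially"
      using delta_pos by (simp add: add_nonneg_nonneg less_imp_le)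
    have "(\<delta> (k n) + 1) / real (m n) \<le> 11 / real (n + 1)" for n
    proof -
      have "(\<delta> (k n) + 1) * real (n + 1) \<le> 11 * (real (n + 1) * \<delta> (k n))"
        using mult_right_mono[of "\<delta> (k n) + 1" "11 * \<delta> (k n)" "real (n + 1)"] \<delta>[of n]
        by (simp add: algebra_simps)
      also have "\<dots> \<le> 11 * real (m n)" using m[of n] by simp
      finally show ?thesis using pos[of n] by (simp add: field_simps)
    qed
    then show "eventually (\<lambda>n. (\<delta> (k n) + 1) / real (m n) \<le> 11 / real (n + 1)) sequentially"
      by simp
    show "filterlim (\<lambda>n. 11 / real (n + 1)) (nhds 0) sequentially"
      using LIMSEQ_Suc[OF lim_const_over_n[of "11 :: real"]] by simp
  qed simp
  show "\<one>\<^bsub>Gs (k n)\<^esub> \<in> carrier (Gs (k n))" for n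
    using grp by (simp add: group.is_monoid)
  fix n x y assume xy: "x \<in> carrier (Gs (k n))" "y \<in> carrier (Gs (k n))"
  let ?d = "word_dist (Gs (k n)) (Ss (k n))"
  show "0 \<le> real (?d x y) / real (m n)" by simp
  show "real (?d x x) / real (m n) = 0" using generated_group.word_dist_self[OF gen xy(1)] by simp
  show "real (?d x y) / real (m n) = real (?d y x) / real (m n)"
    using generated_group.word_dist_commute[OF gen xy] by simp
  show "\<exists>z\<in>carrier (Gs (k n)). real (?d x z) / real (m n) + real (?d z y) / real (m n) =
      real (?d x y) / real (m n) \<and> \<bar>real (?d x z) / real (m n) - t\<bar> \<le> (\<delta> (k n) + 1) / real (m n)"
    if t: "0 \<le> t" "t \<le> real (?d x y) / real (m n)" for t
  proof -
    define i where "i = nat \<lfloor>t * real (m n)\<rfloor>"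
    have "0 \<le> t * real (m n)" using t by simp
    then have "real i = real_of_int \<lfloor>t * real (m n)\<rfloor>" by (simp add: i_def)
    then have i: "real i \<le> t * real (m n)" "t * real (m n) < real i + 1" by linarith+
    have "t * real (m n) \<le> real (?d x y)" using t(2) pos[of n] by (simp add: pos_le_divide_eq)
    then have "i \<le> ?d x y" using i(1) by linarith
    then obtain z where z: "z \<in> carrier (Gs (k n))" "?d x z = i" "?d z y = ?d x y - i"
      using generated_group.word_dist_intermediate[OF gen xy] by blast
    have "\<bar>real i - t * real (m n)\<bar> / real (m n) \<le> (\<delta> (k n) + 1) / real (m n)"
      using i delta_pos[of "k n"] pos[of n] by (intro divide_right_mono) auto
    moreover have "\<bar>real i - t * real (m n)\<bar> / real (m n) = \<bar>(real i - t * real (m n)) / real (m n)\<bar>"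
      by simp
    moreover have "(real i - t * real (m n)) / real (m n) = real i / real (m n) - t"
      using pos[of n] by (simp add: field_simps)
    ultimately show ?thesis using z \<open>i \<le> ?d x y\<close> by (intro bexI[of _ z]) (auto simp: add_div)
  qed
  fix z assume z: "z \<in> carrier (Gs (k n))"
  show "real (?d x z) / real (m n) \<le> real (?d x y) / real (m n) + real (?d y z) / real (m n)"
    using generated_group.word_dist_triangle[OF gen xy z] by (simp add: add_div_le)
  fix p assume p: "p \<in> carrier (Gs (k n))"
    "real (?d x p) / real (m n) + real (?d p y) / real (m n) = real (?d x y) / real (m n)"
  then have "?d x p + ?d p y = ?d x y" unfolding add_div by linarith
  then obtain q where q: "q \<in> carrier (Gs (k n))" "real (?d p q) \<le> \<delta> (k n) + 1"
    "?d y q + ?d q z = ?d y z \<or> ?d z q + ?d q x = ?d z x"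
    using generated_group.word_metric_thin_triangles[OF gen cayley_hyperbolic xy z p(1)] by blast
  have "real (?d p q) / real (m n) \<le> (\<delta> (k n) + 1) / real (m n)"
    using q(2) by (intro divide_right_mono) auto
  moreover have "real (?d y q) + real (?d q z) = real (?d y z) \<or>
      real (?d z q) + real (?d q x) = real (?d z x)" using q(3) by linarith
  ultimately show "\<exists>q\<in>carrier (Gs (k n)). real (?d p q) / real (m n) \<le> (\<delta> (k n) + 1) / real (m n) \<and>
      (real (?d y q) / real (m n) + real (?d q z) / real (m n) = real (?d y z) / real (m n) \<or>
       real (?d z q) / real (m n) + real (?d q x) / real (m n) = real (?d z x) / real (m n))"
    using q(1) unfolding add_div by blast
qed

text \<open>
  The argument of Bestvina and Paulin. Endomorphisms with ever larger minimal displacement, compared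
  to \<open>\<delta>\<close>, twist the translation actions on the word metrics. Rescaled by the displacement, these
  converge to an action on a real tree. It is an action of the limit group, as every relation of
  the limit group already holds at all late stages. No point is fixed, as every point of a stage is
  moved by at least the scale.
\<close>

lemma uniform_displacement_bound:
  assumes FR: "property_FR G"
  shows "\<exists>A>0. eventually (\<lambda>k. \<forall>\<phi>\<in>hom (Gs k) (Gs k). \<exists>x\<in>carrier (Gs k). \<forall>s\<in>Ss k.
           real (word_dist (Gs k) (Ss k) x (\<phi> s \<otimes>\<^bsub>Gs k\<^esub> x)) \<le> A * \<delta> k) sequentially"
proof (cases "S = {}")
  case True
  then have "Ss k = {}" for k using limit_gen[of k] by simp
  moreover have "\<one>\<^bsub>Gs k\<^esub> \<in> carrier (Gs k)" for k using group_stage by (simp add: group.is_monoid)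
  ultimately show ?thesis
    by (intro exI[of _ 1] conjI always_eventually allI ballI bexI[of _ "\<one>\<^bsub>Gs _\<^esub>"]) auto
next
  case False
  show ?thesis
  proof (rule ccontr)
    assume contr: "\<not> ?thesis"
    have "\<exists>k \<psi> m. n \<le> k \<and> 1 / 10 \<le> \<delta> k \<and> \<psi> \<in> hom (Gs k) (Gs k) \<and> real (n + 1) * \<delta> k < real m \<and>
        (\<forall>s\<in>Ss k. word_length (Gs k) (Ss k) (\<psi> s) \<le> m) \<and>
        (\<forall>x\<in>carrier (Gs k). \<exists>s\<in>Ss k. m \<le> word_dist (Gs k) (Ss k) x (\<psi> s \<otimes>\<^bsub>Gs k\<^esub> x))" for n :: nat
    proof -
      have "frequently (\<lambda>k. \<exists>\<phi>\<in>hom (Gs k) (Gs k). \<forall>x\<in>carrier (Gs k). \<exists>s\<in>Ss k.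
          real (n + 1) * \<delta> k < real (word_dist (Gs k) (Ss k) x (\<phi> s \<otimes>\<^bsub>Gs k\<^esub> x))) sequentially"
        using contr[unfolded not_ex, THEN spec[of _ "real (n + 1)"]]
        by (simp add: not_eventually not_le)
      from frequently_ex[OF frequently_eventually_frequently[OF this
          eventually_conj[OF delta_bounded_below[OF FR False] eventually_ge_at_top[of n]]]]
      obtain k \<phi> where k: "1 / 10 \<le> \<delta> k" "n \<le> k" and \<phi>: "\<phi> \<in> hom (Gs k) (Gs k)"
        "\<And>x. x \<in> carrier (Gs k) \<Longrightarrow>
          \<exists>s\<in>Ss k. real (n + 1) * \<delta> k < real (word_dist (Gs k) (Ss k) x (\<phi> s \<otimes>\<^bsub>Gs k\<^esub> x))"
        by blast
      have "finite (Ss k)" "Ss k \<noteq> {}"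
        using gen_stage[of k] False limit_gen[of k] by (auto simp: finite_generating_set_def)
      from generated_group.minimal_displacement[OF generated_stage this \<phi>]
      show ?thesis using k by blast
    qed
    then obtain k \<psi> m where k: "\<And>n :: nat. n \<le> k n" "\<And>n. 1 / 10 \<le> \<delta> (k n)"
      and \<psi>: "\<And>n. \<psi> n \<in> hom (Gs (k n)) (Gs (k n))"
      and m: "\<And>n. real (n + 1) * \<delta> (k n) < real (m n)"
      and \<psi>_le: "\<And>n s. s \<in> Ss (k n) \<Longrightarrow> word_length (Gs (k n)) (Ss (k n)) (\<psi> n s) \<le> m n"
      and \<psi>_ge: "\<And>n x. x \<in> carrier (Gs (k n)) \<Longrightarrow>
        \<exists>s\<in>Ss (k n). m n \<le> word_dist (Gs (k n)) (Ss (k n)) x (\<psi> n s \<otimes>\<^bsub>Gs (k n)\<^esub> x)"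
      by metis
    obtain U :: "nat filter" where U: "ultrafilter U" "U \<le> sequentially"
      using ultrafilter_exists[of "sequentially"] by auto
    define d where "d = (\<lambda>n x y. real (word_dist (Gs (k n)) (Ss (k n)) x y) / real (m n))"
    interpret L: asymptotically_thin_spaces U "\<lambda>n. carrier (Gs (k n))" d
      "\<lambda>n. \<one>\<^bsub>Gs (k n)\<^esub>" "\<lambda>n. (\<delta> (k n) + 1) / real (m n)"
      unfolding d_def by (rule rescaled_stages_thin[OF U k(2) m])
    interpret T: pseudo_tree L.bounded_seqs L.ultradist by (rule L.pseudo_tree_ultradist)
    have pos: "0 < real (m n)" for n
    proof -
      have "0 < real (n + 1) * \<delta> (k n)" using delta_pos by simp
      then show ?thesis using m[of n] by linarith
    qed
    \<comment> \<open>what holds at all late stages holds for almost all of the chosen stages\<close>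
    have k_lim: "eventually (\<lambda>n. P (k n)) U" if "eventually P sequentially" for P
    proof -
      have "filterlim k at_top sequentially"
        using filterlim_at_top_mono[OF filterlim_ident, of k] k(1) by simp
      then show ?thesis using that U(2) unfolding filterlim_iff le_filter_def by blast
    qed
    define \<theta> where "\<theta> = (\<lambda>n g. \<psi> n (stage_map (k n) (preimage g)))"
    have \<theta>: "\<theta> n g \<in> carrier (Gs (k n))" if "g \<in> carrier G" for n g
      unfolding \<theta>_def using hom_in_carrier[OF \<psi>] hom_in_carrier[OF stage_map_hom] preimage that by blast
    define act where "act = (\<lambda>g x n. \<theta> n g \<otimes>\<^bsub>Gs (k n)\<^esub> x n)"
    have act_in: "act g x n \<in> carrier (Gs (k n))" if "g \<in> carrier G" "x \<in> L.bounded_seqs" for g x n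
    proof -
      interpret group "Gs (k n)" by (rule group_stage)
      show ?thesis using \<theta>[OF that(1)] L.bounded_seqs_in[OF that(2)] by (simp add: act_def)
    qed
    have \<theta>_length: "real (word_length (Gs (k n)) (Ss (k n)) (\<theta> n g)) \<le>
        real (m n) * real (word_length (Gs 0) (Ss 0) (preimage g))" if g: "g \<in> carrier G" for n g
    proof -
      have p: "preimage g \<in> carrier (Gs 0)" using preimage g by blast
      have "real (word_length (Gs (k n)) (Ss (k n)) (\<theta> n g)) \<le>
          real (m n) * real (word_length (Gs (k n)) (Ss (k n)) (stage_map (k n) (preimage g)))"
        unfolding \<theta>_def
        by (rule generated_group.hom_length_le[OF generated_stage generated_stage \<psi>])
          (use \<psi>_le hom_in_carrier[OF stage_map_hom p] in auto)
      also have "\<dots> \<le> real (m n) * real (word_length (Gs 0) (Ss 0) (preimage g))"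
        using generated_group_epi.word_length_image_le[OF stage_map_epi p]
        by (intro mult_left_mono) auto
      finally show ?thesis .
    qed
    have act_closed: "act g x \<in> L.bounded_seqs" if g: "g \<in> carrier G" and x: "x \<in> L.bounded_seqs" for g x
    proof -
      obtain C where C: "\<And>n. d n \<one>\<^bsub>Gs (k n)\<^esub> (x n) \<le> C" using x by (auto simp: L.bounded_seqs_def)
      have "d n \<one>\<^bsub>Gs (k n)\<^esub> (act g x n) \<le> real (word_length (Gs 0) (Ss 0) (preimage g)) + C" for n
      proof -
        interpret K: generated_group "Gs (k n)" "Ss (k n)" by (rule generated_stage)
        have xn: "x n \<in> carrier (Gs (k n))" using L.bounded_seqs_in[OF x] .
        have "word_length (Gs (k n)) (Ss (k n)) (act g x n) \<le>
            word_length (Gs (k n)) (Ss (k n)) (\<theta> n g) + word_length (Gs (k n)) (Ss (k n)) (x n)"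
          unfolding act_def using K.word_length_mult[OF \<theta>[OF g] xn] .
        then have "real (word_length (Gs (k n)) (Ss (k n)) (act g x n)) \<le>
            real (m n) * real (word_length (Gs 0) (Ss 0) (preimage g)) +
            real (word_length (Gs (k n)) (Ss (k n)) (x n))"
          using \<theta>_length[OF g, of n] by linarith
        then have "real (word_length (Gs (k n)) (Ss (k n)) (act g x n)) / real (m n) \<le>
            real (word_length (Gs 0) (Ss 0) (preimage g)) +
            real (word_length (Gs (k n)) (Ss (k n)) (x n)) / real (m n)"
          using pos[of n] by (simp add: field_simps)
        then show ?thesis using C[of n] act_in[OF g x] xn by (simp add: d_def)
      qed
      then show ?thesis using act_in[OF g x] by (auto simp: L.bounded_seqs_def)
    qed
    have act_iso: "L.ultradist (act g x) (act g y) = L.ultradist x y"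
      if g: "g \<in> carrier G" and x: "x \<in> L.bounded_seqs" and y: "y \<in> L.bounded_seqs" for g x y
    proof -
      have "d n (act g x n) (act g y n) = d n (x n) (y n)" for n
        using generated_group.word_dist_translate[OF generated_stage \<theta>[OF g] L.bounded_seqs_in[OF x]
            L.bounded_seqs_in[OF y], of n] by (simp add: d_def act_def)
      then show ?thesis by (simp add: L.ultradist_def)
    qed
    have act_one: "L.ultradist (act \<one>\<^bsub>G\<^esub> x) x = 0" if x: "x \<in> L.bounded_seqs" for x
    proof (rule L.ultradist_eventually_eq)
      show "act \<one>\<^bsub>G\<^esub> x \<in> L.bounded_seqs"
        using act_closed x group_limit by (simp add: group.is_monoid)
      show "eventually (\<lambda>n. act \<one>\<^bsub>G\<^esub> x n = x n) U"
        using k_lim[OF preimage_one_eventually]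
      proof eventually_elim
        case (elim n)
        interpret group "Gs (k n)" by (rule group_stage)
        show ?case using elim hom_one[OF \<psi> group_stage group_stage] L.bounded_seqs_in[OF x]
          by (simp add: act_def \<theta>_def)
      qed
    qed
    have act_mult: "L.ultradist (act (g \<otimes>\<^bsub>G\<^esub> h) x) (act g (act h x)) = 0"
      if g: "g \<in> carrier G" and h: "h \<in> carrier G" and x: "x \<in> L.bounded_seqs" for g h x
    proof (rule L.ultradist_eventually_eq)
      have gh: "g \<otimes>\<^bsub>G\<^esub> h \<in> carrier G" using g h group_limit by (simp add: group.is_monoid monoid.m_closed)
      show "act (g \<otimes>\<^bsub>G\<^esub> h) x \<in> L.bounded_seqs" using act_closed gh x by blast
      show "eventually (\<lambda>n. act (g \<otimes>\<^bsub>G\<^esub> h) x n = act g (act h x) n) U"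
        using k_lim[OF preimage_mult_eventually[OF g h]]
      proof eventually_elim
        case (elim n)
        interpret group "Gs (k n)" by (rule group_stage)
        have "\<theta> n (g \<otimes>\<^bsub>G\<^esub> h) = \<theta> n g \<otimes>\<^bsub>Gs (k n)\<^esub> \<theta> n h"
          unfolding \<theta>_def elim
          using hom_mult[OF \<psi>] hom_in_carrier[OF stage_map_hom] preimage g h by blast
        then show ?case using \<theta>[OF g] \<theta>[OF h] L.bounded_seqs_in[OF x] by (simp add: act_def m_assoc)
      qed
    qed
    obtain x where x: "x \<in> L.bounded_seqs" "\<And>g. g \<in> carrier G \<Longrightarrow> L.ultradist (act g x) x = 0"
      using T.property_FR_fixed_point[OF FR group_limit countable_limit act_closed act_iso act_one act_mult]
      by blast
    \<comment> \<open>as \<open>Ss 0\<close> is finite, one generator moves \<open>x n\<close> by at least the scale for almost all \<open>n\<close>\<close>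
    have "\<exists>t\<in>Ss 0. 1 \<le> d n (x n) (\<psi> n (stage_map (k n) t) \<otimes>\<^bsub>Gs (k n)\<^esub> x n)" for n
    proof -
      obtain s where "s \<in> Ss (k n)" "m n \<le> word_dist (Gs (k n)) (Ss (k n)) (x n) (\<psi> n s \<otimes>\<^bsub>Gs (k n)\<^esub> x n)"
        using \<psi>_ge[OF L.bounded_seqs_in[OF x(1)]] by blast
      moreover then obtain t where "t \<in> Ss 0" "s = stage_map (k n) t"
        using stage_map_generators[of "k n"] by blast
      ultimately show ?thesis using pos[of n] by (intro bexI[of _ t]) (auto simp: d_def)
    qed
    then obtain t where t: "t \<in> Ss 0"
      "eventually (\<lambda>n. 1 \<le> d n (x n) (\<psi> n (stage_map (k n) t) \<otimes>\<^bsub>Gs (k n)\<^esub> x n)) U"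
      using ultrafilter_finite_Bex[OF U(1), of "Ss 0"
          "\<lambda>t n. 1 \<le> d n (x n) (\<psi> n (stage_map (k n) t) \<otimes>\<^bsub>Gs (k n)\<^esub> x n)"] gen_stage[of 0]
      by (auto simp: finite_generating_set_def)
    define g where "g = \<eta> 0 t"
    have tG: "t \<in> carrier (Gs 0)" using t(1) gen_stage[of 0] by (auto simp: finite_generating_set_def)
    have g: "g \<in> carrier G" using hom_in_carrier[OF eta_hom tG] by (simp add: g_def)
    have "eventually (\<lambda>j. stage_map j (preimage g) = stage_map j t) sequentially"
      using preimage[OF g] tG by (intro stage_map_eventually_eq) (auto simp: g_def)
    from k_lim[OF this] t(2) have "eventually (\<lambda>n. 1 \<le> d n (x n) (act g x n)) U"
      by eventually_elim (simp add: act_def \<theta>_def)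
    then have "1 \<le> L.ultradist x (act g x)"
      by (intro tendsto_lowerbound[OF L.tendsto_ultradist[OF x(1) act_closed[OF g x(1)]] _ L.not_bot])
    then show False using x(2)[OF g] T.D_commute[OF x(1) act_closed[OF g x(1)]] by simp
  qed
qed

end

section \<open>Norms of outer automorphisms\<close>

context group
begin

lemma inner_aut_auto: "g \<in> carrier G \<Longrightarrow> inner_aut G g \<in> auto G"
  using hom_in_carrier[OF inner_aut_hom] by (simp add: AutoGroup_def)

lemma Out_elements:
  assumes \<Phi>: "\<Phi> \<in> carrier (Out G)"
  shows "\<Phi> \<noteq> {}" "\<Phi> \<subseteq> auto G"
    "\<phi> \<in> \<Phi> \<Longrightarrow> g \<in> carrier G \<Longrightarrow> compose (carrier G) (inner_aut G g) \<phi> \<in> \<Phi>"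
proof -
  interpret Aut: group "AutoGroup G" by (rule AutoGroup)
  interpret N: normal "Inn G" "AutoGroup G" by (rule Inn_normal)
  have car: "carrier (AutoGroup G) = auto G" by (simp add: AutoGroup_def)
  obtain \<psi> where \<psi>: "\<psi> \<in> auto G" "\<Phi> = Inn G #>\<^bsub>AutoGroup G\<^esub> \<psi>"
    using \<Phi> by (auto simp: Out_def carrier_FactGroup car)
  show "\<Phi> \<noteq> {}" unfolding \<psi>(2) r_coset_def using N.one_closed by blast
  show sub: "\<Phi> \<subseteq> auto G" using Aut.r_coset_subset_G[OF N.subset] \<psi> by (simp add: car)
  assume \<phi>: "\<phi> \<in> \<Phi>" and g: "g \<in> carrier G"
  obtain i where i: "i \<in> Inn G" "\<phi> = i \<otimes>\<^bsub>AutoGroup G\<^esub> \<psi>"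
    using \<phi> by (auto simp: \<psi>(2) r_coset_def)
  have ig: "inner_aut G g \<in> Inn G" using g by (simp add: Inn_def)
  have "inner_aut G g \<otimes>\<^bsub>AutoGroup G\<^esub> \<phi> = (inner_aut G g \<otimes>\<^bsub>AutoGroup G\<^esub> i) \<otimes>\<^bsub>AutoGroup G\<^esub> \<psi>"
    unfolding i(2) using Aut.m_assoc[of "inner_aut G g" i \<psi>] N.mem_carrier[OF ig] N.mem_carrier[OF i(1)] \<psi>(1)
    by (simp only: car)
  moreover have "inner_aut G g \<otimes>\<^bsub>AutoGroup G\<^esub> i \<in> Inn G" by (rule N.m_closed[OF ig i(1)])
  ultimately have "inner_aut G g \<otimes>\<^bsub>AutoGroup G\<^esub> \<phi> \<in> \<Phi>"
    unfolding \<psi>(2) r_coset_def by blast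
  then show "compose (carrier G) (inner_aut G g) \<phi> \<in> \<Phi>"
    using AutoGroup_mult[OF inner_aut_auto[OF g], of \<phi>] \<phi> sub by auto
qed

lemma Out_mult_mem:
  assumes "\<Phi> \<in> carrier (Out G)" "\<Psi> \<in> carrier (Out G)" "\<phi> \<in> \<Phi>" "\<psi> \<in> \<Psi>"
  shows "compose (carrier G) \<phi> \<psi> \<in> \<Phi> \<otimes>\<^bsub>Out G\<^esub> \<Psi>"
proof -
  have "\<phi> \<in> auto G" "\<psi> \<in> auto G" using Out_elements(2) assms by blast+
  then have "compose (carrier G) \<phi> \<psi> = \<phi> \<otimes>\<^bsub>AutoGroup G\<^esub> \<psi>" by (simp add: AutoGroup_mult)
  then show ?thesis using assms by (auto simp: Out_def set_mult_def)
qed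

end

text \<open>
  The infimum in the norm is attained, being one of natural numbers, and at an element of \<open>\<Phi>\<close>, since \<open>\<Phi>\<close>
  contains the composites of its elements with inner automorphisms.
\<close>

lemma (in generated_group) out_norm_le_iff:
  assumes fin: "finite S" and \<Phi>: "\<Phi> \<in> carrier (Out G)" and r: "0 \<le> r"
  shows "real (out_norm G S \<Phi>) \<le> r \<longleftrightarrow> (\<exists>\<phi>\<in>\<Phi>. \<forall>s\<in>S. real (word_length G S (\<phi> s)) \<le> r)"
proof
  assume le: "real (out_norm G S \<Phi>) \<le> r"
  obtain \<phi> where \<phi>: "\<phi> \<in> \<Phi>" using Out_elements(1)[OF \<Phi>] by blast
  have "out_norm G S \<Phi> \<in> (\<lambda>g. endo_length G S (inner_aut G g \<circ> \<phi>)) ` carrier G"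
    unfolding out_norm_eq[OF generators_closed \<Phi> \<phi>] endo_norm_def by (rule Inf_nat_def1) auto
  then obtain g where g: "g \<in> carrier G" "out_norm G S \<Phi> = endo_length G S (inner_aut G g \<circ> \<phi>)"
    by blast
  have "real (word_length G S (compose (carrier G) (inner_aut G g) \<phi> s)) \<le> r" if s: "s \<in> S" for s
  proof -
    have "word_length G S ((inner_aut G g \<circ> \<phi>) s) \<le> endo_length G S (inner_aut G g \<circ> \<phi>)"
      unfolding endo_length_def using fin s by (intro Max_ge) auto
    moreover have "s \<in> carrier G" using s generators_closed by auto
    ultimately show ?thesis using g(2) le by (simp add: compose_def)
  qed
  then show "\<exists>\<phi>\<in>\<Phi>. \<forall>s\<in>S. real (word_length G S (\<phi> s)) \<le> r"
    using Out_elements(3)[OF \<Phi> \<phi> g(1)] by blast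
next
  assume "\<exists>\<phi>\<in>\<Phi>. \<forall>s\<in>S. real (word_length G S (\<phi> s)) \<le> r"
  then obtain \<phi> where \<phi>: "\<phi> \<in> \<Phi>" "\<And>s. s \<in> S \<Longrightarrow> real (word_length G S (\<phi> s)) \<le> r" by blast
  have "\<phi> \<in> hom G G" using Out_elements(2)[OF \<Phi>] \<phi>(1) by (auto simp: auto_def)
  from hom_in_carrier[OF this] have \<phi>S: "\<phi> s \<in> carrier G" if "s \<in> S" for s
    using subsetD[OF generators_closed that] by blast
  have "endo_length G S (inner_aut G \<one> \<circ> \<phi>) \<in>
      insert 0 ((\<lambda>s. word_length G S ((inner_aut G \<one> \<circ> \<phi>) s)) ` S)"
    unfolding endo_length_def using fin by (intro Max_in) auto
  then have "real (endo_length G S (inner_aut G \<one> \<circ> \<phi>)) \<le> r"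
    using \<phi>(2) \<phi>S r by (auto simp: inner_aut_def)
  moreover have "out_norm G S \<Phi> \<le> endo_length G S (inner_aut G \<one> \<circ> \<phi>)"
    unfolding out_norm_eq[OF generators_closed \<Phi> \<phi>(1)] endo_norm_def
    by (rule cINF_lower) auto
  ultimately show "real (out_norm G S \<Phi>) \<le> r" by linarith
qed

text \<open>
  The displacement of \<open>x\<close> under the lift is the length of a conjugate of the lift, and the map to the
  limit does not increase lengths.
\<close>

lemma (in generated_group_epi) out_norm_le_of_lift:
  assumes fin: "finite S" and \<Phi>: "\<Phi> \<in> carrier (Out G)" and f: "f \<in> \<Phi>" and r: "0 \<le> r"
    and F: "F \<in> hom K K" "\<And>x. x \<in> carrier K \<Longrightarrow> h (F x) = f (h x)"
    and x: "x \<in> carrier K" "\<And>t. t \<in> T \<Longrightarrow> real (word_dist K T x (F t \<otimes>\<^bsub>K\<^esub> x)) \<le> r"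
  shows "real (out_norm G S \<Phi>) \<le> r"
  unfolding G.out_norm_le_iff[OF fin \<Phi> r]
proof (intro bexI ballI)
  show "compose (carrier G) (inner_aut G (inv\<^bsub>G\<^esub> (h x))) f \<in> \<Phi>"
    using G.Out_elements(3)[OF \<Phi> f] x(1) by simp
  fix s assume s: "s \<in> S"
  then obtain t where t: "t \<in> T" "h t = s" using image_generators by blast
  have tK: "t \<in> carrier K" using t K.generators_closed by auto
  have Ft: "F t \<in> carrier K" using hom_in_carrier[OF F(1) tK] .
  have sG: "s \<in> carrier G" using s G.generators_closed by auto
  have "f s = h (F t)" using F(2)[OF tK] t by simp
  then have "compose (carrier G) (inner_aut G (inv\<^bsub>G\<^esub> (h x))) f s = h (inv\<^bsub>K\<^esub> x \<otimes>\<^bsub>K\<^esub> (F t \<otimes>\<^bsub>K\<^esub> x))"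
    using sG x(1) Ft by (simp add: compose_def inner_aut_def G.m_assoc)
  then show "real (word_length G S (compose (carrier G) (inner_aut G (inv\<^bsub>G\<^esub> (h x))) f s)) \<le> r"
    using word_length_image_le[of "inv\<^bsub>K\<^esub> x \<otimes>\<^bsub>K\<^esub> (F t \<otimes>\<^bsub>K\<^esub> x)"] x(2)[OF t(1)] x(1) Ft
    by (simp add: word_dist_def)
qed

theorem corollary3p14:
  fixes G :: "'a monoid" and S :: "'a set"
    and Gs :: "nat \<Rightarrow> 'b monoid" and Ss :: "nat \<Rightarrow> 'b set"
    and \<alpha> :: "nat \<Rightarrow> 'b \<Rightarrow> 'b" and \<eta> :: "nat \<Rightarrow> 'b \<Rightarrow> 'a" and \<delta> :: "nat \<Rightarrow> real"
  assumes "lacunary_hyperbolic_approximation G S Gs Ss \<alpha> \<eta> \<delta>"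
    and "property_FR G"
    and "(\<lambda>k. ereal_of_enat (inj_radius (Gs k) (Ss k) (\<eta> k)) / ereal (\<delta> k ^ 3)) \<longlonglongrightarrow> \<infinity>"
  shows "\<exists>A::real. A > 0 \<and> (\<forall>\<^sub>F k in sequentially.
           subgroup
             {\<Phi> \<in> carrier (Out G).
                real (max (out_norm G S \<Phi>) (out_norm G S (inv\<^bsub>Out G\<^esub> \<Phi>))) \<le> A * \<delta> k}
             (Out G))"
proof -
  interpret lacunary_hyperbolic_approximation G S Gs Ss \<alpha> \<eta> \<delta> by fact
  interpret G: generated_group G S by (rule generated_limit)
  interpret O: group "Out G" by (rule G.group_Out)
  have fin: "finite S" using gen_limit by (simp add: finite_generating_set_def)
  obtain A where A: "A > 0" and bound: "eventually (\<lambda>k. \<forall>\<phi>\<in>hom (Gs k) (Gs k). \<exists>x\<in>carrier (Gs k).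
      \<forall>s\<in>Ss k. real (word_dist (Gs k) (Ss k) x (\<phi> s \<otimes>\<^bsub>Gs k\<^esub> x)) \<le> A * \<delta> k) sequentially"
    using uniform_displacement_bound[OF assms(2)] by blast
  have "eventually (\<lambda>k. ereal (10 * A ^ 2) <
      ereal_of_enat (inj_radius (Gs k) (Ss k) (\<eta> k)) / ereal (\<delta> k ^ 3)) sequentially"
    using assms(3) by (simp add: tendsto_PInfty)
  with bound have "eventually (\<lambda>k. subgroup {\<Phi> \<in> carrier (Out G).
      real (max (out_norm G S \<Phi>) (out_norm G S (inv\<^bsub>Out G\<^esub> \<Phi>))) \<le> A * \<delta> k} (Out G)) sequentially"
  proof eventually_elim
    case (elim k)
    interpret E: generated_group_epi "Gs k" "Ss k" G S "\<eta> k" by (rule eta_epi)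
    let ?r = "A * \<delta> k"
    have r: "0 \<le> ?r" using A delta_pos[of k] by simp
    have "ereal (\<delta> k ^ 3) * ereal (10 * A ^ 2) < ereal_of_enat (inj_radius (Gs k) (Ss k) (\<eta> k))"
      using elim(2) delta_pos[of k] by (subst (asm) ereal_less_divide_pos) auto
    then have inj: "ereal (10 * \<delta> k * (?r * ?r)) < ereal_of_enat (inj_radius (Gs k) (Ss k) (\<eta> k))"
      by (simp add: power2_eq_square power3_eq_cube mult_ac)
    have norm_le: "real (out_norm G S \<Phi>) \<le> ?r"
      if "\<Phi> \<in> carrier (Out G)" "f \<in> \<Phi>" "F \<in> hom (Gs k) (Gs k)"
        "\<And>x. x \<in> carrier (Gs k) \<Longrightarrow> \<eta> k (F x) = f (\<eta> k x)" for \<Phi> f F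
      using elim(1) E.out_norm_le_of_lift[OF fin that(1,2) r that(3,4)] that(3) by blast
    \<comment> \<open>the composite has length at most \<open>?r * ?r\<close>; with relators of length \<open>10 * \<delta> k\<close> it lifts because
      the injectivity radius exceeds a multiple of the cube of \<open>\<delta> k\<close>\<close>
    have mult: "real (out_norm G S (\<Phi> \<otimes>\<^bsub>Out G\<^esub> \<Psi>)) \<le> ?r"
      if \<Phi>: "\<Phi> \<in> carrier (Out G)" "real (out_norm G S \<Phi>) \<le> ?r"
        and \<Psi>: "\<Psi> \<in> carrier (Out G)" "real (out_norm G S \<Psi>) \<le> ?r" for \<Phi> \<Psi>
    proof -
      obtain \<phi> where \<phi>: "\<phi> \<in> \<Phi>" "\<And>s. s \<in> S \<Longrightarrow> real (word_length G S (\<phi> s)) \<le> ?r"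
        using \<Phi>(2) unfolding G.out_norm_le_iff[OF fin \<Phi>(1) r] by blast
      obtain \<psi> where \<psi>: "\<psi> \<in> \<Psi>" "\<And>s. s \<in> S \<Longrightarrow> real (word_length G S (\<psi> s)) \<le> ?r"
        using \<Psi>(2) unfolding G.out_norm_le_iff[OF fin \<Psi>(1) r] by blast
      have hom: "\<phi> \<in> hom G G" "\<psi> \<in> hom G G"
        using G.Out_elements(2) \<Phi>(1) \<Psi>(1) \<phi>(1) \<psi>(1) by (auto simp: auto_def)
      define f where "f = compose (carrier G) \<phi> \<psi>"
      have f: "f \<in> \<Phi> \<otimes>\<^bsub>Out G\<^esub> \<Psi>"
        unfolding f_def by (rule G.Out_mult_mem[OF \<Phi>(1) \<Psi>(1) \<phi>(1) \<psi>(1)])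
      have \<Phi>\<Psi>: "\<Phi> \<otimes>\<^bsub>Out G\<^esub> \<Psi> \<in> carrier (Out G)" using \<Phi> \<Psi> by simp
      have "f \<in> hom G G" using G.Out_elements(2)[OF \<Phi>\<Psi>] f by (auto simp: auto_def)
      moreover have "real (word_length G S (f s)) \<le> ?r * ?r" if s: "s \<in> S" for s
      proof -
        have sG: "s \<in> carrier G" using s G.generators_closed by auto
        have "real (word_length G S (\<phi> (\<psi> s))) \<le> ?r * real (word_length G S (\<psi> s))"
          by (rule G.hom_length_le[OF generated_limit hom(1) r \<phi>(2) hom_in_carrier[OF hom(2) sG]])
        also have "\<dots> \<le> ?r * ?r" using \<psi>(2)[OF s] r by (rule mult_left_mono)
        finally show ?thesis using sG by (simp add: f_def compose_def)
      qed
      moreover obtain R where R: "is_presentation (Gs k) (Ss k) R"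
        "\<And>r. r \<in> R \<Longrightarrow> real (length r) \<le> 10 * \<delta> k"
        using short_presentation[of k] by blast
      ultimately have "\<exists>F\<in>hom (Gs k) (Gs k). \<forall>x\<in>carrier (Gs k). \<eta> k (F x) = f (\<eta> k x)"
        by (intro E.lift_endomorphism[OF R _ _ _ inj]) (use r in auto)
      then show ?thesis using norm_le[OF \<Phi>\<Psi> f] by blast
    qed
    have one: "real (out_norm G S \<one>\<^bsub>Out G\<^esub>) \<le> ?r"
    proof (rule norm_le[OF O.one_closed, of "inner_aut G \<one>\<^bsub>G\<^esub>" "\<lambda>x. x"])
      show "inner_aut G \<one>\<^bsub>G\<^esub> \<in> \<one>\<^bsub>Out G\<^esub>" by (auto simp: Out_def Inn_def)
      show "\<eta> k x = inner_aut G \<one>\<^bsub>G\<^esub> (\<eta> k x)" if "x \<in> carrier (Gs k)" for x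
        using that by (simp add: inner_aut_def)
    qed (simp add: hom_def)
    show ?case
    proof (rule O.subgroupI)
      show "{\<Phi> \<in> carrier (Out G).
          real (max (out_norm G S \<Phi>) (out_norm G S (inv\<^bsub>Out G\<^esub> \<Phi>))) \<le> ?r} \<noteq> {}"
        using one O.one_closed O.inv_one by fastforce
    qed (use mult O.inv_mult_group in \<open>auto simp: of_nat_max\<close>)
  qed
  then show ?thesis using A by blast
qed

end
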